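(* Let $k$ be a field, $q\in k$ a nonzero element of infinite multiplicative order, and $$A=k\langle x,y,z\rangle/\langle x^2,\ y^2,\ z^2,\ yz,\ xy+qyx,\ xz-zx,\ zy-zx\rangle .$$ For $c\in k$ let $M(1,-q,c)={}_AA/[A(x-qy+cz)+\mathrm{soc}\,A]=A\bar1$, and let $\Lambda=T_2(A)=\begin{pmatrix}A&A\\0&A\end{pmatrix}$. For all $c\in k$, the $T_2(A)$-modules $$X(c):=\binom{{}_AA}{M(1,-q,c)}_{f_1},$$ where $f_1:M(1,-q,c)\to A$ is the left $A$-map given by $f_1(\bar1)=x-y$, are double semi-Gorenstein-projective, but not monic, and hence not torsionless. Moreover: (i) $X(c)^*\cong((x-q^{-1}y)A,\ A_A)_\sigma$, where $\sigma:(x-q^{-1}y)A\to A$ is the embedding; $X(c)^{**}\cong\binom{A}{A(x-y)A}_\iota$ is not semi-Gorenstein-projective, where $\iota:A(x-y)A\to A$ is the embedding. In particular, $X(c)^*$ is not Gorenstein-projective. (ii) If one identifies $X(c)^{**}$ with $\binom{A}{A(x-y)A}_\iota$, then the canonical $\Lambda$-map $\phi_{X(c)}:X(c)\to X(c)^{**}$ reads as $$\binom{\mathrm{Id}_A}{r_{x-y}}:\binom{{}_AA}{M(1,-q,c)}_{f_1}\longrightarrow\binom{{}_AA}{A(x-y)A}_\iota ,$$ where $r_{x-y}$ is right multiplication by $x-y$. Thus $\phi_{X(c)}$ is neither a monomorphism nor an epimorphism.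
   Context: All modules are finitely generated. The algebra $A$ is a $6$-dimensional local algebra with basis $1,x,y,z,yx,zx$; $\mathrm{soc}\,A$ is its socle, $\bar 1$ denotes the residue class of $1$, and $A(x-y)A$ is the two-sided ideal generated by $x-y$, viewed as a left $A$-module. For a finite-dimensional algebra $R$ and a left or right $R$-module $N$, $N^*=\mathrm{Hom}_R(N,R)$, and $\phi_N:N\to N^{**}$, $\phi_N(n)(f)=f(n)$, is the canonical map. $N$ is torsionless if $\phi_N$ is a monomorphism, reflexive if $\phi_N$ is an isomorphism. $N$ is semi-Gorenstein-projective if $\mathrm{Ext}_R^i(N,R)=0$ for all $i\ge1$; double semi-Gorenstein-projective if both $N$ and $N^*$ are semi-Gorenstein-projective; Gorenstein-projective if it is double semi-Gorenstein-projective and reflexive. A left $T_2(A)$-module is identified with a triple $\binom{X}{Y}_\varphi$, where $\varphi:Y\to X$ is a map of left $A$-modules, with action $\begin{pmatrix}a_1&a_2\\0&a_3\end{pmatrix}\binom{x}{y}=\binom{a_1x+a_2\varphi(y)}{a_3y}$; it is monic if $\varphi$ is a monomorphism. A right $T_2(A)$-module is identified with a triple $(U,V)_\psi$, where $\psi:U\to V$ is a map of right $A$-modules, with action $(u,v)\begin{pmatrix}a_1&a_2\\0&a_3\end{pmatrix}=(ua_1,\psi(u)a_2+va_3)$. *)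

theory Defs
  imports
    "HOL-Algebra.Module"
    "HOL-Algebra.QuotRing"
    "HOL-Algebra.Elementary_Groups"
    "HOL-Algebra.Algebraic_Closure_Type"
    "HOL-Library.Poly_Mapping"
begin

section \<open>Modules over noncommutative rings\<close>

text \<open>
  \<^locale>\<open>module\<close> requires a commutative ring of scalars. Its record type is reused here, with
  the fields \<^const>\<open>monoid.mult\<close> and \<^const>\<open>monoid.one\<close> carrying no information.
  A right \<open>R\<close>-module is a left module over \<open>opp R\<close>, so that \<open>r \<odot> m\<close> stands for \<open>m r\<close>.
\<close>

locale left_module = R?: ring R + M?: abelian_group M
  for R :: "('a, 'e) ring_scheme" (structure) and M :: "('a, 'm, 'f) module_scheme" (structure) +
  assumes smult_closed:
      "\<lbrakk>a \<in> carrier R; u \<in> carrier M\<rbrakk> \<Longrightarrow> a \<odot>\<^bsub>M\<^esub> u \<in> carrier M"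
    and smult_l_distr:
      "\<lbrakk>a \<in> carrier R; b \<in> carrier R; u \<in> carrier M\<rbrakk>
        \<Longrightarrow> (a \<oplus>\<^bsub>R\<^esub> b) \<odot>\<^bsub>M\<^esub> u = a \<odot>\<^bsub>M\<^esub> u \<oplus>\<^bsub>M\<^esub> b \<odot>\<^bsub>M\<^esub> u"
    and smult_r_distr:
      "\<lbrakk>a \<in> carrier R; u \<in> carrier M; v \<in> carrier M\<rbrakk>
        \<Longrightarrow> a \<odot>\<^bsub>M\<^esub> (u \<oplus>\<^bsub>M\<^esub> v) = a \<odot>\<^bsub>M\<^esub> u \<oplus>\<^bsub>M\<^esub> a \<odot>\<^bsub>M\<^esub> v"
    and smult_assoc:
      "\<lbrakk>a \<in> carrier R; b \<in> carrier R; u \<in> carrier M\<rbrakk>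
        \<Longrightarrow> (a \<otimes>\<^bsub>R\<^esub> b) \<odot>\<^bsub>M\<^esub> u = a \<odot>\<^bsub>M\<^esub> (b \<odot>\<^bsub>M\<^esub> u)"
    and smult_one:
      "u \<in> carrier M \<Longrightarrow> \<one>\<^bsub>R\<^esub> \<odot>\<^bsub>M\<^esub> u = u"

definition opp :: "('a, 'e) ring_scheme \<Rightarrow> ('a, 'e) ring_scheme"
  where "opp R = R\<lparr>monoid.mult := (\<lambda>a b. b \<otimes>\<^bsub>R\<^esub> a)\<rparr>"

definition regular :: "('a, 'e) ring_scheme \<Rightarrow> ('a, 'a) module"
  where "regular R =
    \<lparr>carrier = carrier R, monoid.mult = monoid.mult R, one = \<one>\<^bsub>R\<^esub>,
     zero = \<zero>\<^bsub>R\<^esub>, add = add R, module.smult = monoid.mult R\<rparr>"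

definition lspan ::
    "('a, 'e) ring_scheme \<Rightarrow> ('a, 'm, 'f) module_scheme \<Rightarrow> 'm set \<Rightarrow> 'm set"
  where "lspan R M S = \<Inter>{H. submodule H R M \<and> S \<subseteq> H}"

definition fg_module :: "('a, 'e) ring_scheme \<Rightarrow> ('a, 'm, 'f) module_scheme \<Rightarrow> bool"
  where "fg_module R M \<longleftrightarrow>
    left_module R M \<and> (\<exists>S. finite S \<and> S \<subseteq> carrier M \<and> lspan R M S = carrier M)"

definition simple_submodule ::
    "'m set \<Rightarrow> ('a, 'e) ring_scheme \<Rightarrow> ('a, 'm, 'f) module_scheme \<Rightarrow> bool"
  where "simple_submodule S R M \<longleftrightarrow>
    submodule S R M \<and> S \<noteq> {\<zero>\<^bsub>M\<^esub>} \<and>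
    (\<forall>T. submodule T R M \<and> T \<subseteq> S \<longrightarrow> T = {\<zero>\<^bsub>M\<^esub>} \<or> T = S)"

definition socle :: "('a, 'e) ring_scheme \<Rightarrow> ('a, 'm, 'f) module_scheme \<Rightarrow> 'm set"
  where "socle R M = lspan R M (\<Union>{S. simple_submodule S R M})"

text \<open>
  The union in the scalar multiplication ranges over equal cosets when \<open>S\<close> is a coset of \<open>K\<close>.
\<close>
definition quot_module :: "('a, 'm, 'f) module_scheme \<Rightarrow> 'm set \<Rightarrow> ('a, 'm set) module"
  where "quot_module M K =
    \<lparr>carrier = a_rcosets\<^bsub>M\<^esub> K, monoid.mult = undefined, one = undefined,
     zero = K, add = set_add M,
     module.smult = (\<lambda>a S. \<Union>u\<in>S. K +>\<^bsub>M\<^esub> (a \<odot>\<^bsub>M\<^esub> u))\<rparr>"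

definition lhom ::
    "('a, 'e) ring_scheme \<Rightarrow> ('a, 'm, 'f) module_scheme \<Rightarrow> ('a, 'n, 'g) module_scheme
      \<Rightarrow> ('m \<Rightarrow> 'n) set"
  where "lhom R M N =
    {f \<in> carrier M \<rightarrow>\<^sub>E carrier N.
      (\<forall>u\<in>carrier M. \<forall>v\<in>carrier M. f (u \<oplus>\<^bsub>M\<^esub> v) = f u \<oplus>\<^bsub>N\<^esub> f v) \<and>
      (\<forall>a\<in>carrier R. \<forall>u\<in>carrier M. f (a \<odot>\<^bsub>M\<^esub> u) = a \<odot>\<^bsub>N\<^esub> f u)}"

definition lisos ::
    "('a, 'e) ring_scheme \<Rightarrow> ('a, 'm, 'f) module_scheme \<Rightarrow> ('a, 'n, 'g) module_scheme
      \<Rightarrow> ('m \<Rightarrow> 'n) set"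
  where "lisos R M N = {f \<in> lhom R M N. bij_betw f (carrier M) (carrier N)}"

definition liso ::
    "('a, 'e) ring_scheme \<Rightarrow> ('a, 'm, 'f) module_scheme \<Rightarrow> ('a, 'n, 'g) module_scheme \<Rightarrow> bool"
  where "liso R M N \<longleftrightarrow> lisos R M N \<noteq> {}"


section \<open>Duality\<close>

text \<open>
  For a left \<open>R\<close>-module \<open>N\<close>, \<open>dual R N\<close> is the right \<open>R\<close>-module of maps \<open>N \<rightarrow> R\<close> with
  \<open>(f a)(n) = f(n) a\<close>, hence a left module over \<open>opp R\<close>. A right module \<open>N\<close> is a left module
  over \<open>opp R\<close>, and \<open>dual (opp R) N\<close> is a left module over \<open>opp (opp R) = R\<close>.
\<close>
definition dual ::
    "('a, 'e) ring_scheme \<Rightarrow> ('a, 'm, 'f) module_scheme \<Rightarrow> ('a, 'm \<Rightarrow> 'a) module"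
  where "dual R N =
    \<lparr>carrier = lhom R N (regular R), monoid.mult = undefined, one = undefined,
     zero = (\<lambda>n\<in>carrier N. \<zero>\<^bsub>R\<^esub>),
     add = (\<lambda>f g. \<lambda>n\<in>carrier N. f n \<oplus>\<^bsub>R\<^esub> g n),
     module.smult = (\<lambda>a f. \<lambda>n\<in>carrier N. f n \<otimes>\<^bsub>R\<^esub> a)\<rparr>"

lemma opp_opp [simp]: "opp (opp R) = R"
  by (simp add: opp_def)

definition bidual ::
    "('a, 'e) ring_scheme \<Rightarrow> ('a, 'm, 'f) module_scheme \<Rightarrow> ('a, ('m \<Rightarrow> 'a) \<Rightarrow> 'a) module"
  where "bidual R N = dual (opp R) (dual R N)"

definition canonical_map ::
    "('a, 'e) ring_scheme \<Rightarrow> ('a, 'm, 'f) module_scheme \<Rightarrow> 'm \<Rightarrow> ('m \<Rightarrow> 'a) \<Rightarrow> 'a"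
  where "canonical_map R N = (\<lambda>n\<in>carrier N. \<lambda>f\<in>carrier (dual R N). f n)"

definition torsionless :: "('a, 'e) ring_scheme \<Rightarrow> ('a, 'm, 'f) module_scheme \<Rightarrow> bool"
  where "torsionless R N \<longleftrightarrow> inj_on (canonical_map R N) (carrier N)"

definition reflexive :: "('a, 'e) ring_scheme \<Rightarrow> ('a, 'm, 'f) module_scheme \<Rightarrow> bool"
  where "reflexive R N \<longleftrightarrow>
    bij_betw (canonical_map R N) (carrier N) (carrier (bidual R N))"


section \<open>Ext groups\<close>

definition free_module :: "('a, 'e) ring_scheme \<Rightarrow> nat \<Rightarrow> ('a, nat \<Rightarrow> 'a) module"
  where "free_module R n =
    \<lparr>carrier = {..<n} \<rightarrow>\<^sub>E carrier R, monoid.mult = undefined, one = undefined,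
     zero = (\<lambda>i\<in>{..<n}. \<zero>\<^bsub>R\<^esub>),
     add = (\<lambda>u v. \<lambda>i\<in>{..<n}. u i \<oplus>\<^bsub>R\<^esub> v i),
     module.smult = (\<lambda>a u. \<lambda>i\<in>{..<n}. a \<otimes>\<^bsub>R\<^esub> u i)\<rparr>"

record ('a, 'm) resolution =
  res_rank :: "nat \<Rightarrow> nat"
  res_diff :: "nat \<Rightarrow> (nat \<Rightarrow> 'a) \<Rightarrow> (nat \<Rightarrow> 'a)"
  res_aug  :: "(nat \<Rightarrow> 'a) \<Rightarrow> 'm"

definition res_module ::
    "('a, 'e) ring_scheme \<Rightarrow> ('a, 'm) resolution \<Rightarrow> nat \<Rightarrow> ('a, nat \<Rightarrow> 'a) module"
  where "res_module R P i = free_module R (res_rank P i)"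

text \<open>
  An exact sequence \<open>\<cdots> \<rightarrow> P\<^sub>2 \<rightarrow> P\<^sub>1 \<rightarrow> P\<^sub>0 \<rightarrow> N \<rightarrow> 0\<close> with \<open>P\<^sub>i\<close> free of finite rank, where
  \<open>res_diff P i\<close> is the map from \<open>P\<^sub>i\<^sub>+\<^sub>1\<close> to \<open>P\<^sub>i\<close>.
\<close>
definition free_resolution ::
    "('a, 'e) ring_scheme \<Rightarrow> ('a, 'm, 'f) module_scheme \<Rightarrow> ('a, 'm) resolution \<Rightarrow> bool"
  where "free_resolution R N P \<longleftrightarrow>
    (\<forall>i. res_diff P i \<in> lhom R (res_module R P (Suc i)) (res_module R P i)) \<and>
    res_aug P \<in> lhom R (res_module R P 0) N \<and>
    res_aug P ` carrier (res_module R P 0) = carrier N \<and>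
    res_diff P 0 ` carrier (res_module R P 1)
      = {u \<in> carrier (res_module R P 0). res_aug P u = \<zero>\<^bsub>N\<^esub>} \<and>
    (\<forall>i. res_diff P (Suc i) ` carrier (res_module R P (Suc (Suc i)))
      = {u \<in> carrier (res_module R P (Suc i)).
          res_diff P i u = \<zero>\<^bsub>res_module R P i\<^esub>})"

definition hom_group ::
    "('a, 'e) ring_scheme \<Rightarrow> ('a, 'm, 'f) module_scheme \<Rightarrow> ('a, 'n, 'g) module_scheme
      \<Rightarrow> ('m \<Rightarrow> 'n) monoid"
  where "hom_group R M N =
    \<lparr>carrier = lhom R M N,
     monoid.mult = (\<lambda>f g. \<lambda>u\<in>carrier M. f u \<oplus>\<^bsub>N\<^esub> g u),
     one = (\<lambda>u\<in>carrier M. \<zero>\<^bsub>N\<^esub>)\<rparr>"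

definition coboundary ::
    "('a, 'e) ring_scheme \<Rightarrow> ('a, 'm) resolution \<Rightarrow> nat
      \<Rightarrow> ((nat \<Rightarrow> 'a) \<Rightarrow> 'n) \<Rightarrow> ((nat \<Rightarrow> 'a) \<Rightarrow> 'n)"
  where "coboundary R P i f =
    (\<lambda>u\<in>carrier (res_module R P (Suc i)). f (res_diff P i u))"

definition cocycles ::
    "('a, 'e) ring_scheme \<Rightarrow> ('a, 'm) resolution \<Rightarrow> ('a, 'n, 'g) module_scheme \<Rightarrow> nat
      \<Rightarrow> ((nat \<Rightarrow> 'a) \<Rightarrow> 'n) set"
  where "cocycles R P L i =
    {f \<in> lhom R (res_module R P i) L.
      coboundary R P i f = \<one>\<^bsub>hom_group R (res_module R P (Suc i)) L\<^esub>}"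

definition coboundaries ::
    "('a, 'e) ring_scheme \<Rightarrow> ('a, 'm) resolution \<Rightarrow> ('a, 'n, 'g) module_scheme \<Rightarrow> nat
      \<Rightarrow> ((nat \<Rightarrow> 'a) \<Rightarrow> 'n) set"
  where "coboundaries R P L i =
    (case i of
       0 \<Rightarrow> {\<one>\<^bsub>hom_group R (res_module R P 0) L\<^esub>}
     | Suc j \<Rightarrow> coboundary R P j ` lhom R (res_module R P j) L)"

definition cohomology ::
    "('a, 'e) ring_scheme \<Rightarrow> ('a, 'm) resolution \<Rightarrow> ('a, 'n, 'g) module_scheme \<Rightarrow> nat
      \<Rightarrow> ((nat \<Rightarrow> 'a) \<Rightarrow> 'n) set monoid"
  where "cohomology R P L i =
    ((hom_group R (res_module R P i) L)\<lparr>carrier := cocycles R P L i\<rparr>)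
      Mod (coboundaries R P L i)"

text \<open>
  \<open>Ext\<^sup>i(N, L)\<close>, computed from a resolution of \<open>N\<close> by free modules of finite rank. Such a
  resolution exists for finitely generated \<open>N\<close> over a finite-dimensional algebra (or any left
  noetherian ring); up to isomorphism the group does not depend on which one is chosen. The
  definition is meaningful for such \<open>N\<close> only.
\<close>
definition Ext ::
    "('a, 'e) ring_scheme \<Rightarrow> ('a, 'm, 'f) module_scheme \<Rightarrow> ('a, 'n, 'g) module_scheme \<Rightarrow> nat
      \<Rightarrow> ((nat \<Rightarrow> 'a) \<Rightarrow> 'n) set monoid"
  where "Ext R N L i = cohomology R (SOME P. free_resolution R N P) L i"

definition semi_Gorenstein_projective ::
    "('a, 'e) ring_scheme \<Rightarrow> ('a, 'm, 'f) module_scheme \<Rightarrow> bool"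
  where "semi_Gorenstein_projective R N \<longleftrightarrow>
    (\<forall>i\<ge>1. trivial_group (Ext R N (regular R) i))"

definition double_semi_Gorenstein_projective ::
    "('a, 'e) ring_scheme \<Rightarrow> ('a, 'm, 'f) module_scheme \<Rightarrow> bool"
  where "double_semi_Gorenstein_projective R N \<longleftrightarrow>
    semi_Gorenstein_projective R N \<and> semi_Gorenstein_projective (opp R) (dual R N)"

definition Gorenstein_projective ::
    "('a, 'e) ring_scheme \<Rightarrow> ('a, 'm, 'f) module_scheme \<Rightarrow> bool"
  where "Gorenstein_projective R N \<longleftrightarrow>
    double_semi_Gorenstein_projective R N \<and> reflexive R N"


section \<open>Triangular matrix rings\<close>

text \<open>The triple \<open>(a1, a2, a3)\<close> is the matrix with rows \<open>(a1, a2)\<close> and \<open>(0, a3)\<close>.\<close>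
definition T2 :: "('a, 'e) ring_scheme \<Rightarrow> ('a \<times> 'a \<times> 'a) ring"
  where "T2 R =
    \<lparr>carrier = carrier R \<times> carrier R \<times> carrier R,
     monoid.mult = (\<lambda>(a1, a2, a3) (b1, b2, b3).
       (a1 \<otimes>\<^bsub>R\<^esub> b1, a1 \<otimes>\<^bsub>R\<^esub> b2 \<oplus>\<^bsub>R\<^esub> a2 \<otimes>\<^bsub>R\<^esub> b3, a3 \<otimes>\<^bsub>R\<^esub> b3)),
     one = (\<one>\<^bsub>R\<^esub>, \<zero>\<^bsub>R\<^esub>, \<one>\<^bsub>R\<^esub>),
     zero = (\<zero>\<^bsub>R\<^esub>, \<zero>\<^bsub>R\<^esub>, \<zero>\<^bsub>R\<^esub>),
     add = (\<lambda>(a1, a2, a3) (b1, b2, b3). (a1 \<oplus>\<^bsub>R\<^esub> b1, a2 \<oplus>\<^bsub>R\<^esub> b2, a3 \<oplus>\<^bsub>R\<^esub> b3))\<rparr>"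

text \<open>The left module given by \<open>f : V \<rightarrow> U\<close>, with \<open>U\<close> on top.\<close>
definition T2_left ::
    "('a, 'm, 'f) module_scheme \<Rightarrow> ('a, 'n, 'g) module_scheme \<Rightarrow> ('n \<Rightarrow> 'm)
      \<Rightarrow> ('a \<times> 'a \<times> 'a, 'm \<times> 'n) module"
  where "T2_left U V f =
    \<lparr>carrier = carrier U \<times> carrier V, monoid.mult = undefined, one = undefined,
     zero = (\<zero>\<^bsub>U\<^esub>, \<zero>\<^bsub>V\<^esub>),
     add = (\<lambda>(u, v) (u', v'). (u \<oplus>\<^bsub>U\<^esub> u', v \<oplus>\<^bsub>V\<^esub> v')),
     module.smult = (\<lambda>(a1, a2, a3) (u, v). (a1 \<odot>\<^bsub>U\<^esub> u \<oplus>\<^bsub>U\<^esub> a2 \<odot>\<^bsub>U\<^esub> f v, a3 \<odot>\<^bsub>V\<^esub> v))\<rparr>"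

text \<open>
  The right module given by a map \<open>g : U \<rightarrow> V\<close> of right modules, i.e. of left modules over
  \<open>opp R\<close>; so \<open>a \<odot> u\<close> stands for \<open>u a\<close>, and the result is a left module over \<open>opp (T2 R)\<close>.
\<close>
definition T2_right ::
    "('a, 'm, 'f) module_scheme \<Rightarrow> ('a, 'n, 'g) module_scheme \<Rightarrow> ('m \<Rightarrow> 'n)
      \<Rightarrow> ('a \<times> 'a \<times> 'a, 'm \<times> 'n) module"
  where "T2_right U V g =
    \<lparr>carrier = carrier U \<times> carrier V, monoid.mult = undefined, one = undefined,
     zero = (\<zero>\<^bsub>U\<^esub>, \<zero>\<^bsub>V\<^esub>),
     add = (\<lambda>(u, v) (u', v'). (u \<oplus>\<^bsub>U\<^esub> u', v \<oplus>\<^bsub>V\<^esub> v')),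
     module.smult = (\<lambda>(a1, a2, a3) (u, v). (a1 \<odot>\<^bsub>U\<^esub> u, a2 \<odot>\<^bsub>V\<^esub> g u \<oplus>\<^bsub>V\<^esub> a3 \<odot>\<^bsub>V\<^esub> v))\<rparr>"

definition monic ::
    "('a, 'm, 'f) module_scheme \<Rightarrow> ('a, 'n, 'g) module_scheme \<Rightarrow> ('n \<Rightarrow> 'm) \<Rightarrow> bool"
  where "monic U V f \<longleftrightarrow> inj_on f (carrier V)"


section \<open>The algebra\<close>

datatype gen = GX | GY | GZ

datatype word = Word (letters: "gen list")

text \<open>
  With concatenation of words written additively, the convolution product of
  \<^theory>\<open>HOL-Library.Poly_Mapping\<close> makes \<open>word \<Rightarrow>\<^sub>0 'k\<close> the free algebra \<open>k\<langle>x,y,z\<rangle>\<close>.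
\<close>
instantiation word :: monoid_add
begin

definition "0 = Word []"
definition "v + w = Word (letters v @ letters w)"

instance
  by standard (simp_all add: zero_word_def plus_word_def)

end

type_synonym 'k free_algebra = "word \<Rightarrow>\<^sub>0 'k"

definition var :: "gen \<Rightarrow> 'k::field free_algebra"
  where "var g = Poly_Mapping.single (Word [g]) 1"

definition const :: "'k \<Rightarrow> 'k::field free_algebra"
  where "const c = Poly_Mapping.single 0 c"

abbreviation "vx \<equiv> var GX"
abbreviation "vy \<equiv> var GY"
abbreviation "vz \<equiv> var GZ"

definition relators :: "'k::field \<Rightarrow> 'k free_algebra set"
  where "relators q =
    {vx ^ 2, vy ^ 2, vz ^ 2, vy * vz, vx * vy + const q * vy * vx, vx * vz - vz * vx,
     vz * vy - vz * vx}"

definition rel_ideal :: "'k::field \<Rightarrow> 'k free_algebra set"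
  where "rel_ideal q = genideal ring_of_type_algebra (relators q)"

definition alg :: "'k::field \<Rightarrow> 'k free_algebra set ring"
  where "alg q = ring_of_type_algebra Quot (rel_ideal q)"

text \<open>The element of \<open>A\<close> represented by a noncommutative polynomial.\<close>
definition elt :: "'k::field \<Rightarrow> 'k free_algebra \<Rightarrow> 'k free_algebra set"
  where "elt q p = rel_ideal q +>\<^bsub>ring_of_type_algebra\<^esub> p"


section \<open>The modules\<close>

definition M_sub :: "'k::field \<Rightarrow> 'k \<Rightarrow> 'k free_algebra set set"
  where "M_sub q c =
    (\<lambda>a. a \<otimes>\<^bsub>alg q\<^esub> elt q (vx - const q * vy + const c * vz)) ` carrier (alg q)
      <+>\<^bsub>alg q\<^esub> socle (alg q) (regular (alg q))"

definition M_module :: "'k::field \<Rightarrow> 'k \<Rightarrow> ('k free_algebra set, 'k free_algebra set set) module"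
  where "M_module q c = quot_module (regular (alg q)) (M_sub q c)"

definition M_res :: "'k::field \<Rightarrow> 'k \<Rightarrow> 'k free_algebra set \<Rightarrow> 'k free_algebra set set"
  where "M_res q c a = M_sub q c +>\<^bsub>alg q\<^esub> a"

definition f1 :: "'k::field \<Rightarrow> 'k \<Rightarrow> 'k free_algebra set set \<Rightarrow> 'k free_algebra set"
  where "f1 q c =
    (THE f. f \<in> lhom (alg q) (M_module q c) (regular (alg q)) \<and>
      f (M_res q c \<one>\<^bsub>alg q\<^esub>) = elt q (vx - vy))"

definition X_module :: "'k::field \<Rightarrow> 'k
    \<Rightarrow> ('k free_algebra set \<times> 'k free_algebra set \<times> 'k free_algebra set,
        'k free_algebra set \<times> 'k free_algebra set set) module"
  where "X_module q c = T2_left (regular (alg q)) (M_module q c) (f1 q c)"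

definition right_ideal_module :: "'k::field \<Rightarrow> ('k free_algebra set, 'k free_algebra set) module"
  where "right_ideal_module q =
    (regular (opp (alg q)))\<lparr>carrier :=
      (\<lambda>a. elt q (vx - const (inverse q) * vy) \<otimes>\<^bsub>alg q\<^esub> a) ` carrier (alg q)\<rparr>"

definition two_sided_ideal_module ::
    "'k::field \<Rightarrow> ('k free_algebra set, 'k free_algebra set) module"
  where "two_sided_ideal_module q =
    (regular (alg q))\<lparr>carrier := genideal (alg q) {elt q (vx - vy)}\<rparr>"

text \<open>
  The map induced on cosets by right multiplication with \<open>g\<close>; it is well defined on \<open>S\<close> if
  \<open>a g\<close> is the same for all \<open>a\<close> in \<open>S\<close>.
\<close>
definition right_mult :: "('a, 'e) ring_scheme \<Rightarrow> 'a \<Rightarrow> 'a set \<Rightarrow> 'a"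
  where "right_mult R g S = the_elem ((\<lambda>a. a \<otimes>\<^bsub>R\<^esub> g) ` S)"

end

theory Submission
  imports Defs "HOL-Library.Product_Plus"
begin

text \<open>
  Put \<open>u\<^sub>n = x - q\<^sup>n y + c\<^sub>n z\<close> for \<open>n \<in> \<int>\<close>, with \<open>c\<^sub>n = 0\<close> for \<open>n \<le> 0\<close>, \<open>c\<^sub>1 = c\<close> and
  \<open>c\<^sub>n\<^sub>+\<^sub>1 = - c\<^sub>n / (1 - q\<^sup>n)\<close> for \<open>n \<ge> 1\<close>. Then \<open>u\<^sub>n\<^sub>+\<^sub>1 u\<^sub>n = 0\<close>, the right annihilator of \<open>u\<^sub>n\<^sub>+\<^sub>1\<close> is \<open>u\<^sub>n A\<close> for
  all \<open>n\<close>, and the left annihilator of \<open>u\<^sub>n\<close> is \<open>A u\<^sub>n\<^sub>+\<^sub>1\<close> unless \<open>n = 0\<close> or \<open>n = -1\<close>. These properties pass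
  to the elements \<open>D\<^sub>n = (- u\<^sub>n, 1, u\<^sub>n\<^sub>+\<^sub>1)\<close> of \<open>\<Lambda> = T\<^sub>2(A)\<close>. The module \<open>X(c)\<close> is cyclic over \<open>\<Lambda>\<close> with
  relation \<open>D\<^sub>0\<close>, so that right multiplication by \<open>D\<^sub>0, D\<^sub>1, \<dots>\<close> resolves it by free modules of rank one,
  and \<open>X(c)\<^sup>* = D\<^sub>-\<^sub>1 \<Lambda>\<close> is resolved by left multiplication by \<open>D\<^sub>-\<^sub>2, D\<^sub>-\<^sub>3, \<dots>\<close>; dualizing either
  resolution gives an exact complex. The bidual is the left annihilator of \<open>D\<^sub>-\<^sub>2\<close>, where the exceptional
  left annihilator \<open>A (x - y) A\<close> of \<open>u\<^sub>-\<^sub>1\<close> enters; a map from this ideal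
  to \<open>A\<close> that is not a right multiplication gives a nonzero class in \<open>Ext\<^sup>1(X(c)\<^sup>*\<^sup>*, \<Lambda>)\<close>.
\<close>

section \<open>Modules and homomorphisms\<close>

text \<open>With \<open>u_n = x - q^n y + c_n z\<close>, the exponents make the
  \<open>yx\<close>-part of \<open>u_(n+1) u_n\<close> cancel, and the coefficient of
  \<open>zx\<close> is \<open>c_n + c_(n+1) (1 - q^n)\<close>. At n = 0 the factor vanishes: this
  forces \<open>c_0 = 0\<close>, hence \<open>c_n = 0\<close> for negative n, and leaves
  \<open>c_1 = c\<close> free, while infinite order of q determines all later \<open>c_n\<close>.
  The same factors, at n and n + 1, have to be inverted to compute the left annihilator of
  \<open>u_n\<close>, whence the two exceptions; right annihilators involve no such division. The
  left annihilator of \<open>D_n\<close> depends on \<open>u_(n+1)\<close>, so there the exceptions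
  are n = -1 and n = -2. X(c) requires left annihilators for n >= 0, its dual for n <= -3, and the
  gap is seen only by the bidual. Two obstacles shape the rest. Ext is defined through an
  arbitrarily chosen resolution, so independence of the choice has to come before any explicit one
  can be used. For the bidual no explicit resolution is at hand: existence is deduced from finite
  dimension, and the nonzero class is produced in a resolution of which nothing more is
  known.\<close>

lemma lhomI:
  assumes "f \<in> carrier M \<rightarrow>\<^sub>E carrier N"
    and "\<And>u v. u \<in> carrier M \<Longrightarrow> v \<in> carrier M \<Longrightarrow> f (u \<oplus>\<^bsub>M\<^esub> v) = f u \<oplus>\<^bsub>N\<^esub> f v"
    and "\<And>a u. a \<in> carrier R \<Longrightarrow> u \<in> carrier M \<Longrightarrow> f (a \<odot>\<^bsub>M\<^esub> u) = a \<odot>\<^bsub>N\<^esub> f u"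
  shows "f \<in> lhom R M N"
  using assms by (simp add: lhom_def)

lemma lhom_funcset: "f \<in> lhom R M N \<Longrightarrow> f \<in> carrier M \<rightarrow>\<^sub>E carrier N"
  by (simp add: lhom_def)

lemma lhom_closed: "f \<in> lhom R M N \<Longrightarrow> u \<in> carrier M \<Longrightarrow> f u \<in> carrier N"
  by (auto simp: lhom_def)

lemma lhom_add:
  "f \<in> lhom R M N \<Longrightarrow> u \<in> carrier M \<Longrightarrow> v \<in> carrier M \<Longrightarrow> f (u \<oplus>\<^bsub>M\<^esub> v) = f u \<oplus>\<^bsub>N\<^esub> f v"
  by (simp add: lhom_def)

lemma lhom_smult:
  "f \<in> lhom R M N \<Longrightarrow> a \<in> carrier R \<Longrightarrow> u \<in> carrier M \<Longrightarrow> f (a \<odot>\<^bsub>M\<^esub> u) = a \<odot>\<^bsub>N\<^esub> f u"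
  by (simp add: lhom_def)

text \<open>Homomorphisms are extensional, being \<open>undefined\<close> off the carrier of the
  source, so agreement on the carrier is equality of functions, even when two different target
  records are in play.\<close>

lemma lhom_eqI:
  assumes "f \<in> lhom R M N" "g \<in> lhom R M N'" "\<And>u. u \<in> carrier M \<Longrightarrow> f u = g u"
  shows "f = g"
  using assms PiE_ext[of f "carrier M" "\<lambda>_. carrier N"]
  by (metis (no_types, lifting) PiE_E ext lhom_funcset)

lemma left_moduleI:
  fixes R (structure) and M (structure)
  assumes "ring R" "abelian_group M"
    and "\<And>a u. \<lbrakk>a \<in> carrier R; u \<in> carrier M\<rbrakk> \<Longrightarrow> a \<odot>\<^bsub>M\<^esub> u \<in> carrier M"
    and "\<And>a b u. \<lbrakk>a \<in> carrier R; b \<in> carrier R; u \<in> carrier M\<rbrakk>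
        \<Longrightarrow> (a \<oplus>\<^bsub>R\<^esub> b) \<odot>\<^bsub>M\<^esub> u = a \<odot>\<^bsub>M\<^esub> u \<oplus>\<^bsub>M\<^esub> b \<odot>\<^bsub>M\<^esub> u"
    and "\<And>a u v. \<lbrakk>a \<in> carrier R; u \<in> carrier M; v \<in> carrier M\<rbrakk>
        \<Longrightarrow> a \<odot>\<^bsub>M\<^esub> (u \<oplus>\<^bsub>M\<^esub> v) = a \<odot>\<^bsub>M\<^esub> u \<oplus>\<^bsub>M\<^esub> a \<odot>\<^bsub>M\<^esub> v"
    and "\<And>a b u. \<lbrakk>a \<in> carrier R; b \<in> carrier R; u \<in> carrier M\<rbrakk>
        \<Longrightarrow> (a \<otimes>\<^bsub>R\<^esub> b) \<odot>\<^bsub>M\<^esub> u = a \<odot>\<^bsub>M\<^esub> (b \<odot>\<^bsub>M\<^esub> u)"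
    and "\<And>u. u \<in> carrier M \<Longrightarrow> \<one>\<^bsub>R\<^esub> \<odot>\<^bsub>M\<^esub> u = u"
  shows "left_module R M"
  using assms by (intro left_module.intro left_module_axioms.intro) auto

context left_module
begin

lemma smult_l_null: assumes "u \<in> carrier M" shows "\<zero> \<odot>\<^bsub>M\<^esub> u = \<zero>\<^bsub>M\<^esub>"
proof -
  have "\<zero> \<odot>\<^bsub>M\<^esub> u = \<zero> \<odot>\<^bsub>M\<^esub> u \<oplus>\<^bsub>M\<^esub> \<zero> \<odot>\<^bsub>M\<^esub> u"
    using smult_l_distr[of "\<zero>" "\<zero>" u] assms by simp
  then show ?thesis using smult_closed[OF R.zero_closed assms] by simp
qed

lemma smult_r_null: assumes "a \<in> carrier R" shows "a \<odot>\<^bsub>M\<^esub> \<zero>\<^bsub>M\<^esub> = \<zero>\<^bsub>M\<^esub>"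
proof -
  have "a \<odot>\<^bsub>M\<^esub> \<zero>\<^bsub>M\<^esub> = a \<odot>\<^bsub>M\<^esub> \<zero>\<^bsub>M\<^esub> \<oplus>\<^bsub>M\<^esub> a \<odot>\<^bsub>M\<^esub> \<zero>\<^bsub>M\<^esub>"
    using smult_r_distr[of a "\<zero>\<^bsub>M\<^esub>" "\<zero>\<^bsub>M\<^esub>"] assms by simp
  then show ?thesis using smult_closed[OF assms M.zero_closed] by simp
qed

lemma smult_l_minus:
  assumes "a \<in> carrier R" "u \<in> carrier M"
  shows "(\<ominus> a) \<odot>\<^bsub>M\<^esub> u = \<ominus>\<^bsub>M\<^esub> (a \<odot>\<^bsub>M\<^esub> u)"
proof -
  have "(\<ominus> a) \<odot>\<^bsub>M\<^esub> u \<oplus>\<^bsub>M\<^esub> a \<odot>\<^bsub>M\<^esub> u = \<zero>\<^bsub>M\<^esub>"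
    using smult_l_distr[of "\<ominus> a" a u] assms by (simp add: R.l_neg smult_l_null)
  then show ?thesis
    using assms by (intro M.minus_equality[symmetric]) (auto intro: smult_closed)
qed

lemma smult_r_minus:
  assumes "a \<in> carrier R" "u \<in> carrier M"
  shows "a \<odot>\<^bsub>M\<^esub> (\<ominus>\<^bsub>M\<^esub> u) = \<ominus>\<^bsub>M\<^esub> (a \<odot>\<^bsub>M\<^esub> u)"
proof -
  have "a \<odot>\<^bsub>M\<^esub> (\<ominus>\<^bsub>M\<^esub> u) \<oplus>\<^bsub>M\<^esub> a \<odot>\<^bsub>M\<^esub> u = \<zero>\<^bsub>M\<^esub>"
    using smult_r_distr[of a "\<ominus>\<^bsub>M\<^esub> u" u] assms by (simp add: M.l_neg smult_r_null)
  then show ?thesis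
    using assms by (intro M.minus_equality[symmetric]) (auto intro: smult_closed)
qed

lemma smult_r_diff:
  assumes "a \<in> carrier R" "u \<in> carrier M" "v \<in> carrier M"
  shows "a \<odot>\<^bsub>M\<^esub> (u \<ominus>\<^bsub>M\<^esub> v) = a \<odot>\<^bsub>M\<^esub> u \<ominus>\<^bsub>M\<^esub> a \<odot>\<^bsub>M\<^esub> v"
  using assms by (simp add: a_minus_def smult_r_distr smult_r_minus smult_closed)

lemma submoduleI:
  assumes "H \<subseteq> carrier M" "H \<noteq> {}"
    and "\<And>u v. u \<in> H \<Longrightarrow> v \<in> H \<Longrightarrow> u \<oplus>\<^bsub>M\<^esub> v \<in> H"
    and sm: "\<And>a u. a \<in> carrier R \<Longrightarrow> u \<in> H \<Longrightarrow> a \<odot>\<^bsub>M\<^esub> u \<in> H"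
  shows "submodule H R M"
proof -
  have inv: "\<ominus>\<^bsub>M\<^esub> u \<in> H" if "u \<in> H" for u
  proof -
    have "u \<in> carrier M" using that assms(1) by auto
    then have "\<ominus>\<^bsub>M\<^esub> u = (\<ominus> \<one>) \<odot>\<^bsub>M\<^esub> u" by (simp add: smult_l_minus smult_one)
    with that show ?thesis by (simp add: sm)
  qed
  have "subgroup H (add_monoid M)"
    using assms inv by (intro group.subgroupI M.a_group) (auto simp: a_inv_def)
  then show ?thesis
    using sm by (simp add: submodule_def submodule_axioms_def)
qed

lemma submoduleD:
  assumes "submodule H R M"
  shows "H \<subseteq> carrier M" "\<zero>\<^bsub>M\<^esub> \<in> H"
    "\<And>u v. u \<in> H \<Longrightarrow> v \<in> H \<Longrightarrow> u \<oplus>\<^bsub>M\<^esub> v \<in> H"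
    "\<And>a u. a \<in> carrier R \<Longrightarrow> u \<in> H \<Longrightarrow> a \<odot>\<^bsub>M\<^esub> u \<in> H"
    "\<And>u. u \<in> H \<Longrightarrow> \<ominus>\<^bsub>M\<^esub> u \<in> H"
proof -
  interpret H: submodule H R M by fact
  show "H \<subseteq> carrier M" "\<zero>\<^bsub>M\<^esub> \<in> H" "\<And>u v. u \<in> H \<Longrightarrow> v \<in> H \<Longrightarrow> u \<oplus>\<^bsub>M\<^esub> v \<in> H"
    "\<And>a u. a \<in> carrier R \<Longrightarrow> u \<in> H \<Longrightarrow> a \<odot>\<^bsub>M\<^esub> u \<in> H"
    using H.subset H.one_closed H.m_closed H.smult_closed by auto
  show "\<And>u. u \<in> H \<Longrightarrow> \<ominus>\<^bsub>M\<^esub> u \<in> H" using H.m_inv_closed by (simp add: a_inv_def)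
qed

lemma carrier_submodule: "submodule (carrier M) R M"
  by (rule submoduleI) (auto intro: smult_closed)

end

lemma lhom_zero:
  assumes "left_module R M" "left_module R N" "f \<in> lhom R M N"
  shows "f \<zero>\<^bsub>M\<^esub> = \<zero>\<^bsub>N\<^esub>"
proof -
  interpret M: left_module R M by fact
  interpret N: left_module R N by fact
  have "f \<zero>\<^bsub>M\<^esub> = f \<zero>\<^bsub>M\<^esub> \<oplus>\<^bsub>N\<^esub> f \<zero>\<^bsub>M\<^esub>"
    using lhom_add[OF assms(3) M.M.zero_closed M.M.zero_closed] by simp
  then show ?thesis using lhom_closed[OF assms(3) M.M.zero_closed] by simp
qed

lemma lhom_minus:
  assumes "left_module R M" "left_module R N" "f \<in> lhom R M N" "u \<in> carrier M"
  shows "f (\<ominus>\<^bsub>M\<^esub> u) = \<ominus>\<^bsub>N\<^esub> f u"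
proof -
  interpret M: left_module R M by fact
  interpret N: left_module R N by fact
  have "f (\<ominus>\<^bsub>M\<^esub> u) \<oplus>\<^bsub>N\<^esub> f u = \<zero>\<^bsub>N\<^esub>"
    using lhom_add[OF assms(3), of "\<ominus>\<^bsub>M\<^esub> u" u] assms lhom_zero[OF assms(1-3)]
    by (simp add: M.M.l_neg)
  then show ?thesis
    using assms by (intro N.M.minus_equality[symmetric]) (auto intro: lhom_closed)
qed

lemma lhom_diff:
  assumes "left_module R M" "left_module R N" "f \<in> lhom R M N" "u \<in> carrier M" "v \<in> carrier M"
  shows "f (u \<ominus>\<^bsub>M\<^esub> v) = f u \<ominus>\<^bsub>N\<^esub> f v"
proof -
  interpret M: left_module R M by fact
  show ?thesis
    using assms by (simp add: a_minus_def lhom_add lhom_minus)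
qed

lemma lhom_compose:
  assumes "left_module R M" "f \<in> lhom R M N" "g \<in> lhom R N L"
  shows "(\<lambda>u\<in>carrier M. g (f u)) \<in> lhom R M L"
proof -
  interpret M: left_module R M by fact
  show ?thesis
    using assms by (intro lhomI) (auto simp: lhom_closed lhom_add lhom_smult M.smult_closed)
qed

lemma lhom_fun_diff:
  assumes "left_module R M" "left_module R N" "f \<in> lhom R M N" "g \<in> lhom R M N"
  shows "(\<lambda>u\<in>carrier M. f u \<ominus>\<^bsub>N\<^esub> g u) \<in> lhom R M N"
proof -
  interpret M: left_module R M by fact
  interpret N: left_module R N by fact
  have *: "(a \<oplus>\<^bsub>N\<^esub> b) \<ominus>\<^bsub>N\<^esub> (c \<oplus>\<^bsub>N\<^esub> d) = (a \<ominus>\<^bsub>N\<^esub> c) \<oplus>\<^bsub>N\<^esub> (b \<ominus>\<^bsub>N\<^esub> d)"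
    if "a \<in> carrier N" "b \<in> carrier N" "c \<in> carrier N" "d \<in> carrier N" for a b c d
    using that by (simp add: a_minus_def N.M.minus_add N.M.a_ac)
  show ?thesis
    using assms by (intro lhomI)
      (auto simp: lhom_closed lhom_add lhom_smult M.smult_closed * N.smult_closed
        N.smult_r_diff)
qed

lemma lhom_fun_add:
  assumes "left_module R M" "left_module R N" "f \<in> lhom R M N" "g \<in> lhom R M N"
  shows "(\<lambda>u\<in>carrier M. f u \<oplus>\<^bsub>N\<^esub> g u) \<in> lhom R M N"
proof -
  interpret M: left_module R M by fact
  interpret N: left_module R N by fact
  show ?thesis
    using assms by (intro lhomI)
      (auto simp: lhom_closed lhom_add lhom_smult M.smult_closed N.smult_closed
        N.smult_r_distr N.M.a_ac)
qed

lemma lhom_fun_zero: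
  assumes "left_module R M" "left_module R N"
  shows "(\<lambda>u\<in>carrier M. \<zero>\<^bsub>N\<^esub>) \<in> lhom R M N"
proof -
  interpret M: left_module R M by fact
  interpret N: left_module R N by fact
  show ?thesis
    by (intro lhomI) (auto simp: M.smult_closed N.smult_r_null)
qed

lemma lhom_id: "left_module R M \<Longrightarrow> (\<lambda>u\<in>carrier M. u) \<in> lhom R M M"
proof -
  assume "left_module R M"
  then interpret M: left_module R M .
  show ?thesis by (intro lhomI) (auto simp: M.smult_closed)
qed

lemma lhom_image_submodule:
  assumes "left_module R M" "left_module R N" "f \<in> lhom R M N"
  shows "submodule (f ` carrier M) R N"
proof -
  interpret M: left_module R M by fact
  interpret N: left_module R N by fact
  show ?thesis
  proof (rule N.submoduleI)
    show "f ` carrier M \<subseteq> carrier N" using assms(3) by (auto intro: lhom_closed)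
    show "f ` carrier M \<noteq> {}" using M.M.zero_closed by blast
  next
    fix u v assume "u \<in> f ` carrier M" "v \<in> f ` carrier M"
    then obtain u' v' where "u' \<in> carrier M" "v' \<in> carrier M" "u = f u'" "v = f v'" by auto
    then show "u \<oplus>\<^bsub>N\<^esub> v \<in> f ` carrier M"
      using lhom_add[OF assms(3), of u' v'] by (metis M.M.a_closed image_eqI)
  next
    fix a u assume "a \<in> carrier R" "u \<in> f ` carrier M"
    then obtain u' where "u' \<in> carrier M" "u = f u'" by auto
    with \<open>a \<in> carrier R\<close> show "a \<odot>\<^bsub>N\<^esub> u \<in> f ` carrier M"
      using lhom_smult[OF assms(3), of a u'] by (metis M.smult_closed image_eqI)
  qed
qed

lemma lhom_kernel_submodule:
  assumes "left_module R M" "left_module R N" "f \<in> lhom R M N"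
  shows "submodule {u \<in> carrier M. f u = \<zero>\<^bsub>N\<^esub>} R M"
proof -
  interpret M: left_module R M by fact
  interpret N: left_module R N by fact
  show ?thesis
    using assms lhom_zero[OF assms]
    by (intro M.submoduleI) (auto simp: lhom_add lhom_smult M.smult_closed N.smult_r_null)
qed

section \<open>Opposite rings, regular modules and free modules of finite rank\<close>

lemma carrier_opp [simp]: "carrier (opp R) = carrier R"
  and mult_opp [simp]: "a \<otimes>\<^bsub>opp R\<^esub> b = b \<otimes>\<^bsub>R\<^esub> a"
  and one_opp [simp]: "\<one>\<^bsub>opp R\<^esub> = \<one>\<^bsub>R\<^esub>"
  and zero_opp [simp]: "\<zero>\<^bsub>opp R\<^esub> = \<zero>\<^bsub>R\<^esub>"
  and add_opp [simp]: "add (opp R) = add R"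
  by (simp_all add: opp_def)

lemma ring_opp: assumes "ring R" shows "ring (opp R)"
proof -
  interpret ring R by fact
  have "abelian_group (opp R)"
    by (rule abelian_groupI)
      (auto simp: a_ac intro!: bexI[of _ "\<ominus>\<^bsub>R\<^esub> _"] l_neg)
  moreover have "Group.monoid (opp R)"
    by (rule monoidI) (auto simp: m_assoc)
  ultimately show ?thesis
    by (rule ringI) (auto simp: l_distr r_distr)
qed

lemma carrier_regular [simp]: "carrier (regular R) = carrier R"
  and zero_regular [simp]: "\<zero>\<^bsub>regular R\<^esub> = \<zero>\<^bsub>R\<^esub>"
  and add_regular [simp]: "add (regular R) = add R"
  and smult_regular [simp]: "module.smult (regular R) = monoid.mult R"
  by (simp_all add: regular_def)

lemma left_module_regular: assumes "ring R" shows "left_module R (regular R)"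
proof -
  interpret ring R by fact
  have "abelian_group (regular R)"
    by (rule abelian_groupI)
      (auto simp: a_ac intro!: bexI[of _ "\<ominus>\<^bsub>R\<^esub> _"] l_neg)
  then show ?thesis
    by (intro left_moduleI) (auto simp: l_distr r_distr m_assoc ring_axioms)
qed

lemma minus_regular: assumes "ring R" "a \<in> carrier R"
  shows "\<ominus>\<^bsub>regular R\<^esub> a = \<ominus>\<^bsub>R\<^esub> a"
proof -
  interpret ring R by fact
  interpret M: left_module R "regular R" using left_module_regular assms by blast
  show ?thesis using assms
    by (intro M.M.minus_equality) (auto simp: l_neg)
qed

lemma carrier_free_module: "carrier (free_module R n) = {..<n} \<rightarrow>\<^sub>E carrier R"
  and zero_free_module: "\<zero>\<^bsub>free_module R n\<^esub> = (\<lambda>i\<in>{..<n}. \<zero>\<^bsub>R\<^esub>)"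
  and add_free_module: "u \<oplus>\<^bsub>free_module R n\<^esub> v = (\<lambda>i\<in>{..<n}. u i \<oplus>\<^bsub>R\<^esub> v i)"
  and smult_free_module: "a \<odot>\<^bsub>free_module R n\<^esub> u = (\<lambda>i\<in>{..<n}. a \<otimes>\<^bsub>R\<^esub> u i)"
  by (simp_all add: free_module_def)

lemmas free_module_simps =
  carrier_free_module zero_free_module add_free_module smult_free_module

lemma left_module_free: assumes "ring R" shows "left_module R (free_module R n)"
proof -
  let ?F = "free_module R n"
  interpret ring R by fact
  have c: "u i \<in> carrier R" if "u \<in> carrier (?F)" "i < n" for u i
    using that by (auto simp: carrier_free_module)
  have ext: "u = v" if "u \<in> carrier (?F)" "v \<in> carrier (?F)"
    "\<And>i. i < n \<Longrightarrow> u i = v i" for u v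
    using that unfolding carrier_free_module by (intro PiE_ext[of u _ _ v]) auto
  have zero: "\<zero>\<^bsub>?F\<^esub> \<in> carrier (?F)"
    by (simp add: free_module_simps)
  have add: "u \<oplus>\<^bsub>?F\<^esub> v \<in> carrier (?F)"
    if "u \<in> carrier (?F)" "v \<in> carrier (?F)" for u v
    using that c unfolding add_free_module by (simp add: carrier_free_module)
  have smult: "a \<odot>\<^bsub>?F\<^esub> u \<in> carrier (?F)"
    if "a \<in> carrier R" "u \<in> carrier (?F)" for a u
    using that c unfolding smult_free_module by (simp add: carrier_free_module)
  have "abelian_group (?F)"
  proof (rule abelian_groupI)
    fix u assume u: "u \<in> carrier (?F)"
    let ?v = "\<lambda>i\<in>{..<n}. \<ominus>\<^bsub>R\<^esub> u i"
    have v: "?v \<in> carrier (?F)"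
      using c[OF u] by (simp add: carrier_free_module)
    have "?v \<oplus>\<^bsub>?F\<^esub> u = \<zero>\<^bsub>?F\<^esub>"
      by (rule ext[OF add[OF v u] zero]) (simp add: add_free_module zero_free_module l_neg c[OF u])
    with v show "\<exists>v\<in>carrier (?F). v \<oplus>\<^bsub>?F\<^esub> u = \<zero>\<^bsub>?F\<^esub>"
      by blast
  next
    fix u v w assume uvw: "u \<in> carrier (?F)" "v \<in> carrier (?F)"
      "w \<in> carrier (?F)"
    show "u \<oplus>\<^bsub>?F\<^esub> v \<oplus>\<^bsub>?F\<^esub> w =
        u \<oplus>\<^bsub>?F\<^esub> (v \<oplus>\<^bsub>?F\<^esub> w)"
      by (rule ext) (simp_all add: add uvw, simp add: add_free_module c uvw a_assoc)
  next
    fix u v assume uv: "u \<in> carrier (?F)" "v \<in> carrier (?F)"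
    show "u \<oplus>\<^bsub>?F\<^esub> v = v \<oplus>\<^bsub>?F\<^esub> u"
      by (rule ext) (simp_all add: add uv, simp add: add_free_module c uv a_comm)
  next
    fix u assume u: "u \<in> carrier (?F)"
    show "\<zero>\<^bsub>?F\<^esub> \<oplus>\<^bsub>?F\<^esub> u = u"
      by (rule ext) (simp_all add: add zero u, simp add: add_free_module zero_free_module c u)
  qed (fact zero add)+
  then show ?thesis
  proof (rule left_moduleI[OF assms])
    fix a b u assume ab: "a \<in> carrier R" "b \<in> carrier R" and u: "u \<in> carrier (?F)"
    show "(a \<oplus>\<^bsub>R\<^esub> b) \<odot>\<^bsub>?F\<^esub> u =
        a \<odot>\<^bsub>?F\<^esub> u \<oplus>\<^bsub>?F\<^esub> b \<odot>\<^bsub>?F\<^esub> u"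
      by (rule ext) (simp_all add: add smult ab u,
          simp add: add_free_module smult_free_module c u ab l_distr)
    show "(a \<otimes>\<^bsub>R\<^esub> b) \<odot>\<^bsub>?F\<^esub> u =
        a \<odot>\<^bsub>?F\<^esub> (b \<odot>\<^bsub>?F\<^esub> u)"
      by (rule ext) (simp_all add: smult ab u, simp add: smult_free_module c u ab m_assoc)
  next
    fix a u v assume a: "a \<in> carrier R"
      and uv: "u \<in> carrier (?F)" "v \<in> carrier (?F)"
    show "a \<odot>\<^bsub>?F\<^esub> (u \<oplus>\<^bsub>?F\<^esub> v) =
        a \<odot>\<^bsub>?F\<^esub> u \<oplus>\<^bsub>?F\<^esub> a \<odot>\<^bsub>?F\<^esub> v"
      by (rule ext) (simp_all add: add smult a uv,
          simp add: add_free_module smult_free_module c uv a r_distr)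
  next
    fix u assume u: "u \<in> carrier (?F)"
    show "\<one>\<^bsub>R\<^esub> \<odot>\<^bsub>?F\<^esub> u = u"
      by (rule ext) (simp_all add: smult u, simp add: smult_free_module c u)
  qed (fact smult)
qed

definition unit_vec :: "('a, 'e) ring_scheme \<Rightarrow> nat \<Rightarrow> nat \<Rightarrow> nat \<Rightarrow> 'a"
  where "unit_vec R n j = (\<lambda>i\<in>{..<n}. if i = j then \<one>\<^bsub>R\<^esub> else \<zero>\<^bsub>R\<^esub>)"

lemma unit_vec_closed: "ring R \<Longrightarrow> unit_vec R n j \<in> carrier (free_module R n)"
  by (auto simp: unit_vec_def carrier_free_module ring.ring_simprules)

lemma free_module_hom_eq:
  assumes "ring R" "left_module R M"
    and f: "f \<in> lhom R (free_module R n) M" and g: "g \<in> lhom R (free_module R n) M"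
    and eq: "\<And>j. j < n \<Longrightarrow> f (unit_vec R n j) = g (unit_vec R n j)"
  shows "f = g"
proof (rule lhom_eqI[OF f g])
  let ?F = "free_module R n"
  interpret ring R by fact
  interpret F: left_module R ?F using left_module_free assms(1) .
  \<comment> \<open>Induction on k over the vectors supported below k. The step splits off
    coordinate k as a multiple of a unit vector, and k = n gives the claim.\<close>
  have *: "\<lbrakk>u \<in> carrier (?F); \<And>i. k \<le> i \<Longrightarrow> i < n \<Longrightarrow> u i = \<zero>\<^bsub>R\<^esub>\<rbrakk> \<Longrightarrow> k \<le> n \<Longrightarrow> f u = g u"
    for k u
  proof (induction k arbitrary: u)
    case 0
    then have "u = \<zero>\<^bsub>?F\<^esub>"
      by (auto simp: free_module_simps PiE_def extensional_def restrict_def fun_eq_iff)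
    then show ?case
      using lhom_zero[OF F.left_module_axioms assms(2)] f g by metis
  next
    case (Suc k)
    let ?v = "\<lambda>i\<in>{..<n}. if i = k then \<zero>\<^bsub>R\<^esub> else u i"
    have v: "?v \<in> carrier (?F)"
      using Suc.prems by (auto simp: free_module_simps)
    have uk: "u k \<in> carrier R" using Suc.prems by (auto simp: free_module_simps)
    have e: "unit_vec R n k \<in> carrier (?F)" using unit_vec_closed assms(1) .
    have c: "u i \<in> carrier R" if "i < n" for i using Suc.prems that by (auto simp: free_module_simps)
    have u: "u = ?v \<oplus>\<^bsub>?F\<^esub> u k \<odot>\<^bsub>?F\<^esub> unit_vec R n k"
    proof
      fix i show "u i = (?v \<oplus>\<^bsub>?F\<^esub> u k \<odot>\<^bsub>?F\<^esub> unit_vec R n k) i"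
        using Suc.prems(1) c uk
        by (cases "i < n") (auto simp: free_module_simps unit_vec_def PiE_def extensional_def)
    qed
    have "f ?v = g ?v"
    proof (rule Suc.IH[OF v])
      show "?v i = \<zero>\<^bsub>R\<^esub>" if "k \<le> i" "i < n" for i
        using that Suc.prems(2)[of i] by simp
    qed (use Suc.prems in simp)
    moreover have "f (u k \<odot>\<^bsub>?F\<^esub> unit_vec R n k) = g (u k \<odot>\<^bsub>?F\<^esub> unit_vec R n k)"
      using uk e f g eq[of k] Suc.prems by (simp add: lhom_smult)
    moreover have "u k \<odot>\<^bsub>?F\<^esub> unit_vec R n k \<in> carrier (?F)"
      using uk e by (rule F.smult_closed)
    ultimately show ?case
      by (subst (1 2) u) (simp add: lhom_add[OF f] lhom_add[OF g] v del: restrict_apply)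
  qed
  show "f u = g u" if "u \<in> carrier (?F)" for u
    using *[of u n] that by auto
qed

lemma free_module_hom_exists:
  assumes "ring R" "left_module R M" and m: "\<And>j. j < n \<Longrightarrow> m j \<in> carrier M"
  obtains f where "f \<in> lhom R (free_module R n) M" "\<And>j. j < n \<Longrightarrow> f (unit_vec R n j) = m j"
proof -
  let ?F = "free_module R n"
  interpret M: left_module R M by fact
  interpret F: left_module R ?F using left_module_free assms(1) .
  define f where "f = (\<lambda>u\<in>carrier (?F). \<Oplus>\<^bsub>M\<^esub>i\<in>{..<n}. u i \<odot>\<^bsub>M\<^esub> m i)"
  have c: "u i \<in> carrier R" if "u \<in> carrier (?F)" "i < n" for u i
    using that by (auto simp: carrier_free_module)
  have smsum: "a \<odot>\<^bsub>M\<^esub> (\<Oplus>\<^bsub>M\<^esub>i\<in>A. h i) = (\<Oplus>\<^bsub>M\<^esub>i\<in>A. a \<odot>\<^bsub>M\<^esub> h i)"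
    if "finite A" "a \<in> carrier R" "h \<in> A \<rightarrow> carrier M" for a A and h :: "nat \<Rightarrow> _"
    using that
  proof (induction A rule: finite_induct)
    case (insert x A)
    then have h: "h x \<in> carrier M" "h \<in> A \<rightarrow> carrier M"
      and ah: "(\<lambda>i. a \<odot>\<^bsub>M\<^esub> h i) \<in> A \<rightarrow> carrier M" "a \<odot>\<^bsub>M\<^esub> h x \<in> carrier M"
      by (auto intro: M.smult_closed)
    have "a \<odot>\<^bsub>M\<^esub> (\<Oplus>\<^bsub>M\<^esub>i\<in>insert x A. h i) = a \<odot>\<^bsub>M\<^esub> (h x \<oplus>\<^bsub>M\<^esub> (\<Oplus>\<^bsub>M\<^esub>i\<in>A. h i))"
      using M.M.finsum_insert[OF insert.hyps h(2,1)] by simp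
    also have "\<dots> = a \<odot>\<^bsub>M\<^esub> h x \<oplus>\<^bsub>M\<^esub> (\<Oplus>\<^bsub>M\<^esub>i\<in>A. a \<odot>\<^bsub>M\<^esub> h i)"
      using M.smult_r_distr[OF insert.prems(1) h(1) M.M.finsum_closed[OF h(2)]]
        insert.IH[OF insert.prems(1) h(2)] by simp
    finally show ?case using M.M.finsum_insert[OF insert.hyps ah] by simp
  qed (simp add: M.smult_r_null)
  have "f \<in> lhom R (?F) M"
  proof (rule lhomI)
    show "f \<in> carrier (?F) \<rightarrow>\<^sub>E carrier M"
      by (auto simp: f_def c m intro!: M.M.finsum_closed M.smult_closed)
  next
    fix u v assume uv: "u \<in> carrier (?F)" "v \<in> carrier (?F)"
    have "f (u \<oplus>\<^bsub>?F\<^esub> v) =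
        (\<Oplus>\<^bsub>M\<^esub>i\<in>{..<n}. (u \<oplus>\<^bsub>?F\<^esub> v) i \<odot>\<^bsub>M\<^esub> m i)"
      using F.M.a_closed[OF uv] by (simp add: f_def)
    also have "\<dots> = (\<Oplus>\<^bsub>M\<^esub>i\<in>{..<n}. u i \<odot>\<^bsub>M\<^esub> m i \<oplus>\<^bsub>M\<^esub> v i \<odot>\<^bsub>M\<^esub> m i)"
      by (rule M.M.finsum_cong')
        (auto simp: add_free_module c[OF uv(1)] c[OF uv(2)] m M.smult_closed M.smult_l_distr)
    also have "\<dots> = (\<Oplus>\<^bsub>M\<^esub>i\<in>{..<n}. u i \<odot>\<^bsub>M\<^esub> m i) \<oplus>\<^bsub>M\<^esub> (\<Oplus>\<^bsub>M\<^esub>i\<in>{..<n}. v i \<odot>\<^bsub>M\<^esub> m i)"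
      by (rule M.M.finsum_addf) (auto simp: c[OF uv(1)] c[OF uv(2)] m M.smult_closed)
    finally show "f (u \<oplus>\<^bsub>?F\<^esub> v) = f u \<oplus>\<^bsub>M\<^esub> f v"
      using uv by (simp add: f_def)
  next
    fix a u assume au: "a \<in> carrier R" "u \<in> carrier (?F)"
    have "f (a \<odot>\<^bsub>?F\<^esub> u) = (\<Oplus>\<^bsub>M\<^esub>i\<in>{..<n}. (a \<odot>\<^bsub>?F\<^esub> u) i \<odot>\<^bsub>M\<^esub> m i)"
      using F.smult_closed[OF au] by (simp add: f_def)
    also have "\<dots> = (\<Oplus>\<^bsub>M\<^esub>i\<in>{..<n}. a \<odot>\<^bsub>M\<^esub> (u i \<odot>\<^bsub>M\<^esub> m i))"
      by (rule M.M.finsum_cong')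
        (auto simp: smult_free_module c[OF au(2)] au(1) m M.smult_closed M.smult_assoc)
    also have "\<dots> = a \<odot>\<^bsub>M\<^esub> (\<Oplus>\<^bsub>M\<^esub>i\<in>{..<n}. u i \<odot>\<^bsub>M\<^esub> m i)"
      by (rule smsum[symmetric]) (auto simp: au(1) c[OF au(2)] m M.smult_closed)
    finally show "f (a \<odot>\<^bsub>?F\<^esub> u) = a \<odot>\<^bsub>M\<^esub> f u"
      using au by (simp add: f_def)
  qed
  moreover have "f (unit_vec R n j) = m j" if "j < n" for j
  proof -
    have "f (unit_vec R n j) = (\<Oplus>\<^bsub>M\<^esub>i\<in>{..<n}. unit_vec R n j i \<odot>\<^bsub>M\<^esub> m i)"
      by (simp add: f_def unit_vec_closed assms(1))
    also have "\<dots> = (\<Oplus>\<^bsub>M\<^esub>i\<in>{..<n}. if j = i then m i else \<zero>\<^bsub>M\<^esub>)"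
      using m by (intro M.M.finsum_cong') (auto simp: unit_vec_def M.smult_one M.smult_l_null)
    also have "\<dots> = m j"
      using that m by (intro M.M.finsum_singleton) auto
    finally show ?thesis .
  qed
  ultimately show thesis by (rule that)
qed

text \<open>Projectivity of free modules: each unit vector chooses a preimage. The image of
  \<open>h\<close> is bounded by that of \<open>d\<close> instead of asking for \<open>d\<close> to
  be onto, since a differential of a resolution only reaches the next kernel.\<close>

lemma free_module_lift:
  assumes "ring R" "left_module R M" "left_module R N"
    and d: "d \<in> lhom R M N" and h: "h \<in> lhom R (free_module R n) N"
    and im: "h ` carrier (free_module R n) \<subseteq> d ` carrier M"
  obtains f where "f \<in> lhom R (free_module R n) M"
    "\<And>u. u \<in> carrier (free_module R n) \<Longrightarrow> d (f u) = h u"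
proof -
  have "\<exists>m. m \<in> carrier M \<and> d m = h (unit_vec R n j)" for j
    using im unit_vec_closed[OF assms(1), of n j] by (metis imageE image_subset_iff)
  then obtain m where m: "\<And>j. m j \<in> carrier M" "\<And>j. d (m j) = h (unit_vec R n j)" by metis
  obtain f where f: "f \<in> lhom R (free_module R n) M" "\<And>j. j < n \<Longrightarrow> f (unit_vec R n j) = m j"
    using free_module_hom_exists[OF assms(1,2), of n m] m by blast
  have "(\<lambda>u\<in>carrier (free_module R n). d (f u)) = h"
    by (rule free_module_hom_eq[OF assms(1,3) lhom_compose[OF left_module_free[OF assms(1)] f(1) d] h])
      (simp add: unit_vec_closed assms(1) f(2) m)
  then have "\<And>u. u \<in> carrier (free_module R n) \<Longrightarrow> d (f u) = h u"
    by (metis restrict_apply')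
  with f(1) show thesis by (rule that)
qed

section \<open>Free resolutions\<close>

text \<open>Folding the augmentation into degree 0 gives exactness at every spot the single form
  \<open>d_image\<close>, on which the lifting steps in all degrees rest.\<close>

definition syzygy :: "('a, 'e) ring_scheme \<Rightarrow> ('a, 'm, 'f) module_scheme \<Rightarrow> ('a, 'm) resolution
    \<Rightarrow> nat \<Rightarrow> (nat \<Rightarrow> 'a) set"
  where "syzygy R N P n = (case n of
      0 \<Rightarrow> {u \<in> carrier (res_module R P 0). res_aug P u = \<zero>\<^bsub>N\<^esub>}
    | Suc i \<Rightarrow> {u \<in> carrier (res_module R P (Suc i)). res_diff P i u = \<zero>\<^bsub>res_module R P i\<^esub>})"

lemma syzygy_0: "syzygy R N P 0 = {u \<in> carrier (res_module R P 0). res_aug P u = \<zero>\<^bsub>N\<^esub>}"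
  and syzygy_Suc: "syzygy R N P (Suc i) =
    {u \<in> carrier (res_module R P (Suc i)). res_diff P i u = \<zero>\<^bsub>res_module R P i\<^esub>}"
  by (simp_all add: syzygy_def)

locale resolved_module = left_module R N
  for R :: "('a, 'e) ring_scheme" (structure) and N :: "('a, 'm, 'f) module_scheme" (structure) +
  fixes P :: "('a, 'm) resolution"
  assumes free_resolution: "free_resolution R N P"
begin

abbreviation "F \<equiv> res_module R P"
abbreviation "d \<equiv> res_diff P"

lemma F_module: "left_module R (F i)"
  unfolding res_module_def using R.ring_axioms by (rule left_module_free)

lemma d_hom: "d i \<in> lhom R (F (Suc i)) (F i)"
  and aug_hom: "res_aug P \<in> lhom R (F 0) N"
  and aug_surj: "res_aug P ` carrier (F 0) = carrier N"
  using free_resolution by (simp_all add: free_resolution_def)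

lemma d_image: "d i ` carrier (F (Suc i)) = syzygy R N P i"
  using free_resolution by (cases i) (simp_all add: free_resolution_def syzygy_0 syzygy_Suc)

lemma d_syzygy: "u \<in> carrier (F (Suc i)) \<Longrightarrow> d i u \<in> syzygy R N P i"
  using d_image by blast

lemma d_d: "u \<in> carrier (F (Suc (Suc i))) \<Longrightarrow> d i (d (Suc i) u) = \<zero>\<^bsub>F i\<^esub>"
  using d_syzygy[of u "Suc i"] by (simp add: syzygy_Suc)

lemma aug_d: "u \<in> carrier (F (Suc 0)) \<Longrightarrow> res_aug P (d 0 u) = \<zero>\<^bsub>N\<^esub>"
  using d_syzygy[of u 0] by (simp add: syzygy_0)

lemma syzygy_closed: "u \<in> syzygy R N P i \<Longrightarrow> u \<in> carrier (F i)"
  by (cases i) (simp_all add: syzygy_0 syzygy_Suc)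

lemma lift_to_syzygy:
  assumes "h \<in> lhom R (res_module R Q n) (F i)" "h ` carrier (res_module R Q n) \<subseteq> syzygy R N P i"
  shows "\<exists>f\<in>lhom R (res_module R Q n) (F (Suc i)). \<forall>u\<in>carrier (res_module R Q n). d i (f u) = h u"
  using free_module_lift[OF R.ring_axioms F_module F_module d_hom, of h "res_rank Q n" i] assms d_image
  unfolding res_module_def by metis

lemma lift_to_aug:
  assumes "h \<in> lhom R (res_module R Q n) N"
  shows "\<exists>f\<in>lhom R (res_module R Q n) (F 0). \<forall>u\<in>carrier (res_module R Q n). res_aug P (f u) = h u"
proof -
  have "h ` carrier (res_module R Q n) \<subseteq> res_aug P ` carrier (F 0)"
    using aug_surj lhom_closed[OF assms] by blast
  then show ?thesis
    using free_module_lift[OF R.ring_axioms F_module left_module_axioms aug_hom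
        assms[unfolded res_module_def]]
    unfolding res_module_def by metis
qed

end

text \<open>Vanishing of Ext in degree i + 1, computed from P and phrased with elements instead of
  quotient groups. The augmentation of P does not occur, so isomorphic modules can share the
  test.\<close>

definition ext_vanishes ::
    "('a, 'e) ring_scheme \<Rightarrow> ('a, 'm) resolution \<Rightarrow> ('a, 'n, 'g) module_scheme \<Rightarrow> nat \<Rightarrow> bool"
  where "ext_vanishes R P L i \<longleftrightarrow>
    (\<forall>f\<in>lhom R (res_module R P (Suc i)) L.
      (\<forall>u\<in>carrier (res_module R P (Suc (Suc i))). f (res_diff P (Suc i) u) = \<zero>\<^bsub>L\<^esub>) \<longrightarrow>
      (\<exists>g\<in>lhom R (res_module R P i) L.
        \<forall>u\<in>carrier (res_module R P (Suc i)). f u = g (res_diff P i u)))"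

lemma hom_group_simps:
  "carrier (hom_group R M N) = lhom R M N"
  "f \<otimes>\<^bsub>hom_group R M N\<^esub> g = (\<lambda>u\<in>carrier M. f u \<oplus>\<^bsub>N\<^esub> g u)"
  "\<one>\<^bsub>hom_group R M N\<^esub> = (\<lambda>u\<in>carrier M. \<zero>\<^bsub>N\<^esub>)"
  by (simp_all add: hom_group_def)

context resolved_module
begin

lemma mem_cocycles:
  "f \<in> cocycles R P L i \<longleftrightarrow>
    f \<in> lhom R (F i) L \<and> (\<forall>u\<in>carrier (F (Suc i)). f (d i u) = \<zero>\<^bsub>L\<^esub>)"
  unfolding cocycles_def coboundary_def hom_group_simps
  by (auto simp: fun_eq_iff restrict_def split: if_splits)

lemma mem_coboundaries_Suc:
  assumes "f \<in> lhom R (F (Suc i)) L"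
  shows "f \<in> coboundaries R P L (Suc i) \<longleftrightarrow>
    (\<exists>g\<in>lhom R (F i) L. \<forall>u\<in>carrier (F (Suc i)). f u = g (d i u))" (is "_ = ?R")
proof
  assume "f \<in> coboundaries R P L (Suc i)"
  then show ?R by (auto simp: coboundaries_def coboundary_def)
next
  assume ?R
  then obtain g where g: "g \<in> lhom R (F i) L" "\<forall>u\<in>carrier (F (Suc i)). f u = g (d i u)" by blast
  have "f = coboundary R P i g"
    unfolding coboundary_def
    by (rule lhom_eqI[OF assms lhom_compose[OF F_module d_hom g(1)]]) (simp add: g)
  then show "f \<in> coboundaries R P L (Suc i)" using g(1) by (simp add: coboundaries_def)
qed

text \<open>A quotient Z/B is trivial exactly when Z is contained in B. In one direction the coset
  of f contains 0 + f; in the other, differences of cocycles are cocycles, so every coset of Z is Z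
  itself.\<close>

lemma trivial_cohomology_iff:
  assumes L: "left_module R L"
  shows "trivial_group (cohomology R P L (Suc i)) \<longleftrightarrow> ext_vanishes R P L i"
proof -
  interpret L: left_module R L by fact
  let ?Z = "cocycles R P L (Suc i)" and ?B = "coboundaries R P L (Suc i)"
  let ?H = "hom_group R (F (Suc i)) L"
  let ?G = "?H\<lparr>carrier := ?Z\<rparr>"
  have Z: "f \<in> lhom R (F (Suc i)) L" if "f \<in> ?Z" for f using that by (simp add: mem_cocycles)
  have BZ: "?B \<subseteq> ?Z"
  proof
    fix f assume "f \<in> ?B"
    then obtain g where g: "g \<in> lhom R (F i) L" "f = coboundary R P i g"
      by (auto simp: coboundaries_def)
    then have "f \<in> lhom R (F (Suc i)) L"
      unfolding coboundary_def using lhom_compose[OF F_module d_hom] by blast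
    moreover have "f (d (Suc i) u) = \<zero>\<^bsub>L\<^esub>" if "u \<in> carrier (F (Suc (Suc i)))" for u
      using g that lhom_zero[OF F_module L g(1)]
      by (simp add: coboundary_def d_d lhom_closed[OF d_hom])
    ultimately show "f \<in> ?Z" by (simp add: mem_cocycles)
  qed
  have van: "ext_vanishes R P L i \<longleftrightarrow> ?Z \<subseteq> ?B"
    unfolding ext_vanishes_def subset_iff by (auto simp: mem_cocycles mem_coboundaries_Suc)
  have zeroB: "(\<lambda>u\<in>carrier (F (Suc i)). \<zero>\<^bsub>L\<^esub>) \<in> ?B"
    by (subst mem_coboundaries_Suc[OF lhom_fun_zero[OF F_module L]])
      (auto intro!: bexI[OF _ lhom_fun_zero[OF F_module L]] simp: lhom_closed[OF d_hom])
  have add: "f \<otimes>\<^bsub>?H\<^esub> g \<in> ?Z" if "f \<in> ?Z" "g \<in> ?Z" for f g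
    using that lhom_fun_add[OF F_module L, of f "Suc i" g]
    by (simp add: mem_cocycles hom_group_simps lhom_closed[OF d_hom])
  have diff: "\<exists>h\<in>?Z. g = h \<otimes>\<^bsub>?H\<^esub> f" if "f \<in> ?Z" "g \<in> ?Z" for f g
  proof
    let ?h = "\<lambda>u\<in>carrier (F (Suc i)). g u \<ominus>\<^bsub>L\<^esub> f u"
    show h: "?h \<in> ?Z"
      using that lhom_fun_diff[OF F_module L, of g "Suc i" f]
      by (simp add: mem_cocycles lhom_closed[OF d_hom] a_minus_def)
    have "(\<lambda>u\<in>carrier (F (Suc i)). ?h u \<oplus>\<^bsub>L\<^esub> f u) \<in> lhom R (F (Suc i)) L"
      using lhom_fun_add[OF F_module L] h that Z by blast
    then show "g = ?h \<otimes>\<^bsub>?H\<^esub> f"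
      unfolding hom_group_simps
    proof (rule lhom_eqI[OF Z[OF that(2)]])
      fix u assume u: "u \<in> carrier (F (Suc i))"
      then have "f u \<in> carrier L" "g u \<in> carrier L" using that Z lhom_closed by metis+
      then show "g u = (\<lambda>u\<in>carrier (F (Suc i)). ?h u \<oplus>\<^bsub>L\<^esub> f u) u"
        using u by (simp add: a_minus_def L.M.a_assoc L.M.l_neg)
    qed
  qed
  have co: "cohomology R P L (Suc i) =
      \<lparr>carrier = rcosets\<^bsub>?G\<^esub> ?B, monoid.mult = set_mult ?G, one = ?B\<rparr>"
    by (simp add: cohomology_def FactGroup_def)
  show ?thesis unfolding van
  proof
    assume "trivial_group (cohomology R P L (Suc i))"
    then have *: "rcosets\<^bsub>?G\<^esub> ?B = {?B}" by (simp add: trivial_group_def co)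
    show "?Z \<subseteq> ?B"
    proof
      fix f assume f: "f \<in> ?Z"
      then have "?B #>\<^bsub>?G\<^esub> f \<in> rcosets\<^bsub>?G\<^esub> ?B" by (auto simp: RCOSETS_def)
      then have "?B #>\<^bsub>?G\<^esub> f = ?B" using * by auto
      then have "(\<lambda>u\<in>carrier (F (Suc i)). \<zero>\<^bsub>L\<^esub>) \<otimes>\<^bsub>?H\<^esub> f \<in> ?B"
        using zeroB by (auto simp: r_coset_def)
      moreover have "(\<lambda>u\<in>carrier (F (Suc i)). \<zero>\<^bsub>L\<^esub>) \<otimes>\<^bsub>?H\<^esub> f = f"
        unfolding hom_group_simps
        by (rule lhom_eqI[OF lhom_fun_add[OF F_module L lhom_fun_zero[OF F_module L] Z[OF f]] Z[OF f]])
          (simp add: lhom_closed[OF Z[OF f]])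
      ultimately show "f \<in> ?B" by simp
    qed
  next
    assume "?Z \<subseteq> ?B"
    with BZ have eq: "?B = ?Z" by blast
    have coset: "?Z #>\<^bsub>?G\<^esub> f = ?Z" if "f \<in> ?Z" for f
      using add diff[OF that] that by (auto simp: r_coset_def)
    have ne: "?Z \<noteq> {}" using zeroB eq by blast
    have sm: "?Z <#>\<^bsub>?H\<^esub> ?Z = ?Z"
      using add diff ne by (auto simp: set_mult_def) blast
    have "rcosets\<^bsub>?G\<^esub> ?Z = {?Z}"
      using coset ne by (auto simp: RCOSETS_def)
    then show "trivial_group (cohomology R P L (Suc i))"
      unfolding co eq trivial_group_def
      by (auto intro!: groupI simp: sm)
  qed
qed

end

section \<open>Comparison of resolutions and independence of Ext\<close>

lemma resolved_moduleI:
  "left_module R N \<Longrightarrow> free_resolution R N P \<Longrightarrow> resolved_module R N P"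
  by (simp add: resolved_module_def resolved_module_axioms_def)

lemma comparison_map:
  assumes "resolved_module R N P" "resolved_module R N Q"
  obtains \<alpha> where "\<And>i. \<alpha> i \<in> lhom R (res_module R P i) (res_module R Q i)"
    "\<And>u. u \<in> carrier (res_module R P 0) \<Longrightarrow> res_aug Q (\<alpha> 0 u) = res_aug P u"
    "\<And>i u. u \<in> carrier (res_module R P (Suc i)) \<Longrightarrow>
      res_diff Q i (\<alpha> (Suc i) u) = \<alpha> i (res_diff P i u)"
proof -
  interpret P: resolved_module R N P by fact
  interpret Q: resolved_module R N Q by fact
  \<comment> \<open>The invariant carries syzygies to syzygies: this puts \<open>a (P.d n u)\<close>
    into the image of \<open>Q.d n\<close>, which allows the next lift. The augmentation concerns
    degree 0 only and rides along as an implication.\<close>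
  let ?S = "\<lambda>n a. a \<in> lhom R (P.F n) (Q.F n) \<and> a ` syzygy R N P n \<subseteq> syzygy R N Q n \<and>
    (n = 0 \<longrightarrow> (\<forall>u\<in>carrier (P.F 0). res_aug Q (a u) = res_aug P u))"
  have "\<exists>\<alpha>. \<forall>n. ?S n (\<alpha> n) \<and>
      (\<forall>u\<in>carrier (P.F (Suc n)). Q.d n (\<alpha> (Suc n) u) = \<alpha> n (P.d n u))"
  proof (rule dependent_nat_choice[where P = ?S
        and Q = "\<lambda>n a b. \<forall>u\<in>carrier (P.F (Suc n)). Q.d n (b u) = a (P.d n u)"])
    obtain a where a: "a \<in> lhom R (P.F 0) (Q.F 0)"
      "\<And>u. u \<in> carrier (P.F 0) \<Longrightarrow> res_aug Q (a u) = res_aug P u"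
      using Q.lift_to_aug[OF P.aug_hom] by blast
    moreover have "a ` syzygy R N P 0 \<subseteq> syzygy R N Q 0"
      using a lhom_closed[OF a(1)] by (auto simp: syzygy_0)
    ultimately show "\<exists>a. ?S 0 a" by blast
  next
    fix a n assume a: "?S n a"
    have h: "(\<lambda>u\<in>carrier (P.F (Suc n)). a (P.d n u)) \<in> lhom R (P.F (Suc n)) (Q.F n)"
      using a lhom_compose[OF P.F_module P.d_hom] by blast
    have im: "(\<lambda>u\<in>carrier (P.F (Suc n)). a (P.d n u)) ` carrier (P.F (Suc n)) \<subseteq> syzygy R N Q n"
      using a P.d_syzygy by auto
    obtain b where b: "b \<in> lhom R (P.F (Suc n)) (Q.F (Suc n))"
      "\<And>u. u \<in> carrier (P.F (Suc n)) \<Longrightarrow>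
        Q.d n (b u) = (\<lambda>u\<in>carrier (P.F (Suc n)). a (P.d n u)) u"
      using Q.lift_to_syzygy[OF h im] by blast
    have "b ` syzygy R N P (Suc n) \<subseteq> syzygy R N Q (Suc n)"
      using b lhom_closed[OF b(1)] lhom_zero[OF P.F_module Q.F_module conjunct1[OF a]]
      by (auto simp: syzygy_Suc)
    with b show "\<exists>b. ?S (Suc n) b \<and> (\<forall>u\<in>carrier (P.F (Suc n)). Q.d n (b u) = a (P.d n u))"
      by auto
  qed
  then obtain \<alpha> where *: "\<forall>n. ?S n (\<alpha> n) \<and> (\<forall>u\<in>carrier (P.F (Suc n)).
      Q.d n (\<alpha> (Suc n) u) = \<alpha> n (P.d n u))" ..
  show thesis
    by (rule that[of \<alpha>]) (use * in auto)
qed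

text \<open>The chain map \<delta> covers the zero map, so it can be contracted degree by degree:
  once \<open>d s\<close> agrees with \<delta> on syzygies, the difference of
  \<open>\<delta> (Suc n)\<close> and \<open>s d\<close> takes values in syzygies and lifts to the
  next s. The relation is recorded from degree one on, where Ext in positive degree is
  tested.\<close>

lemma null_homotopy:
  assumes "resolved_module R N P"
    and \<delta>: "\<And>i. \<delta> i \<in> lhom R (res_module R P i) (res_module R P i)"
    and \<delta>0: "\<And>u. u \<in> carrier (res_module R P 0) \<Longrightarrow> res_aug P (\<delta> 0 u) = \<zero>\<^bsub>N\<^esub>"
    and \<delta>d: "\<And>i u. u \<in> carrier (res_module R P (Suc i)) \<Longrightarrow>
      res_diff P i (\<delta> (Suc i) u) = \<delta> i (res_diff P i u)"
  shows "\<exists>s. (\<forall>i. s i \<in> lhom R (res_module R P i) (res_module R P (Suc i))) \<and>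
    (\<forall>i. \<forall>u\<in>carrier (res_module R P (Suc i)).
      \<delta> (Suc i) u = res_diff P (Suc i) (s (Suc i) u) \<oplus>\<^bsub>res_module R P (Suc i)\<^esub> s i (res_diff P i u))"
proof -
  interpret P: resolved_module R N P by fact
  let ?S = "\<lambda>n s. s \<in> lhom R (P.F n) (P.F (Suc n)) \<and> (\<forall>u\<in>syzygy R N P n. P.d n (s u) = \<delta> n u)"
  have "\<exists>s. \<forall>n. ?S n (s n) \<and> (\<forall>u\<in>carrier (P.F (Suc n)).
      \<delta> (Suc n) u = P.d (Suc n) (s (Suc n) u) \<oplus>\<^bsub>P.F (Suc n)\<^esub> s n (P.d n u))"
  proof (rule dependent_nat_choice[where P = ?S
        and Q = "\<lambda>n s t. \<forall>u\<in>carrier (P.F (Suc n)).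
          \<delta> (Suc n) u = P.d (Suc n) (t u) \<oplus>\<^bsub>P.F (Suc n)\<^esub> s (P.d n u)"])
    have "\<delta> 0 ` carrier (P.F 0) \<subseteq> syzygy R N P 0"
      using \<delta>0 lhom_closed[OF \<delta>] by (auto simp: syzygy_0)
    then obtain s where "s \<in> lhom R (P.F 0) (P.F (Suc 0))"
      "\<And>u. u \<in> carrier (P.F 0) \<Longrightarrow> P.d 0 (s u) = \<delta> 0 u"
      using P.lift_to_syzygy[OF \<delta>[of 0]] by blast
    then show "\<exists>s. ?S 0 s" using P.syzygy_closed by blast
  next
    fix s n assume s: "?S n s"
    interpret F: left_module R "P.F n" by (rule P.F_module)
    interpret F': left_module R "P.F (Suc n)" by (rule P.F_module)
    let ?sd = "\<lambda>u\<in>carrier (P.F (Suc n)). s (P.d n u)"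
    let ?h = "\<lambda>u\<in>carrier (P.F (Suc n)). \<delta> (Suc n) u \<ominus>\<^bsub>P.F (Suc n)\<^esub> ?sd u"
    have sd: "?sd \<in> lhom R (P.F (Suc n)) (P.F (Suc n))"
      using s lhom_compose[OF P.F_module P.d_hom] by blast
    have h: "?h \<in> lhom R (P.F (Suc n)) (P.F (Suc n))"
      using lhom_fun_diff[OF P.F_module P.F_module \<delta> sd] .
    have im: "?h ` carrier (P.F (Suc n)) \<subseteq> syzygy R N P (Suc n)"
    proof
      fix v assume "v \<in> ?h ` carrier (P.F (Suc n))"
      then obtain u where u: "u \<in> carrier (P.F (Suc n))" "v = ?h u" by blast
      have "P.d n v = P.d n (\<delta> (Suc n) u) \<ominus>\<^bsub>P.F n\<^esub> P.d n (s (P.d n u))"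
        using u lhom_diff[OF P.F_module P.F_module P.d_hom] lhom_closed[OF \<delta> u(1)]
          lhom_closed[OF sd u(1)] by simp
      also have "\<dots> = \<zero>\<^bsub>P.F n\<^esub>"
        using s P.d_syzygy[OF u(1)] \<delta>d[OF u(1)] lhom_closed[OF \<delta>] P.syzygy_closed
        by (simp add: a_minus_def F.M.r_neg)
      finally show "v \<in> syzygy R N P (Suc n)"
        using lhom_closed[OF h u(1)] u(2) by (simp only: syzygy_Suc mem_Collect_eq)
    qed
    then obtain t where t: "t \<in> lhom R (P.F (Suc n)) (P.F (Suc (Suc n)))"
      "\<And>u. u \<in> carrier (P.F (Suc n)) \<Longrightarrow> P.d (Suc n) (t u) = ?h u"
      using P.lift_to_syzygy[OF h im] by blast
    have eq: "\<delta> (Suc n) u = P.d (Suc n) (t u) \<oplus>\<^bsub>P.F (Suc n)\<^esub> s (P.d n u)"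
      if "u \<in> carrier (P.F (Suc n))" for u
      using t(2)[OF that] lhom_closed[OF \<delta> that] lhom_closed[OF sd that] that
      by (simp add: a_minus_def F'.M.a_assoc F'.M.l_neg)
    moreover have "P.d (Suc n) (t u) = \<delta> (Suc n) u" if "u \<in> syzygy R N P (Suc n)" for u
    proof -
      have u: "u \<in> carrier (P.F (Suc n))" using that P.syzygy_closed by blast
      have "s (P.d n u) = \<zero>\<^bsub>P.F (Suc n)\<^esub>"
        using that lhom_zero[OF P.F_module P.F_module conjunct1[OF s]] by (simp add: syzygy_Suc)
      then show ?thesis
        using eq[OF u] lhom_closed[OF P.d_hom lhom_closed[OF t(1) u]] by simp
    qed
    ultimately show "\<exists>t. ?S (Suc n) t \<and> (\<forall>u\<in>carrier (P.F (Suc n)).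
        \<delta> (Suc n) u = P.d (Suc n) (t u) \<oplus>\<^bsub>P.F (Suc n)\<^esub> s (P.d n u))"
      using t(1) by blast
  qed
  then obtain s where *: "\<forall>n. ?S n (s n) \<and> (\<forall>u\<in>carrier (P.F (Suc n)).
      \<delta> (Suc n) u = P.d (Suc n) (s (Suc n) u) \<oplus>\<^bsub>P.F (Suc n)\<^esub> s n (P.d n u))" ..
  then show ?thesis by (intro exI[of _ s]) simp
qed


text \<open>With comparison maps \<alpha>, \<beta> in both directions, the identity of P is
  \<open>\<beta> \<alpha> + \<delta>\<close>, and \<delta> is null-homotopic in positive degree. The
  cocycle f composed with \<beta> is a cocycle on Q, hence of the form \<open>h d\<close>; on the
  other summand only \<open>f s d\<close> is left, since f kills \<open>d s\<close>. So f is the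
  coboundary of \<open>h \<alpha> + f s\<close>.\<close>

lemma ext_vanishes_resolution_independent:
  assumes P: "resolved_module R N P" and Q: "resolved_module R N Q" and L: "left_module R L"
    and van: "ext_vanishes R Q L i"
  shows "ext_vanishes R P L i"
  unfolding ext_vanishes_def
proof (intro ballI impI)
  interpret P: resolved_module R N P by fact
  interpret Q: resolved_module R N Q by fact
  interpret L: left_module R L by fact
  fix f assume f: "f \<in> lhom R (P.F (Suc i)) L"
    and cocycle: "\<forall>u\<in>carrier (P.F (Suc (Suc i))). f (P.d (Suc i) u) = \<zero>\<^bsub>L\<^esub>"
  obtain \<alpha> where \<alpha>: "\<And>i. \<alpha> i \<in> lhom R (P.F i) (Q.F i)"
    and \<alpha>0: "\<And>u. u \<in> carrier (P.F 0) \<Longrightarrow> res_aug Q (\<alpha> 0 u) = res_aug P u"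
    and \<alpha>d: "\<And>i u. u \<in> carrier (P.F (Suc i)) \<Longrightarrow> Q.d i (\<alpha> (Suc i) u) = \<alpha> i (P.d i u)"
    by (rule comparison_map[OF P Q]) blast
  obtain \<beta> where \<beta>: "\<And>i. \<beta> i \<in> lhom R (Q.F i) (P.F i)"
    and \<beta>0: "\<And>u. u \<in> carrier (Q.F 0) \<Longrightarrow> res_aug P (\<beta> 0 u) = res_aug Q u"
    and \<beta>d: "\<And>i u. u \<in> carrier (Q.F (Suc i)) \<Longrightarrow> P.d i (\<beta> (Suc i) u) = \<beta> i (Q.d i u)"
    by (rule comparison_map[OF Q P]) blast
  note cl = lhom_closed[OF \<alpha>] lhom_closed[OF \<beta>] lhom_closed[OF P.d_hom] lhom_closed[OF Q.d_hom]
  have P_ab: "abelian_group (P.F j)" for j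
    using P.F_module[of j] by (simp add: left_module_def)
  define \<gamma> where "\<gamma> j = (\<lambda>u\<in>carrier (P.F j). \<beta> j (\<alpha> j u))" for j
  have \<gamma>: "\<gamma> j \<in> lhom R (P.F j) (P.F j)" for j
    unfolding \<gamma>_def by (rule lhom_compose[OF P.F_module \<alpha> \<beta>])
  define \<delta> where "\<delta> j = (\<lambda>u\<in>carrier (P.F j). (\<lambda>u\<in>carrier (P.F j). u) u \<ominus>\<^bsub>P.F j\<^esub> \<gamma> j u)" for j
  have \<delta>: "\<delta> j \<in> lhom R (P.F j) (P.F j)" for j
    unfolding \<delta>_def by (rule lhom_fun_diff[OF P.F_module P.F_module lhom_id[OF P.F_module] \<gamma>])
  have \<delta>0: "res_aug P (\<delta> 0 u) = \<zero>\<^bsub>N\<^esub>" if "u \<in> carrier (P.F 0)" for u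
    using that lhom_diff[OF P.F_module P.left_module_axioms P.aug_hom]
      P.M.r_neg[OF lhom_closed[OF P.aug_hom that]]
    by (simp add: \<delta>_def \<gamma>_def cl \<alpha>0 \<beta>0 a_minus_def)
  have \<delta>d: "P.d j (\<delta> (Suc j) u) = \<delta> j (P.d j u)" if "u \<in> carrier (P.F (Suc j))" for u j
    using that lhom_diff[OF P.F_module P.F_module P.d_hom]
    by (simp add: \<delta>_def \<gamma>_def cl \<alpha>d \<beta>d)
  have "\<exists>s. (\<forall>j. s j \<in> lhom R (P.F j) (P.F (Suc j))) \<and>
      (\<forall>j. \<forall>u\<in>carrier (P.F (Suc j)).
        \<delta> (Suc j) u = P.d (Suc j) (s (Suc j) u) \<oplus>\<^bsub>P.F (Suc j)\<^esub> s j (P.d j u))"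
    by (rule null_homotopy[OF P]) (simp_all add: \<delta> \<delta>0 \<delta>d)
  then obtain s where "(\<forall>j. s j \<in> lhom R (P.F j) (P.F (Suc j))) \<and>
      (\<forall>j. \<forall>u\<in>carrier (P.F (Suc j)).
        \<delta> (Suc j) u = P.d (Suc j) (s (Suc j) u) \<oplus>\<^bsub>P.F (Suc j)\<^esub> s j (P.d j u))" ..
  then have s: "\<And>j. s j \<in> lhom R (P.F j) (P.F (Suc j))"
    and s\<delta>: "\<And>j u. u \<in> carrier (P.F (Suc j)) \<Longrightarrow>
      \<delta> (Suc j) u = P.d (Suc j) (s (Suc j) u) \<oplus>\<^bsub>P.F (Suc j)\<^esub> s j (P.d j u)"
    by blast+
  define f' where "f' = (\<lambda>u\<in>carrier (Q.F (Suc i)). f (\<beta> (Suc i) u))"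
  have "f' \<in> lhom R (Q.F (Suc i)) L"
    unfolding f'_def by (rule lhom_compose[OF Q.F_module \<beta> f])
  moreover have "f' (Q.d (Suc i) u) = \<zero>\<^bsub>L\<^esub>" if "u \<in> carrier (Q.F (Suc (Suc i)))" for u
    using that cocycle by (simp add: f'_def cl flip: \<beta>d)
  ultimately obtain h where h: "h \<in> lhom R (Q.F i) L"
    "\<And>u. u \<in> carrier (Q.F (Suc i)) \<Longrightarrow> f' u = h (Q.d i u)"
    using van unfolding ext_vanishes_def by blast
  define g1 where "g1 = (\<lambda>u\<in>carrier (P.F i). h (\<alpha> i u))"
  define g2 where "g2 = (\<lambda>u\<in>carrier (P.F i). f (s i u))"
  have g1: "g1 \<in> lhom R (P.F i) L"
    unfolding g1_def by (rule lhom_compose[OF P.F_module \<alpha> h(1)])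
  have g2: "g2 \<in> lhom R (P.F i) L"
    unfolding g2_def by (rule lhom_compose[OF P.F_module s f])
  show "\<exists>g\<in>lhom R (P.F i) L. \<forall>u\<in>carrier (P.F (Suc i)). f u = g (P.d i u)"
  proof (rule bexI[OF _ lhom_fun_add[OF P.F_module L g1 g2]], rule ballI)
    fix u assume u: "u \<in> carrier (P.F (Suc i))"
    interpret F: left_module R "P.F (Suc i)" by (rule P.F_module)
    have c: "\<gamma> (Suc i) u \<in> carrier (P.F (Suc i))" "\<delta> (Suc i) u \<in> carrier (P.F (Suc i))"
      "s i (P.d i u) \<in> carrier (P.F (Suc i))"
      "P.d (Suc i) (s (Suc i) u) \<in> carrier (P.F (Suc i))"
      using u lhom_closed[OF \<gamma>] lhom_closed[OF \<delta>] lhom_closed[OF s] cl by auto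
    have "u = \<delta> (Suc i) u \<oplus>\<^bsub>P.F (Suc i)\<^esub> \<gamma> (Suc i) u"
      using u c by (simp add: \<delta>_def a_minus_def F.M.a_assoc F.M.l_neg)
    then have "f u = f (\<delta> (Suc i) u) \<oplus>\<^bsub>L\<^esub> f (\<gamma> (Suc i) u)"
      using lhom_add[OF f c(2,1)] by simp
    also have "f (\<delta> (Suc i) u) = g2 (P.d i u)"
      using lhom_add[OF f c(4,3)] lhom_closed[OF f c(3)] cocycle lhom_closed[OF s u]
      by (simp add: s\<delta>[OF u] g2_def cl u)
    also have "f (\<gamma> (Suc i) u) = g1 (P.d i u)"
      using h(2)[OF lhom_closed[OF \<alpha> u]] u by (simp add: \<gamma>_def f'_def g1_def cl \<alpha>d)
    finally show "f u = (\<lambda>u\<in>carrier (P.F i). g1 u \<oplus>\<^bsub>L\<^esub> g2 u) (P.d i u)"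
      using u lhom_closed[OF g1] lhom_closed[OF g2] by (simp add: cl L.M.a_comm)
  qed
qed

text \<open>\<open>Ext\<close> picks its resolution by \<open>SOME\<close>. The given P witnesses
  that this choice is a resolution at all, and independence moves the test from it to P.\<close>

lemma semi_Gorenstein_projective_iff:
  assumes "resolved_module R N P"
  shows "semi_Gorenstein_projective R N \<longleftrightarrow> (\<forall>i. ext_vanishes R P (regular R) i)"
proof -
  interpret P: resolved_module R N P by fact
  define Q where "Q = (SOME P. free_resolution R N P)"
  have Q: "resolved_module R N Q"
    unfolding Q_def
    using P.free_resolution by (intro resolved_moduleI P.left_module_axioms someI)
  have reg: "left_module R (regular R)" using left_module_regular P.R.ring_axioms .
  have "semi_Gorenstein_projective R N \<longleftrightarrow>
      (\<forall>i. trivial_group (cohomology R Q (regular R) (Suc i)))"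
    unfolding semi_Gorenstein_projective_def Ext_def Q_def
    by (metis One_nat_def Suc_le_D le_add1 plus_1_eq_Suc)
  also have "\<dots> \<longleftrightarrow> (\<forall>i. ext_vanishes R Q (regular R) i)"
    using resolved_module.trivial_cohomology_iff[OF Q reg] by simp
  also have "\<dots> \<longleftrightarrow> (\<forall>i. ext_vanishes R P (regular R) i)"
    using ext_vanishes_resolution_independent[OF _ _ reg] assms Q by blast
  finally show ?thesis .
qed

text \<open>The module is \<open>R / R d_0\<close>, resolved by right multiplications by
  \<open>d_0, d_1, ...\<close> on R, and \<open>l_ann\<close> is the exactness of this resolution.
  Every homomorphism from R to R is right multiplication by an element, so dualizing turns the
  differentials into left multiplications, and \<open>r_ann\<close> is the exactness of the dual
  complex in positive degrees.\<close>

lemma cyclic_semi_Gorenstein_projective: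
  fixes R :: "('a, 'e) ring_scheme" (structure) and d :: "nat \<Rightarrow> 'a"
  assumes N: "left_module R N" and g: "g \<in> carrier N"
    and gen: "\<And>v. v \<in> carrier N \<Longrightarrow> \<exists>a\<in>carrier R. v = a \<odot>\<^bsub>N\<^esub> g"
    and d: "\<And>n. d n \<in> carrier R"
    and ann_g: "\<And>a. a \<in> carrier R \<Longrightarrow> a \<odot>\<^bsub>N\<^esub> g = \<zero>\<^bsub>N\<^esub> \<longleftrightarrow> (\<exists>b\<in>carrier R. a = b \<otimes> d 0)"
    and l_ann: "\<And>n a. a \<in> carrier R \<Longrightarrow>
      a \<otimes> d n = \<zero> \<longleftrightarrow> (\<exists>b\<in>carrier R. a = b \<otimes> d (Suc n))"
    and r_ann: "\<And>n a. a \<in> carrier R \<Longrightarrow> d (Suc n) \<otimes> a = \<zero> \<Longrightarrow>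
      \<exists>b\<in>carrier R. a = d n \<otimes> b"
  shows "semi_Gorenstein_projective R N"
proof -
  interpret N: left_module R N by fact
  let ?F = "free_module R (Suc 0)"
  have reg: "left_module R (regular R)" using left_module_regular N.R.ring_axioms .
  have F: "left_module R ?F" using left_module_free N.R.ring_axioms .
  interpret F: left_module R ?F by (rule F)
  \<comment> \<open>Vectors of the free module of rank one are functions on
    \<open>{..<Suc 0}\<close>; \<open>vec\<close> and evaluation at 0 identify them with elements of
    R.\<close>
  define vec where "vec a = (\<lambda>i\<in>{..<Suc 0}. a)" for a :: 'a
  have vec_closed: "a \<in> carrier R \<Longrightarrow> vec a \<in> carrier ?F" for a
    by (simp add: vec_def carrier_free_module)
  have vec_0: "vec a 0 = a" for a by (simp add: vec_def)
  have vec_eq: "u = vec (u 0)" if "u \<in> carrier ?F" for u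
    using that by (auto simp: vec_def carrier_free_module PiE_def extensional_def fun_eq_iff)
  have zero_cl: "u 0 \<in> carrier R" if "u \<in> carrier ?F" for u
    using that by (auto simp: carrier_free_module)
  have zero_iff: "u = \<zero>\<^bsub>?F\<^esub> \<longleftrightarrow> u 0 = \<zero>" if "u \<in> carrier ?F" for u
    using vec_eq[OF that] by (auto simp: zero_free_module vec_def)
  have comp: "(u \<oplus>\<^bsub>?F\<^esub> v) 0 = u 0 \<oplus> v 0" "(a \<odot>\<^bsub>?F\<^esub> u) 0 = a \<otimes> u 0" for a u v
    by (simp_all add: add_free_module smult_free_module)
  have vec_hom: "vec a \<oplus>\<^bsub>?F\<^esub> vec b = vec (a \<oplus> b)" "a \<odot>\<^bsub>?F\<^esub> vec b = vec (a \<otimes> b)" for a b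
    by (auto simp: add_free_module smult_free_module vec_def fun_eq_iff)
  define P where
    "P = \<lparr>res_rank = (\<lambda>_. Suc 0), res_diff = (\<lambda>n. \<lambda>u\<in>carrier ?F. vec (u 0 \<otimes> d n)),
      res_aug = (\<lambda>u\<in>carrier ?F. u 0 \<odot>\<^bsub>N\<^esub> g)\<rparr>"
  have RP: "res_module R P n = ?F" for n by (simp add: res_module_def P_def)
  have P_simps: "res_diff P n u = vec (u 0 \<otimes> d n)" "res_aug P u = u 0 \<odot>\<^bsub>N\<^esub> g"
    if "u \<in> carrier ?F" for n u
    using that by (simp_all add: P_def)
  have diff_im: "res_diff P n ` carrier ?F = {u \<in> carrier ?F. \<exists>b\<in>carrier R. u 0 = b \<otimes> d n}" for n
  proof (intro equalityI subsetI)
    fix u assume "u \<in> {u \<in> carrier ?F. \<exists>b\<in>carrier R. u 0 = b \<otimes> d n}"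
    then obtain b where b: "u \<in> carrier ?F" "b \<in> carrier R" "u 0 = b \<otimes> d n" by blast
    then have "u = res_diff P n (vec b)"
      using vec_eq[of u] by (simp add: P_simps vec_closed vec_0)
    then show "u \<in> res_diff P n ` carrier ?F" using vec_closed b by blast
  qed (auto simp: P_simps vec_0 d zero_cl intro!: vec_closed)
  have "free_resolution R N P"
    unfolding free_resolution_def RP
  proof (intro conjI allI)
    show "res_diff P n \<in> lhom R ?F ?F" for n
      by (rule lhomI) (auto simp: P_def d zero_cl vec_closed F.smult_closed comp vec_hom
          N.R.l_distr N.R.m_assoc)
    show "res_aug P \<in> lhom R ?F N"
      by (rule lhomI) (auto simp: P_def g zero_cl F.smult_closed N.smult_closed comp
          N.smult_l_distr N.smult_assoc)
    show "res_aug P ` carrier ?F = carrier N"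
    proof (intro equalityI subsetI)
      fix v assume "v \<in> carrier N"
      then obtain a where "a \<in> carrier R" "v = a \<odot>\<^bsub>N\<^esub> g" using gen by blast
      then have "v = res_aug P (vec a)" by (simp add: P_simps vec_closed vec_0)
      then show "v \<in> res_aug P ` carrier ?F" using vec_closed \<open>a \<in> carrier R\<close> by blast
    qed (auto simp: P_simps zero_cl g N.smult_closed)
    show "res_diff P 0 ` carrier ?F = {u \<in> carrier ?F. res_aug P u = \<zero>\<^bsub>N\<^esub>}"
      unfolding diff_im by (intro Collect_cong conj_cong refl) (simp add: P_simps ann_g zero_cl)
    show "res_diff P (Suc n) ` carrier ?F = {u \<in> carrier ?F. res_diff P n u = \<zero>\<^bsub>?F\<^esub>}" for n
      unfolding diff_im
      by (intro Collect_cong conj_cong refl)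
        (simp add: P_simps zero_iff vec_closed d vec_0 l_ann zero_cl)
  qed
  then interpret P: resolved_module R N P by (rule resolved_moduleI[OF N])
  have "ext_vanishes R P (regular R) n" for n
    unfolding ext_vanishes_def RP
  proof (intro ballI impI)
    fix f assume f: "f \<in> lhom R ?F (regular R)"
      and z: "\<forall>u\<in>carrier ?F. f (res_diff P (Suc n) u) = \<zero>\<^bsub>regular R\<^esub>"
    define a where "a = f (vec \<one>)"
    have a: "a \<in> carrier R" using lhom_closed[OF f vec_closed] by (simp add: a_def)
    have fu: "f u = u 0 \<otimes> a" if u: "u \<in> carrier ?F" for u
    proof -
      have "u = u 0 \<odot>\<^bsub>?F\<^esub> vec \<one>"
        using vec_eq[OF u] zero_cl[OF u] by (simp add: vec_hom)
      then show ?thesis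
        using lhom_smult[OF f zero_cl[OF u] vec_closed[of "\<one>"]] by (simp add: a_def)
    qed
    have "f (res_diff P (Suc n) (vec \<one>)) = d (Suc n) \<otimes> a"
      by (simp add: P_simps vec_closed d vec_0 fu)
    then have "d (Suc n) \<otimes> a = \<zero>" using z vec_closed[of "\<one>"] by simp
    then obtain b where b: "b \<in> carrier R" "a = d n \<otimes> b" using r_ann a by blast
    let ?g = "\<lambda>u\<in>carrier ?F. u 0 \<otimes> b"
    have "?g \<in> lhom R ?F (regular R)"
      by (rule lhomI) (auto simp: b zero_cl F.smult_closed comp N.R.l_distr N.R.m_assoc)
    moreover have "f u = ?g (res_diff P n u)" if "u \<in> carrier ?F" for u
      using that b d by (simp add: fu P_simps vec_closed zero_cl vec_0 N.R.m_assoc)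
    ultimately show "\<exists>g\<in>lhom R ?F (regular R). \<forall>u\<in>carrier ?F. f u = g (res_diff P n u)" by blast
  qed
  then show ?thesis using semi_Gorenstein_projective_iff[OF P.resolved_module_axioms] by blast
qed

section \<open>Duals and triangular matrix rings\<close>

lemma left_module_submodule:
  assumes M: "left_module R M" and "submodule H R M"
  shows "left_module R (M\<lparr>carrier := H\<rparr>)"
proof -
  interpret M: left_module R M by fact
  note H = M.submoduleD[OF assms(2)]
  have sub: "u \<in> carrier M" if "u \<in> H" for u using H(1) that by blast
  have "abelian_group (M\<lparr>carrier := H\<rparr>)"
  proof (rule abelian_groupI)
    fix u assume "u \<in> carrier (M\<lparr>carrier := H\<rparr>)"
    then show "\<exists>v\<in>carrier (M\<lparr>carrier := H\<rparr>). v \<oplus>\<^bsub>M\<lparr>carrier := H\<rparr>\<^esub> u = \<zero>\<^bsub>M\<lparr>carrier := H\<rparr>\<^esub>"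
      using H sub by (intro bexI[of _ "\<ominus>\<^bsub>M\<^esub> u"]) (simp_all add: M.M.l_neg)
  qed (simp_all add: H sub M.M.a_ac)
  then show ?thesis
    by (intro left_moduleI M.R.ring_axioms)
      (simp_all add: H sub M.smult_l_distr M.smult_r_distr M.smult_assoc M.smult_one)
qed

lemma lhom_submodule_codomain:
  assumes "f \<in> lhom R L (M\<lparr>carrier := H\<rparr>)" "H \<subseteq> carrier M"
  shows "f \<in> lhom R L M"
  using assms by (auto simp: lhom_def)

lemma lisos_inv:
  assumes M: "left_module R M" and f: "f \<in> lisos R M N"
  shows "(\<lambda>v\<in>carrier N. inv_into (carrier M) f v) \<in> lisos R N M"
proof -
  interpret M: left_module R M by fact
  let ?g = "inv_into (carrier M) f"
  have fh: "f \<in> lhom R M N" and bij: "bij_betw f (carrier M) (carrier N)"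
    using f by (auto simp: lisos_def)
  have gc: "?g v \<in> carrier M" and fg: "f (?g v) = v" if "v \<in> carrier N" for v
    using that bij by (auto simp: bij_betw_def intro: inv_into_into f_inv_into_f)
  have gf: "?g (f u) = u" if "u \<in> carrier M" for u
    using that bij by (simp add: bij_betw_def)
  have add: "v \<oplus>\<^bsub>N\<^esub> w = f (?g v \<oplus>\<^bsub>M\<^esub> ?g w)" if "v \<in> carrier N" "w \<in> carrier N" for v w
    using that by (simp add: lhom_add[OF fh] gc fg)
  have sm: "a \<odot>\<^bsub>N\<^esub> v = f (a \<odot>\<^bsub>M\<^esub> ?g v)" if "a \<in> carrier R" "v \<in> carrier N" for a v
    using that by (simp add: lhom_smult[OF fh] gc fg)
  have "(\<lambda>v\<in>carrier N. ?g v) \<in> lhom R N M"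
  proof (rule lhomI)
    fix v w assume vw: "v \<in> carrier N" "w \<in> carrier N"
    have "v \<oplus>\<^bsub>N\<^esub> w \<in> carrier N"
      using vw lhom_closed[OF fh, of "?g v \<oplus>\<^bsub>M\<^esub> ?g w"] by (simp add: add gc)
    then show "(\<lambda>v\<in>carrier N. ?g v) (v \<oplus>\<^bsub>N\<^esub> w) =
        (\<lambda>v\<in>carrier N. ?g v) v \<oplus>\<^bsub>M\<^esub> (\<lambda>v\<in>carrier N. ?g v) w"
      using vw gf[of "?g v \<oplus>\<^bsub>M\<^esub> ?g w"] by (simp add: gc add)
  next
    fix a v assume av: "a \<in> carrier R" "v \<in> carrier N"
    have "a \<odot>\<^bsub>N\<^esub> v \<in> carrier N"
      using av lhom_closed[OF fh, of "a \<odot>\<^bsub>M\<^esub> ?g v"] by (simp add: sm gc M.smult_closed)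
    then show "(\<lambda>v\<in>carrier N. ?g v) (a \<odot>\<^bsub>N\<^esub> v) = a \<odot>\<^bsub>M\<^esub> (\<lambda>v\<in>carrier N. ?g v) v"
      using av gf[of "a \<odot>\<^bsub>M\<^esub> ?g v"] by (simp add: gc sm M.smult_closed)
  qed (simp add: gc)
  moreover have "bij_betw (\<lambda>v\<in>carrier N. ?g v) (carrier N) (carrier M)"
    using bij_betw_inv_into[OF bij] by (simp cong: bij_betw_cong)
  ultimately show ?thesis by (simp add: lisos_def)
qed

text \<open>Only the augmentation is composed with the isomorphism. Ranks and differentials stay the
  same, so that vanishing of Ext becomes literally the same condition for both modules.\<close>

lemma free_resolution_transfer:
  assumes R: "ring R" and M: "left_module R M" and N: "left_module R N"
    and P: "free_resolution R M P" and f: "f \<in> lisos R M N"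
  shows "free_resolution R N \<lparr>res_rank = res_rank P, res_diff = res_diff P,
    res_aug = \<lambda>u\<in>carrier (res_module R P 0). f (res_aug P u)\<rparr>"
proof -
  interpret P: resolved_module R M P using resolved_moduleI[OF M P] .
  interpret N: left_module R N by fact
  let ?aug = "\<lambda>u\<in>carrier (res_module R P 0). f (res_aug P u)"
  have fh: "f \<in> lhom R M N" and bij: "bij_betw f (carrier M) (carrier N)"
    using f by (auto simp: lisos_def)
  have aug: "res_aug P u \<in> carrier M" if "u \<in> carrier (res_module R P 0)" for u
    using lhom_closed[OF P.aug_hom that] .
  have "?aug u = \<zero>\<^bsub>N\<^esub> \<longleftrightarrow> res_aug P u = \<zero>\<^bsub>M\<^esub>" if "u \<in> carrier (res_module R P 0)" for u
    using inj_on_eq_iff[OF bij_betw_imp_inj_on[OF bij] aug[OF that] P.M.zero_closed]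
      that lhom_zero[OF M N fh] by simp
  then have ker: "{u \<in> carrier (res_module R P 0). ?aug u = \<zero>\<^bsub>N\<^esub>} =
      {u \<in> carrier (res_module R P 0). res_aug P u = \<zero>\<^bsub>M\<^esub>}" by blast
  have "?aug ` carrier (res_module R P 0) = f ` (res_aug P ` carrier (res_module R P 0))"
    by (auto simp: image_image)
  then have surj: "?aug ` carrier (res_module R P 0) = carrier N"
    using bij by (simp add: P.aug_surj bij_betw_def)
  have rm: "res_module R \<lparr>res_rank = res_rank P, res_diff = res_diff P, res_aug = ?aug\<rparr> i = res_module R P i" for i
    by (simp add: res_module_def)
  show ?thesis
    using P lhom_compose[OF P.F_module P.aug_hom fh] ker surj
    unfolding free_resolution_def rm by simp
qed

lemma dual_simps:
  "carrier (dual R N) = lhom R N (regular R)"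
  "\<zero>\<^bsub>dual R N\<^esub> = (\<lambda>n\<in>carrier N. \<zero>\<^bsub>R\<^esub>)"
  "f \<oplus>\<^bsub>dual R N\<^esub> g = (\<lambda>n\<in>carrier N. f n \<oplus>\<^bsub>R\<^esub> g n)"
  "a \<odot>\<^bsub>dual R N\<^esub> f = (\<lambda>n\<in>carrier N. f n \<otimes>\<^bsub>R\<^esub> a)"
  by (simp_all add: dual_def)

lemma left_module_dual:
  assumes N: "left_module R N"
  shows "left_module (opp R) (dual R N)"
proof -
  interpret N: left_module R N by fact
  have reg: "left_module R (regular R)" using left_module_regular N.R.ring_axioms .
  have cl: "f n \<in> carrier R" if "f \<in> lhom R N (regular R)" "n \<in> carrier N" for f n
    using lhom_closed[OF that] by simp
  have sm: "(\<lambda>n\<in>carrier N. f n \<otimes>\<^bsub>R\<^esub> a) \<in> lhom R N (regular R)"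
    if "f \<in> lhom R N (regular R)" "a \<in> carrier R" for f a
    using that
    by (intro lhomI) (auto simp: cl lhom_add[OF that(1)] lhom_smult[OF that(1)] N.smult_closed
        N.R.l_distr N.R.m_assoc)
  have add: "(\<lambda>n\<in>carrier N. f n \<oplus>\<^bsub>R\<^esub> g n) \<in> lhom R N (regular R)"
    if "f \<in> lhom R N (regular R)" "g \<in> lhom R N (regular R)" for f g
    using lhom_fun_add[OF N reg that] by simp
  have zero: "(\<lambda>n\<in>carrier N. \<zero>\<^bsub>R\<^esub>) \<in> lhom R N (regular R)"
    using lhom_fun_zero[OF N reg] by simp
  note eqI = lhom_eqI[where R = R and M = N and N = "regular R" and N' = "regular R"]
  have "abelian_group (dual R N)"
  proof (rule abelian_groupI)
    fix f g h assume fgh: "f \<in> carrier (dual R N)" "g \<in> carrier (dual R N)" "h \<in> carrier (dual R N)"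
    then show "f \<oplus>\<^bsub>dual R N\<^esub> g \<oplus>\<^bsub>dual R N\<^esub> h = f \<oplus>\<^bsub>dual R N\<^esub> (g \<oplus>\<^bsub>dual R N\<^esub> h)"
      unfolding dual_simps by (intro eqI add) (simp_all add: cl N.R.a_assoc)
  next
    fix f g assume "f \<in> carrier (dual R N)" "g \<in> carrier (dual R N)"
    then show "f \<oplus>\<^bsub>dual R N\<^esub> g = g \<oplus>\<^bsub>dual R N\<^esub> f"
      unfolding dual_simps by (intro eqI add) (simp_all add: cl N.R.a_comm)
  next
    fix f assume f: "f \<in> carrier (dual R N)"
    then show "\<zero>\<^bsub>dual R N\<^esub> \<oplus>\<^bsub>dual R N\<^esub> f = f"
      unfolding dual_simps by (intro eqI add zero) (simp_all add: cl)
    let ?g = "\<lambda>n\<in>carrier N. f n \<otimes>\<^bsub>R\<^esub> (\<ominus>\<^bsub>R\<^esub> \<one>\<^bsub>R\<^esub>)"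
    have g: "?g \<in> lhom R N (regular R)" using f sm by (simp add: dual_simps)
    have "?g \<oplus>\<^bsub>dual R N\<^esub> f = \<zero>\<^bsub>dual R N\<^esub>"
      using f unfolding dual_simps
      by (intro eqI add[OF g] zero) (simp_all add: cl N.R.r_minus N.R.l_neg)
    with g show "\<exists>g\<in>carrier (dual R N). g \<oplus>\<^bsub>dual R N\<^esub> f = \<zero>\<^bsub>dual R N\<^esub>"
      by (metis dual_simps(1))
  qed (simp_all add: dual_simps add zero)
  then show ?thesis
  proof (rule left_moduleI[OF ring_opp[OF N.R.ring_axioms]])
    fix a b f assume "a \<in> carrier (opp R)" "b \<in> carrier (opp R)" "f \<in> carrier (dual R N)"
    then have ab: "a \<in> carrier R" "b \<in> carrier R" and f: "f \<in> lhom R N (regular R)"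
      by (simp_all add: dual_simps)
    show "(a \<oplus>\<^bsub>opp R\<^esub> b) \<odot>\<^bsub>dual R N\<^esub> f = a \<odot>\<^bsub>dual R N\<^esub> f \<oplus>\<^bsub>dual R N\<^esub> b \<odot>\<^bsub>dual R N\<^esub> f"
      unfolding dual_simps using ab f
      by (intro eqI add sm) (simp_all add: cl N.R.r_distr)
    show "(a \<otimes>\<^bsub>opp R\<^esub> b) \<odot>\<^bsub>dual R N\<^esub> f = a \<odot>\<^bsub>dual R N\<^esub> (b \<odot>\<^bsub>dual R N\<^esub> f)"
      unfolding dual_simps using ab f
      by (intro eqI sm) (simp_all add: cl N.R.m_assoc)
  next
    fix a f g assume "a \<in> carrier (opp R)" "f \<in> carrier (dual R N)" "g \<in> carrier (dual R N)"
    then show "a \<odot>\<^bsub>dual R N\<^esub> (f \<oplus>\<^bsub>dual R N\<^esub> g) = a \<odot>\<^bsub>dual R N\<^esub> f \<oplus>\<^bsub>dual R N\<^esub> a \<odot>\<^bsub>dual R N\<^esub> g"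
      unfolding dual_simps
      by (intro eqI add sm) (simp_all add: cl N.R.l_distr)
  next
    fix f assume "f \<in> carrier (dual R N)"
    then show "\<one>\<^bsub>opp R\<^esub> \<odot>\<^bsub>dual R N\<^esub> f = f"
      unfolding dual_simps by (intro eqI sm) (simp_all add: cl)
  qed (simp add: dual_simps sm)
qed

lemma left_module_bidual:
  assumes "left_module R N" shows "left_module R (bidual R N)"
  using left_module_dual[OF left_module_dual[OF assms]] by (simp add: bidual_def)

lemma canonical_map_closed:
  assumes N: "left_module R N" and n: "n \<in> carrier N"
  shows "canonical_map R N n \<in> carrier (bidual R N)"
proof -
  interpret D: left_module "opp R" "dual R N" using left_module_dual[OF N] .
  have "(\<lambda>f\<in>carrier (dual R N). f n) \<in> lhom (opp R) (dual R N) (regular (opp R))"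
  proof (rule lhomI)
    show "(\<lambda>f\<in>carrier (dual R N). f n) \<in> carrier (dual R N) \<rightarrow>\<^sub>E carrier (regular (opp R))"
      using n by (auto simp: dual_simps dest: lhom_closed)
    show "(\<lambda>f\<in>carrier (dual R N). f n) (f \<oplus>\<^bsub>dual R N\<^esub> g) =
        (\<lambda>f\<in>carrier (dual R N). f n) f \<oplus>\<^bsub>regular (opp R)\<^esub> (\<lambda>f\<in>carrier (dual R N). f n) g"
      if "f \<in> carrier (dual R N)" "g \<in> carrier (dual R N)" for f g
      using D.M.a_closed[OF that] that n by (simp add: dual_simps(3))
    show "(\<lambda>f\<in>carrier (dual R N). f n) (a \<odot>\<^bsub>dual R N\<^esub> f) =
        a \<odot>\<^bsub>regular (opp R)\<^esub> (\<lambda>f\<in>carrier (dual R N). f n) f"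
      if "a \<in> carrier (opp R)" "f \<in> carrier (dual R N)" for a f
      using D.smult_closed[OF that] that n by (simp add: dual_simps(4))
  qed
  then show ?thesis
    using n by (simp add: canonical_map_def bidual_def dual_simps(1)[of "opp R"])
qed

text \<open>The presentation \<open>R / R d\<close> with g as the class of 1. Homomorphisms out of
  it correspond to elements killed by d, so the dual is the right annihilator of d.\<close>

locale cyclic_module = left_module R N
  for R :: "('a, 'e) ring_scheme" (structure) and N :: "('a, 'm, 'f) module_scheme" (structure) +
  fixes g :: 'm and d :: 'a
  assumes g: "g \<in> carrier N" and d: "d \<in> carrier R"
    and gen: "\<And>v. v \<in> carrier N \<Longrightarrow> \<exists>a\<in>carrier R. v = a \<odot>\<^bsub>N\<^esub> g"
    and ann_g: "\<And>a. a \<in> carrier R \<Longrightarrow>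
      a \<odot>\<^bsub>N\<^esub> g = \<zero>\<^bsub>N\<^esub> \<longleftrightarrow> (\<exists>b\<in>carrier R. a = b \<otimes> d)"
begin

lemma dual_closed: "f \<in> carrier (dual R N) \<Longrightarrow> v \<in> carrier N \<Longrightarrow> f v \<in> carrier R"
  by (auto simp: dual_simps dest: lhom_closed)

lemma dual_apply: "f \<in> carrier (dual R N) \<Longrightarrow> a \<in> carrier R \<Longrightarrow> f (a \<odot>\<^bsub>N\<^esub> g) = a \<otimes> f g"
  using lhom_smult[of f R N "regular R" a g] g by (simp add: dual_simps)

lemma dual_eqI:
  assumes "f \<in> carrier (dual R N)" "h \<in> carrier (dual R N)" "f g = h g"
  shows "f = h"
proof (rule lhom_eqI)
  show "f \<in> lhom R N (regular R)" "h \<in> lhom R N (regular R)"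
    using assms by (simp_all add: dual_simps)
  show "f v = h v" if "v \<in> carrier N" for v
    using gen[OF that] assms by (auto simp: dual_apply)
qed

lemma dual_ann: assumes "f \<in> carrier (dual R N)" shows "d \<otimes> f g = \<zero>"
proof -
  have "d \<odot>\<^bsub>N\<^esub> g = \<zero>\<^bsub>N\<^esub>"
    using ann_g[OF d] d by (auto intro: bexI[of _ "\<one>"])
  then have "d \<otimes> f g = f \<zero>\<^bsub>N\<^esub>" using dual_apply[OF assms d] by simp
  also have "\<dots> = \<zero>"
    using lhom_zero[OF left_module_axioms left_module_regular[OF R.ring_axioms], of f] assms
    by (simp add: dual_simps)
  finally show ?thesis .
qed

lemma hom_exists:
  assumes M: "left_module R M" and m: "m \<in> carrier M" and dm: "d \<odot>\<^bsub>M\<^esub> m = \<zero>\<^bsub>M\<^esub>"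
  shows "\<exists>f\<in>lhom R N M. f g = m"
proof -
  interpret L: left_module R M by fact
  define coef where "coef v = (SOME a. a \<in> carrier R \<and> v = a \<odot>\<^bsub>N\<^esub> g)" for v
  have coef: "coef v \<in> carrier R" "v = coef v \<odot>\<^bsub>N\<^esub> g" if "v \<in> carrier N" for v
    using someI_ex[of "\<lambda>a. a \<in> carrier R \<and> v = a \<odot>\<^bsub>N\<^esub> g"] gen[OF that]
    unfolding coef_def by blast+
  \<comment> \<open>Coefficients with respect to g are determined only up to \<open>R d\<close>,
    which acts as zero on m because \<open>d m = 0\<close>.\<close>
  have wd: "a \<odot>\<^bsub>M\<^esub> m = b \<odot>\<^bsub>M\<^esub> m"
    if ab: "a \<in> carrier R" "b \<in> carrier R" "a \<odot>\<^bsub>N\<^esub> g = b \<odot>\<^bsub>N\<^esub> g" for a b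
  proof -
    have "(a \<ominus> b) \<odot>\<^bsub>N\<^esub> g = \<zero>\<^bsub>N\<^esub>"
      using that g by (simp add: a_minus_def smult_l_distr smult_l_minus M.r_neg smult_closed)
    then obtain e where "e \<in> carrier R" "a \<ominus> b = e \<otimes> d"
      using ann_g[of "a \<ominus> b"] R.minus_closed[OF ab(1,2)] by blast
    then have "(a \<ominus> b) \<odot>\<^bsub>M\<^esub> m = \<zero>\<^bsub>M\<^esub>"
      using m d by (simp add: L.smult_assoc dm L.smult_r_null)
    then have "a \<odot>\<^bsub>M\<^esub> m \<ominus>\<^bsub>M\<^esub> b \<odot>\<^bsub>M\<^esub> m = \<zero>\<^bsub>M\<^esub>"
      using that m by (simp add: a_minus_def L.smult_l_distr L.smult_l_minus)
    then show ?thesis using ab m L.M.minus_equality[of "a \<odot>\<^bsub>M\<^esub> m" "\<ominus>\<^bsub>M\<^esub> (b \<odot>\<^bsub>M\<^esub> m)"]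
      by (simp add: L.smult_closed a_minus_def)
  qed
  let ?f = "\<lambda>v\<in>carrier N. coef v \<odot>\<^bsub>M\<^esub> m"
  have f: "?f (a \<odot>\<^bsub>N\<^esub> g) = a \<odot>\<^bsub>M\<^esub> m" if "a \<in> carrier R" for a
    using wd[OF coef(1) that coef(2)[symmetric]] that g by (simp add: smult_closed)
  have "?f \<in> lhom R N M"
  proof (rule lhomI)
    show "?f \<in> carrier N \<rightarrow>\<^sub>E carrier M" using coef m by (auto intro: L.smult_closed)
    fix u v assume uv: "u \<in> carrier N" "v \<in> carrier N"
    have "u \<oplus>\<^bsub>N\<^esub> v = (coef u \<oplus> coef v) \<odot>\<^bsub>N\<^esub> g"
      using coef[OF uv(1)] coef[OF uv(2)] g by (simp add: smult_l_distr)
    then show "?f (u \<oplus>\<^bsub>N\<^esub> v) = ?f u \<oplus>\<^bsub>M\<^esub> ?f v"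
      using f[of "coef u \<oplus> coef v"] coef uv m by (simp add: L.smult_l_distr)
  next
    fix a u assume au: "a \<in> carrier R" "u \<in> carrier N"
    have "a \<odot>\<^bsub>N\<^esub> u = (a \<otimes> coef u) \<odot>\<^bsub>N\<^esub> g"
      using coef[OF au(2)] au g by (simp add: smult_assoc)
    then show "?f (a \<odot>\<^bsub>N\<^esub> u) = a \<odot>\<^bsub>M\<^esub> ?f u"
      using f[of "a \<otimes> coef u"] coef au m by (simp add: L.smult_assoc)
  qed
  moreover have "?f g = m" using f[of "\<one>"] g m by (simp add: smult_one L.smult_one)
  ultimately show ?thesis by blast
qed

lemma dual_exists:
  assumes "l \<in> carrier R" "d \<otimes> l = \<zero>"
  shows "\<exists>f\<in>carrier (dual R N). f g = l"
  using hom_exists[OF left_module_regular[OF R.ring_axioms], of l] assms by (simp add: dual_simps)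

text \<open>Evaluation at g identifies the dual with the right annihilator of d. By
  \<open>ann_d\<close> this is generated by \<open>xi g\<close>, and by \<open>ann_e\<close> its
  relations are \<open>e' R\<close>. Over the opposite ring the dual is thus again cyclic with one
  relation, and the same locale then describes the bidual.\<close>

lemma cyclic_dual:
  assumes xi: "xi \<in> carrier (dual R N)" and e': "e' \<in> carrier R"
    and ann_d: "\<And>a. a \<in> carrier R \<Longrightarrow> d \<otimes> a = \<zero> \<Longrightarrow> \<exists>b\<in>carrier R. a = xi g \<otimes> b"
    and ann_e: "\<And>a. a \<in> carrier R \<Longrightarrow>
      xi g \<otimes> a = \<zero> \<longleftrightarrow> (\<exists>b\<in>carrier R. a = e' \<otimes> b)"
  shows "cyclic_module (opp R) (dual R N) xi e'"
proof -
  interpret D: left_module "opp R" "dual R N" using left_module_dual[OF left_module_axioms] .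
  have sm: "(a \<odot>\<^bsub>dual R N\<^esub> f) g = f g \<otimes> a" if "f \<in> carrier (dual R N)" for a f
    using that g by (simp add: dual_simps)
  show ?thesis
  proof unfold_locales
    fix f assume f: "f \<in> carrier (dual R N)"
    then obtain b where b: "b \<in> carrier R" "f g = xi g \<otimes> b"
      using ann_d dual_ann dual_closed g by blast
    have "f = b \<odot>\<^bsub>dual R N\<^esub> xi"
      using b f xi by (intro dual_eqI D.smult_closed) (simp_all add: sm)
    then show "\<exists>a\<in>carrier (opp R). f = a \<odot>\<^bsub>dual R N\<^esub> xi" using b by auto
  next
    fix a assume "a \<in> carrier (opp R)"
    then have a: "a \<in> carrier R" by simp
    have "a \<odot>\<^bsub>dual R N\<^esub> xi = \<zero>\<^bsub>dual R N\<^esub> \<longleftrightarrow> xi g \<otimes> a = \<zero>"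
      using dual_eqI[of "a \<odot>\<^bsub>dual R N\<^esub> xi" "\<zero>\<^bsub>dual R N\<^esub>"] D.smult_closed[of a xi] D.M.zero_closed
        sm[OF xi, of a] a xi g by (auto simp: dual_simps(2))
    then show "a \<odot>\<^bsub>dual R N\<^esub> xi = \<zero>\<^bsub>dual R N\<^esub> \<longleftrightarrow> (\<exists>b\<in>carrier (opp R). a = b \<otimes>\<^bsub>opp R\<^esub> e')"
      using ann_e[OF a] by simp
  qed (simp_all add: xi e')
qed

end

section \<open>Triangular matrix rings and their modules\<close>

lemma T2_simps:
  "carrier (T2 R) = carrier R \<times> carrier R \<times> carrier R"
  "(a1, a2, a3) \<otimes>\<^bsub>T2 R\<^esub> (b1, b2, b3) =
    (a1 \<otimes>\<^bsub>R\<^esub> b1, a1 \<otimes>\<^bsub>R\<^esub> b2 \<oplus>\<^bsub>R\<^esub> a2 \<otimes>\<^bsub>R\<^esub> b3, a3 \<otimes>\<^bsub>R\<^esub> b3)"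
  "(a1, a2, a3) \<oplus>\<^bsub>T2 R\<^esub> (b1, b2, b3) = (a1 \<oplus>\<^bsub>R\<^esub> b1, a2 \<oplus>\<^bsub>R\<^esub> b2, a3 \<oplus>\<^bsub>R\<^esub> b3)"
  "\<one>\<^bsub>T2 R\<^esub> = (\<one>\<^bsub>R\<^esub>, \<zero>\<^bsub>R\<^esub>, \<one>\<^bsub>R\<^esub>)"
  "\<zero>\<^bsub>T2 R\<^esub> = (\<zero>\<^bsub>R\<^esub>, \<zero>\<^bsub>R\<^esub>, \<zero>\<^bsub>R\<^esub>)"
  by (simp_all add: T2_def)

lemma ring_T2: assumes "ring R" shows "ring (T2 R)"
proof -
  interpret ring R by fact
  have "abelian_group (T2 R)"
  proof (rule abelian_groupI)
    fix p assume "p \<in> carrier (T2 R)"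
    then show "\<exists>p'\<in>carrier (T2 R). p' \<oplus>\<^bsub>T2 R\<^esub> p = \<zero>\<^bsub>T2 R\<^esub>"
      by (cases p) (auto simp: T2_simps l_neg
          intro!: bexI[of _ "(\<ominus>\<^bsub>R\<^esub> fst p, \<ominus>\<^bsub>R\<^esub> fst (snd p), \<ominus>\<^bsub>R\<^esub> snd (snd p))"])
  qed (auto simp: T2_simps a_ac)
  moreover have "Group.monoid (T2 R)"
    by (rule monoidI) (auto simp: T2_simps l_distr r_distr m_assoc a_ac)
  ultimately show ?thesis
    by (rule ringI) (auto simp: T2_simps l_distr r_distr a_ac)
qed

lemma T2_left_simps:
  "carrier (T2_left U V f) = carrier U \<times> carrier V"
  "\<zero>\<^bsub>T2_left U V f\<^esub> = (\<zero>\<^bsub>U\<^esub>, \<zero>\<^bsub>V\<^esub>)"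
  "(u, v) \<oplus>\<^bsub>T2_left U V f\<^esub> (u', v') = (u \<oplus>\<^bsub>U\<^esub> u', v \<oplus>\<^bsub>V\<^esub> v')"
  "(a1, a2, a3) \<odot>\<^bsub>T2_left U V f\<^esub> (u, v) = (a1 \<odot>\<^bsub>U\<^esub> u \<oplus>\<^bsub>U\<^esub> a2 \<odot>\<^bsub>U\<^esub> f v, a3 \<odot>\<^bsub>V\<^esub> v)"
  by (simp_all add: T2_left_def)

lemma T2_right_simps:
  "carrier (T2_right U V f) = carrier U \<times> carrier V"
  "(u, v) \<oplus>\<^bsub>T2_right U V f\<^esub> (u', v') = (u \<oplus>\<^bsub>U\<^esub> u', v \<oplus>\<^bsub>V\<^esub> v')"
  "(a1, a2, a3) \<odot>\<^bsub>T2_right U V f\<^esub> (u, v) = (a1 \<odot>\<^bsub>U\<^esub> u, a2 \<odot>\<^bsub>V\<^esub> f u \<oplus>\<^bsub>V\<^esub> a3 \<odot>\<^bsub>V\<^esub> v)"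
  by (simp_all add: T2_right_def)

lemma left_module_T2_left:
  assumes U: "left_module R U" and V: "left_module R V"
    and closed: "\<And>v. v \<in> carrier V \<Longrightarrow> f v \<in> carrier U"
    and add: "\<And>v w. v \<in> carrier V \<Longrightarrow> w \<in> carrier V \<Longrightarrow> f (v \<oplus>\<^bsub>V\<^esub> w) = f v \<oplus>\<^bsub>U\<^esub> f w"
    and smult: "\<And>a v. a \<in> carrier R \<Longrightarrow> v \<in> carrier V \<Longrightarrow> f (a \<odot>\<^bsub>V\<^esub> v) = a \<odot>\<^bsub>U\<^esub> f v"
  shows "left_module (T2 R) (T2_left U V f)"
proof -
  interpret U: left_module R U by fact
  interpret V: left_module R V by fact
  have "abelian_group (T2_left U V f)"
  proof (rule abelian_groupI)
    fix p assume "p \<in> carrier (T2_left U V f)"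
    then show "\<exists>p'\<in>carrier (T2_left U V f). p' \<oplus>\<^bsub>T2_left U V f\<^esub> p = \<zero>\<^bsub>T2_left U V f\<^esub>"
      by (cases p) (auto simp: T2_left_simps U.M.l_neg V.M.l_neg
          intro!: bexI[of _ "(\<ominus>\<^bsub>U\<^esub> fst p, \<ominus>\<^bsub>V\<^esub> snd p)"])
  qed (auto simp: T2_left_simps U.M.a_ac V.M.a_ac)
  then show ?thesis
    by (intro left_moduleI ring_T2 U.R.ring_axioms)
      (auto simp: T2_simps T2_left_simps closed add smult U.smult_closed V.smult_closed
        U.smult_l_distr U.smult_r_distr V.smult_l_distr V.smult_r_distr U.smult_assoc V.smult_assoc
        U.smult_one V.smult_one U.smult_l_null U.M.a_ac)
qed

section \<open>Finite generation and existence of resolutions\<close>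

locale quotient_module = left_module R M
  for R :: "('a, 'e) ring_scheme" (structure) and M :: "('a, 'm, 'f) module_scheme" (structure) +
  fixes K :: "'m set"
  assumes K: "submodule K R M"
begin

sublocale K: abelian_subgroup K M
  using K M.abelian_group_axioms
  by (intro abelian_subgroupI3) (auto simp: submodule_def intro: additive_subgroup.intro)

lemma coset_eq_iff:
  assumes "u \<in> carrier M" "v \<in> carrier M"
  shows "K +>\<^bsub>M\<^esub> u = K +>\<^bsub>M\<^esub> v \<longleftrightarrow> u \<ominus>\<^bsub>M\<^esub> v \<in> K"
proof -
  have "K +>\<^bsub>M\<^esub> u = K +>\<^bsub>M\<^esub> v \<longleftrightarrow> u \<in> K +>\<^bsub>M\<^esub> v"
    using K.a_rcos_self[OF assms(1)] K.a_repr_independence'[OF _ assms(2)] by auto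
  then show ?thesis
    using K.a_rcos_module[OF assms(2,1)] by (simp add: a_minus_def)
qed

lemma carrier_quot: "carrier (quot_module M K) = (\<lambda>u. K +>\<^bsub>M\<^esub> u) ` carrier M"
  by (auto simp: quot_module_def A_RCOSETS_def RCOSETS_def a_r_coset_def)

lemma zero_quot: "\<zero>\<^bsub>quot_module M K\<^esub> = K +>\<^bsub>M\<^esub> \<zero>\<^bsub>M\<^esub>"
  using M.a_coset_add_zero[of K] K.a_subset by (simp add: quot_module_def)

lemma add_quot:
  "u \<in> carrier M \<Longrightarrow> v \<in> carrier M \<Longrightarrow>
    (K +>\<^bsub>M\<^esub> u) \<oplus>\<^bsub>quot_module M K\<^esub> (K +>\<^bsub>M\<^esub> v) = K +>\<^bsub>M\<^esub> (u \<oplus>\<^bsub>M\<^esub> v)"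
  by (simp add: quot_module_def K.a_rcos_sum)

text \<open>Two representatives differ by some w in K, and \<open>a w\<close> stays in K; hence the
  union in the definition runs over one and the same coset.\<close>

lemma smult_quot:
  assumes "a \<in> carrier R" "u \<in> carrier M"
  shows "a \<odot>\<^bsub>quot_module M K\<^esub> (K +>\<^bsub>M\<^esub> u) = K +>\<^bsub>M\<^esub> (a \<odot>\<^bsub>M\<^esub> u)"
proof -
  have "K +>\<^bsub>M\<^esub> (a \<odot>\<^bsub>M\<^esub> v) = K +>\<^bsub>M\<^esub> (a \<odot>\<^bsub>M\<^esub> u)" if v: "v \<in> K +>\<^bsub>M\<^esub> u" for v
  proof -
    obtain w where w: "w \<in> K" "v = w \<oplus>\<^bsub>M\<^esub> u" using v by (auto simp: a_r_coset_def')
    then have w': "w \<in> carrier M" using K.a_subset by blast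
    have "a \<odot>\<^bsub>M\<^esub> v \<ominus>\<^bsub>M\<^esub> a \<odot>\<^bsub>M\<^esub> u = a \<odot>\<^bsub>M\<^esub> w"
      using assms w w' by (simp add: smult_r_distr smult_closed a_minus_def M.a_assoc M.r_neg)
    then show ?thesis
      using assms w w' submoduleD(4)[OF K assms(1) w(1)]
      by (subst coset_eq_iff) (simp_all add: smult_closed)
  qed
  then have "(\<Union>v\<in>K +>\<^bsub>M\<^esub> u. K +>\<^bsub>M\<^esub> (a \<odot>\<^bsub>M\<^esub> v)) = (\<Union>v\<in>K +>\<^bsub>M\<^esub> u. K +>\<^bsub>M\<^esub> (a \<odot>\<^bsub>M\<^esub> u))"
    by (rule SUP_cong[OF refl])
  also have "\<dots> = K +>\<^bsub>M\<^esub> (a \<odot>\<^bsub>M\<^esub> u)" using K.a_rcos_self[OF assms(2)] by blast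
  finally show ?thesis by (simp add: quot_module_def)
qed

lemma left_module_quot: "left_module R (quot_module M K)"
proof -
  have "abelian_group (quot_module M K)"
  proof (rule abelian_groupI)
    fix p assume "p \<in> carrier (quot_module M K)"
    then obtain u where u: "u \<in> carrier M" "p = K +>\<^bsub>M\<^esub> u" by (auto simp: carrier_quot)
    show "\<exists>p'\<in>carrier (quot_module M K). p' \<oplus>\<^bsub>quot_module M K\<^esub> p = \<zero>\<^bsub>quot_module M K\<^esub>"
      using u by (intro bexI[of _ "K +>\<^bsub>M\<^esub> (\<ominus>\<^bsub>M\<^esub> u)"])
        (simp_all add: carrier_quot add_quot zero_quot M.l_neg)
  qed (auto simp: carrier_quot add_quot zero_quot M.a_ac)
  then show ?thesis
    by (intro left_moduleI R.ring_axioms)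
      (auto simp: carrier_quot add_quot smult_quot smult_closed smult_l_distr smult_r_distr
        smult_assoc smult_one)
qed

end

text \<open>The noetherian property in the form used to continue a resolution: the kernel of a map
  between free modules of finite rank is again covered by such a module.\<close>

definition noetherian_free :: "('a, 'e) ring_scheme \<Rightarrow> bool"
  where "noetherian_free R \<longleftrightarrow> (\<forall>n K. submodule K R (free_module R n) \<longrightarrow>
    (\<exists>m. \<exists>h\<in>lhom R (free_module R m) (free_module R n). h ` carrier (free_module R m) = K))"

lemma free_resolution_exists:
  assumes R: "ring R" and noeth: "noetherian_free R" and N: "left_module R N"
    and aug: "aug \<in> lhom R (free_module R n) N" "aug ` carrier (free_module R n) = carrier N"
  shows "\<exists>P. free_resolution R N P"
proof -
  let ?F = "free_module R"
  note F = left_module_free[OF R]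
  have cover: "\<exists>m. \<exists>h\<in>lhom R (?F m) (?F k). h ` carrier (?F m) = K" if "submodule K R (?F k)" for k K
    using noeth that unfolding noetherian_free_def by blast
  \<comment> \<open>A state is a differential d together with the ranks a and b of its source and
    target; \<open>?T\<close> makes the source of one differential the target of the next. At i = 0
    the target is the given cover of N.\<close>
  let ?S = "\<lambda>i::nat. \<lambda>(a, b, d). d \<in> lhom R (?F a) (?F b) \<and>
    (i = 0 \<longrightarrow> b = n \<and> d ` carrier (?F a) = {u \<in> carrier (?F n). aug u = \<zero>\<^bsub>N\<^esub>})"
  let ?T = "\<lambda>i::nat. \<lambda>(a, b, d) (a', b', d').
    b' = a \<and> d' ` carrier (?F a') = {u \<in> carrier (?F a). d u = \<zero>\<^bsub>?F b\<^esub>}"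
  have "\<exists>s. \<forall>i. ?S i (s i) \<and> ?T i (s i) (s (Suc i))"
  proof (rule dependent_nat_choice[where P = ?S and Q = ?T])
    obtain m h where "h \<in> lhom R (?F m) (?F n)"
      "h ` carrier (?F m) = {u \<in> carrier (?F n). aug u = \<zero>\<^bsub>N\<^esub>}"
      using cover[OF lhom_kernel_submodule[OF F N aug(1)]] by blast
    then show "\<exists>x. ?S 0 x" by (intro exI[of _ "(m, n, h)"]) simp
  next
    fix x i assume x: "?S i x"
    obtain a b d where abd: "x = (a, b, d)" by (cases x)
    then have "d \<in> lhom R (?F a) (?F b)" using x by simp
    then obtain m h where "h \<in> lhom R (?F m) (?F a)"
      "h ` carrier (?F m) = {u \<in> carrier (?F a). d u = \<zero>\<^bsub>?F b\<^esub>}"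
      using cover[OF lhom_kernel_submodule[OF F F]] by blast
    then show "\<exists>y. ?S (Suc i) y \<and> ?T i x y"
      unfolding abd by (intro exI[of _ "(m, a, h)"]) simp
  qed
  then obtain s where s: "\<forall>i. ?S i (s i) \<and> ?T i (s i) (s (Suc i))" ..
  define r where "r i = fst (snd (s i))" for i
  define D where "D i = snd (snd (s i))" for i
  have r_Suc: "fst (s i) = r (Suc i)" for i
    using s by (auto simp: r_def split_beta)
  have D: "D i \<in> lhom R (?F (r (Suc i))) (?F (r i))" for i
    using s by (auto simp: D_def r_def split_beta simp flip: r_Suc)
  have r0: "r 0 = n" "D 0 ` carrier (?F (r 1)) = {u \<in> carrier (?F n). aug u = \<zero>\<^bsub>N\<^esub>}"
    using s[rule_format, of 0] r_Suc[of 0] by (auto simp: r_def D_def split_beta)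
  have exact: "D (Suc i) ` carrier (?F (r (Suc (Suc i)))) =
      {u \<in> carrier (?F (r (Suc i))). D i u = \<zero>\<^bsub>?F (r i)\<^esub>}" for i
    using s[rule_format, of i] r_Suc[of i] r_Suc[of "Suc i"] by (auto simp: r_def D_def split_beta)
  have "free_resolution R N \<lparr>res_rank = r, res_diff = D, res_aug = aug\<rparr>"
    unfolding free_resolution_def res_module_def
    using D aug r0 exact by simp
  then show ?thesis ..
qed

text \<open>
  \<open>\<kappa>\<close> plays the role of the field of scalars. The induction is on the number of coordinate
  functionals: one vector with a nonzero value splits off the kernel of a functional.
\<close>
lemma finitely_spanned:
  fixes \<kappa> :: "'k::field \<Rightarrow> 'a" and \<Phi> :: "('m \<Rightarrow> 'k) set"
  assumes M: "left_module R M" and \<kappa>: "\<And>c. \<kappa> c \<in> carrier R"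
    and "finite \<Phi>"
    and add: "\<And>\<phi> u v. \<phi> \<in> \<Phi> \<Longrightarrow> u \<in> carrier M \<Longrightarrow> v \<in> carrier M \<Longrightarrow> \<phi> (u \<oplus>\<^bsub>M\<^esub> v) = \<phi> u + \<phi> v"
    and smult: "\<And>\<phi> c u. \<phi> \<in> \<Phi> \<Longrightarrow> u \<in> carrier M \<Longrightarrow> \<phi> (\<kappa> c \<odot>\<^bsub>M\<^esub> u) = c * \<phi> u"
    and V: "V \<subseteq> carrier M"
    and V_add: "\<And>u v. u \<in> V \<Longrightarrow> v \<in> V \<Longrightarrow> u \<oplus>\<^bsub>M\<^esub> v \<in> V"
    and V_smult: "\<And>c u. u \<in> V \<Longrightarrow> \<kappa> c \<odot>\<^bsub>M\<^esub> u \<in> V"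
    and sep: "\<And>u. u \<in> V \<Longrightarrow> (\<And>\<phi>. \<phi> \<in> \<Phi> \<Longrightarrow> \<phi> u = 0) \<Longrightarrow> u = \<zero>\<^bsub>M\<^esub>"
  shows "\<exists>G. finite G \<and> G \<subseteq> V \<and> (\<forall>H. submodule H R M \<and> G \<subseteq> H \<longrightarrow> V \<subseteq> H)"
  using assms(3-)
proof (induction \<Phi> arbitrary: V rule: finite_induct)
  case empty
  interpret left_module R M by fact
  have "V \<subseteq> {\<zero>\<^bsub>M\<^esub>}" using empty.prems(6) by auto
  then show ?case using submoduleD(2) by (intro exI[of _ "{}"]) auto
next
  case (insert \<phi> \<Phi>)
  interpret left_module R M by fact
  note V = insert.prems(3-5)
  show ?case
  proof (cases "\<forall>v\<in>V. \<phi> v = 0")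
    case True
    show ?thesis
    proof (rule insert.IH)
      show "u = \<zero>\<^bsub>M\<^esub>" if "u \<in> V" "\<And>\<psi>. \<psi> \<in> \<Phi> \<Longrightarrow> \<psi> u = 0" for u
        using that True insert.prems(6)[of u] by blast
    qed (use V insert.prems(1,2) in simp_all)
  next
    case False
    then obtain w where w: "w \<in> V" "\<phi> w \<noteq> 0" by blast
    have wM: "w \<in> carrier M" using w V(1) by blast
    let ?V = "{v \<in> V. \<phi> v = 0}"
    have "\<exists>G. finite G \<and> G \<subseteq> ?V \<and> (\<forall>H. submodule H R M \<and> G \<subseteq> H \<longrightarrow> ?V \<subseteq> H)"
    proof (rule insert.IH)
      show "u \<oplus>\<^bsub>M\<^esub> v \<in> ?V" if "u \<in> ?V" "v \<in> ?V" for u v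
        using that V insert.prems(1)[of \<phi> u v] by auto
      show "\<kappa> c \<odot>\<^bsub>M\<^esub> u \<in> ?V" if "u \<in> ?V" for c u
        using that V insert.prems(2)[of \<phi> u c] by auto
      show "u = \<zero>\<^bsub>M\<^esub>" if "u \<in> ?V" "\<And>\<psi>. \<psi> \<in> \<Phi> \<Longrightarrow> \<psi> u = 0" for u
        using that insert.prems(6)[of u] by auto
    qed (use V(1) insert.prems(1,2) in auto)
    then obtain G where G: "finite G \<and> G \<subseteq> ?V \<and> (\<forall>H. submodule H R M \<and> G \<subseteq> H \<longrightarrow> ?V \<subseteq> H)" ..
    have "V \<subseteq> H" if H: "submodule H R M" "insert w G \<subseteq> H" for H
    proof
      fix v assume v: "v \<in> V"
      then have vM: "v \<in> carrier M" using V(1) by blast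
      \<comment> \<open>The coefficient is chosen so that \<phi> vanishes on the sum of v and
        \<open>?r\<close>.\<close>
      let ?r = "\<kappa> (- \<phi> v / \<phi> w) \<odot>\<^bsub>M\<^esub> w"
      have rM: "?r \<in> carrier M" using \<kappa> wM by (rule smult_closed)
      have "v \<oplus>\<^bsub>M\<^esub> ?r \<in> ?V"
        using v w V insert.prems(1)[of \<phi> v ?r] insert.prems(2)[of \<phi> w] vM rM wM by simp
      moreover have "?V \<subseteq> H" using G H by simp
      ultimately have "v \<oplus>\<^bsub>M\<^esub> ?r \<in> H" by (rule rev_subsetD)
      moreover have "\<ominus>\<^bsub>M\<^esub> ?r \<in> H"
        using H \<kappa> by (intro submoduleD(5)[OF H(1)] submoduleD(4)[OF H(1)]) auto
      ultimately have "(v \<oplus>\<^bsub>M\<^esub> ?r) \<oplus>\<^bsub>M\<^esub> (\<ominus>\<^bsub>M\<^esub> ?r) \<in> H" using submoduleD(3)[OF H(1)] by blast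
      then show "v \<in> H" using vM rM by (simp add: M.a_assoc M.r_neg)
    qed
    then show ?thesis using G w(1) by (intro exI[of _ "insert w G"]) blast
  qed
qed

text \<open>\<open>finitely_spanned\<close> supplies a finite generating set G of K, and unit
  vectors are sent to its entries. The map is first built with K as codomain, which bounds its image
  from above; G bounds it from below.\<close>

lemma submodule_image_of_free:
  fixes \<kappa> :: "'k::field \<Rightarrow> 'a" and \<Phi> :: "('m \<Rightarrow> 'k) set"
  assumes M: "left_module R M" and \<kappa>: "\<And>c. \<kappa> c \<in> carrier R"
    and "finite \<Phi>"
    and add: "\<And>\<phi> u v. \<phi> \<in> \<Phi> \<Longrightarrow> u \<in> carrier M \<Longrightarrow> v \<in> carrier M \<Longrightarrow> \<phi> (u \<oplus>\<^bsub>M\<^esub> v) = \<phi> u + \<phi> v"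
    and smult: "\<And>\<phi> c u. \<phi> \<in> \<Phi> \<Longrightarrow> u \<in> carrier M \<Longrightarrow> \<phi> (\<kappa> c \<odot>\<^bsub>M\<^esub> u) = c * \<phi> u"
    and K: "submodule K R M"
    and sep: "\<And>u. u \<in> K \<Longrightarrow> (\<And>\<phi>. \<phi> \<in> \<Phi> \<Longrightarrow> \<phi> u = 0) \<Longrightarrow> u = \<zero>\<^bsub>M\<^esub>"
  shows "\<exists>n. \<exists>h\<in>lhom R (free_module R n) M. h ` carrier (free_module R n) = K"
proof -
  interpret left_module R M by fact
  note K' = submoduleD[OF K]
  have "\<exists>G. finite G \<and> G \<subseteq> K \<and> (\<forall>H. submodule H R M \<and> G \<subseteq> H \<longrightarrow> K \<subseteq> H)"
    by (rule finitely_spanned[OF M \<kappa> \<open>finite \<Phi>\<close> add smult]) (auto simp: K' \<kappa> sep)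
  then obtain G where G: "finite G \<and> G \<subseteq> K \<and> (\<forall>H. submodule H R M \<and> G \<subseteq> H \<longrightarrow> K \<subseteq> H)" ..
  obtain xs where xs: "set xs = G" using finite_list[OF conjunct1[OF G]] by blast
  let ?F = "free_module R (length xs)"
  let ?K = "M\<lparr>carrier := K\<rparr>"
  have KM: "left_module R ?K" using left_module_submodule[OF M K] .
  have xsK: "xs ! j \<in> carrier ?K" if "j < length xs" for j
    using nth_mem[OF that] xs conjunct1[OF conjunct2[OF G]] by auto
  obtain h where h: "h \<in> lhom R (?F) ?K"
    "\<And>j. j < length xs \<Longrightarrow> h (unit_vec R (length xs) j) = xs ! j"
    using free_module_hom_exists[OF R.ring_axioms KM, of "length xs" "\<lambda>j. xs ! j"] xsK by blast
  have hM: "h \<in> lhom R (?F) M"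
    using lhom_submodule_codomain[OF h(1) K'(1)] .
  have "x \<in> h ` carrier (?F)" if x: "x \<in> set xs" for x
  proof -
    obtain j where "j < length xs" "x = xs ! j" using x by (auto simp: in_set_conv_nth)
    then show ?thesis
      using unit_vec_closed[OF R.ring_axioms]
      by (intro image_eqI[of _ _ "unit_vec R (length xs) j"]) (simp_all add: h(2))
  qed
  then have "G \<subseteq> h ` carrier (?F)" unfolding xs by (rule subsetI)
  with lhom_image_submodule[OF left_module_free[OF R.ring_axioms] M hM]
  have "K \<subseteq> h ` carrier (?F)"
    by (intro conjunct2[OF conjunct2[OF G], rule_format] conjI)
  moreover have "h ` carrier (?F) \<subseteq> K"
    using lhom_closed[OF h(1)] by auto
  ultimately show ?thesis using hM by blast
qed

text \<open>The functionals of R, applied to each coordinate of a vector, form a finite separating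
  family on the free module, hence on all of its submodules.\<close>

lemma noetherian_free_of_coordinates:
  fixes \<kappa> :: "'k::field \<Rightarrow> 'a" and \<Psi> :: "('a \<Rightarrow> 'k) set"
  assumes R: "ring R" and \<kappa>: "\<And>c. \<kappa> c \<in> carrier R"
    and "finite \<Psi>"
    and add: "\<And>\<psi> a b. \<psi> \<in> \<Psi> \<Longrightarrow> a \<in> carrier R \<Longrightarrow> b \<in> carrier R \<Longrightarrow> \<psi> (a \<oplus>\<^bsub>R\<^esub> b) = \<psi> a + \<psi> b"
    and smult: "\<And>\<psi> c a. \<psi> \<in> \<Psi> \<Longrightarrow> a \<in> carrier R \<Longrightarrow> \<psi> (\<kappa> c \<otimes>\<^bsub>R\<^esub> a) = c * \<psi> a"
    and sep: "\<And>a. a \<in> carrier R \<Longrightarrow> (\<And>\<psi>. \<psi> \<in> \<Psi> \<Longrightarrow> \<psi> a = 0) \<Longrightarrow> a = \<zero>\<^bsub>R\<^esub>"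
  shows "noetherian_free R"
  unfolding noetherian_free_def
proof (intro allI impI)
  fix n K assume K: "submodule K R (free_module R n)"
  let ?F = "free_module R n"
  interpret F: left_module R ?F using left_module_free[OF R] .
  let ?\<Phi> = "(\<lambda>(i, \<psi>) u. \<psi> (u i)) ` ({..<n} \<times> \<Psi>)"
  have c: "u i \<in> carrier R" if "u \<in> carrier (?F)" "i < n" for u i
    using that by (auto simp: carrier_free_module)
  show "\<exists>m. \<exists>h\<in>lhom R (free_module R m) (?F). h ` carrier (free_module R m) = K"
  proof (rule submodule_image_of_free[OF F.left_module_axioms \<kappa>, where \<Phi> = ?\<Phi>])
    show "finite ?\<Phi>" using \<open>finite \<Psi>\<close> by simp
    show "\<phi> (u \<oplus>\<^bsub>?F\<^esub> v) = \<phi> u + \<phi> v"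
      if "\<phi> \<in> ?\<Phi>" "u \<in> carrier (?F)" "v \<in> carrier (?F)" for \<phi> u v
      using that by (auto simp: add_free_module add c)
    show "\<phi> (\<kappa> a \<odot>\<^bsub>?F\<^esub> u) = a * \<phi> u"
      if "\<phi> \<in> ?\<Phi>" "u \<in> carrier (?F)" for \<phi> a u
      using that by (auto simp: smult_free_module smult c)
    show "u = \<zero>\<^bsub>?F\<^esub>" if u: "u \<in> K" "\<And>\<phi>. \<phi> \<in> ?\<Phi> \<Longrightarrow> \<phi> u = 0" for u
    proof -
      have uF: "u \<in> carrier (?F)" using u(1) F.submoduleD(1)[OF K] by blast
      have "u i = \<zero>\<^bsub>R\<^esub>" if i: "i < n" for i
      proof (rule sep[OF c[OF uF i]])
        fix \<psi> assume "\<psi> \<in> \<Psi>"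
        then have "(\<lambda>u. \<psi> (u i)) \<in> ?\<Phi>" using i by (intro image_eqI[of _ _ "(i, \<psi>)"]) auto
        from u(2)[OF this] show "\<psi> (u i) = 0" .
      qed
      then show ?thesis
        using uF by (auto simp: free_module_simps PiE_def extensional_def fun_eq_iff)
    qed
  qed fact
qed

section \<open>A nonvanishing Ext group over a triangular matrix ring\<close>

text \<open>
  The pushout of \<open>J \<rightarrow> R\<close> along \<open>f\<close> gives an extension of \<open>(R, J)\<close> by \<open>(R, 0)\<close> that splits only if
  \<open>f\<close> is a right multiplication; the cocycle \<open>h\<close> below is its class in an arbitrary resolution.
\<close>
lemma ext_T2_left_ideal_nonzero:
  fixes R :: "('a, 'e) ring_scheme" (structure)
  defines "\<Lambda> \<equiv> T2 R"
  assumes R: "ring R" and J: "submodule J R (regular R)"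
    and f: "f \<in> lhom R ((regular R)\<lparr>carrier := J\<rparr>) (regular R)"
    and not_mult: "\<not> (\<exists>b\<in>carrier R. \<forall>w\<in>J. f w = w \<otimes> b)"
    and P: "resolved_module \<Lambda> (T2_left (regular R) ((regular R)\<lparr>carrier := J\<rparr>) id) P"
  shows "\<not> ext_vanishes \<Lambda> P (regular \<Lambda>) 0"
proof
  assume van: "ext_vanishes \<Lambda> P (regular \<Lambda>) 0"
  interpret R: ring R by fact
  interpret reg: left_module R "regular R" using left_module_regular[OF R] .
  let ?JM = "(regular R)\<lparr>carrier := J\<rparr>"
  let ?Y = "T2_left (regular R) ?JM id"
  interpret P: resolved_module \<Lambda> ?Y P by fact
  note J' = reg.submoduleD[OF J, simplified]
  have JR: "w \<in> carrier R" if "w \<in> J" for w using J'(1) that by blast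
  have \<Lambda>_simps: "carrier \<Lambda> = carrier R \<times> carrier R \<times> carrier R"
    "(a1, a2, a3) \<otimes>\<^bsub>\<Lambda>\<^esub> (b1, b2, b3) =
      (a1 \<otimes> b1, a1 \<otimes> b2 \<oplus> a2 \<otimes> b3, a3 \<otimes> b3)"
    "(a1, a2, a3) \<oplus>\<^bsub>\<Lambda>\<^esub> (b1, b2, b3) = (a1 \<oplus> b1, a2 \<oplus> b2, a3 \<oplus> b3)"
    "\<zero>\<^bsub>\<Lambda>\<^esub> = (\<zero>, \<zero>, \<zero>)"
    for a1 a2 a3 b1 b2 b3 by (simp_all add: \<Lambda>_def T2_simps)
  define n where "n = res_rank P 0"
  let ?F = "free_module \<Lambda> n"
  have F0: "P.F 0 = ?F" by (simp add: res_module_def n_def)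
  interpret F: left_module \<Lambda> ?F using left_module_free P.R.ring_axioms .
  interpret F1: left_module \<Lambda> "P.F (Suc 0)" by (rule P.F_module)
  let ?\<epsilon> = "res_aug P"
  have \<epsilon>: "?\<epsilon> \<in> lhom \<Lambda> ?F ?Y" using P.aug_hom F0 by simp
  have \<epsilon>_cl: "?\<epsilon> u \<in> carrier R \<times> J" if "u \<in> carrier ?F" for u
    using lhom_closed[OF \<epsilon> that] by (simp add: T2_left_simps)
  have \<epsilon>2: "snd (?\<epsilon> u) \<in> J" if "u \<in> carrier ?F" for u
    using \<epsilon>_cl[OF that] by auto
  have \<epsilon>_add: "snd (?\<epsilon> (u \<oplus>\<^bsub>?F\<^esub> v)) = snd (?\<epsilon> u) \<oplus> snd (?\<epsilon> v)"
    if "u \<in> carrier ?F" "v \<in> carrier ?F" for u v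
    using lhom_add[OF \<epsilon> that] by (cases "?\<epsilon> u"; cases "?\<epsilon> v") (simp add: T2_left_simps)
  have \<epsilon>_smult: "snd (?\<epsilon> ((a1, a2, a3) \<odot>\<^bsub>?F\<^esub> u)) = a3 \<otimes> snd (?\<epsilon> u)"
    if "a1 \<in> carrier R" "a2 \<in> carrier R" "a3 \<in> carrier R" "u \<in> carrier ?F" for a1 a2 a3 u
    using lhom_smult[OF \<epsilon> _ that(4), of "(a1, a2, a3)"] that
    by (cases "?\<epsilon> u") (simp add: T2_left_simps \<Lambda>_simps)
  \<comment> \<open>As a left module, \<Lambda> is the sum of its two columns, and the second column
    is R over R with the identity between them. \<tau> copies the top entry of that column to the
    bottom and discards the rest, so that \<sigma> below applies the bottom part of the augmentation
    to top entries.\<close>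
  define \<tau> where "\<tau> u = (\<lambda>i\<in>{..<n}. (\<zero>, \<zero>, fst (snd (u i))))" for u :: "nat \<Rightarrow> 'a \<times> 'a \<times> 'a"
  have coord: "\<exists>a1\<in>carrier R. \<exists>a2\<in>carrier R. \<exists>a3\<in>carrier R. u i = (a1, a2, a3)"
    if "u \<in> carrier ?F" "i < n" for u i
  proof -
    have "u i \<in> carrier \<Lambda>" using that by (auto simp: carrier_free_module)
    then show ?thesis by (cases "u i") (simp add: \<Lambda>_simps)
  qed
  have \<tau>_cl: "\<tau> u \<in> carrier ?F" if "u \<in> carrier ?F" for u
    using coord[OF that] by (fastforce simp: \<tau>_def carrier_free_module \<Lambda>_simps)
  have \<tau>_add: "\<tau> (u \<oplus>\<^bsub>?F\<^esub> v) = \<tau> u \<oplus>\<^bsub>?F\<^esub> \<tau> v"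
    if u: "u \<in> carrier ?F" and v: "v \<in> carrier ?F" for u v
  proof
    fix i show "\<tau> (u \<oplus>\<^bsub>?F\<^esub> v) i = (\<tau> u \<oplus>\<^bsub>?F\<^esub> \<tau> v) i"
      using coord[OF u, of i] coord[OF v, of i]
      by (cases "i < n") (auto simp: \<tau>_def add_free_module \<Lambda>_simps)
  qed
  have \<tau>_smult: "\<tau> ((a1, a2, a3) \<odot>\<^bsub>?F\<^esub> u) =
      (\<zero>, \<zero>, a1) \<odot>\<^bsub>?F\<^esub> \<tau> u \<oplus>\<^bsub>?F\<^esub> (\<zero>, \<zero>, a2) \<odot>\<^bsub>?F\<^esub> u"
    if u: "u \<in> carrier ?F" and a: "a1 \<in> carrier R" "a2 \<in> carrier R" "a3 \<in> carrier R" for a1 a2 a3 u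
  proof
    fix i show "\<tau> ((a1, a2, a3) \<odot>\<^bsub>?F\<^esub> u) i =
        ((\<zero>, \<zero>, a1) \<odot>\<^bsub>?F\<^esub> \<tau> u \<oplus>\<^bsub>?F\<^esub> (\<zero>, \<zero>, a2) \<odot>\<^bsub>?F\<^esub> u) i"
      using coord[OF u, of i] a
      by (cases "i < n") (auto simp: \<tau>_def add_free_module smult_free_module \<Lambda>_simps)
  qed
  define \<sigma> where "\<sigma> u = snd (?\<epsilon> (\<tau> u))" for u
  have \<sigma>_J: "\<sigma> u \<in> J" if "u \<in> carrier ?F" for u
    using \<epsilon>2 \<tau>_cl that by (simp add: \<sigma>_def)
  have \<sigma>_add: "\<sigma> (u \<oplus>\<^bsub>?F\<^esub> v) = \<sigma> u \<oplus> \<sigma> v"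
    if "u \<in> carrier ?F" "v \<in> carrier ?F" for u v
    using that by (simp add: \<sigma>_def \<tau>_add \<tau>_cl \<epsilon>_add)
  \<comment> \<open>Apart from the term with \<open>snd (?\<epsilon> u)\<close>, matrices act on
    values of \<sigma> through a1 alone, as they do on the first column of \<Lambda>. That term
    vanishes on the kernel of the augmentation, so there f after \<sigma> is a \<Lambda>-map into
    the first column.\<close>
  have \<sigma>_smult: "\<sigma> ((a1, a2, a3) \<odot>\<^bsub>?F\<^esub> u) = a1 \<otimes> \<sigma> u \<oplus> a2 \<otimes> snd (?\<epsilon> u)"
    if "u \<in> carrier ?F" "a1 \<in> carrier R" "a2 \<in> carrier R" "a3 \<in> carrier R" for a1 a2 a3 u
    using that by (simp add: \<sigma>_def \<tau>_smult \<tau>_cl \<epsilon>_add \<epsilon>_smult F.smult_closed \<Lambda>_simps)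
  have f_cl: "f w \<in> carrier R" if "w \<in> J" for w
    using lhom_closed[OF f] that by simp
  have f_add: "f (v \<oplus> w) = f v \<oplus> f w" if "v \<in> J" "w \<in> J" for v w
    using lhom_add[OF f, of v w] that by simp
  have f_smult: "f (a \<otimes> w) = a \<otimes> f w" if "a \<in> carrier R" "w \<in> J" for a w
    using lhom_smult[OF f, of a w] that by simp
  have f_zero: "f \<zero> = \<zero>"
    using f_smult[of "\<zero>" "\<zero>"] J'(2) f_cl by simp
  have d_cl: "P.d 0 p \<in> carrier ?F" if "p \<in> carrier (P.F (Suc 0))" for p
    using lhom_closed[OF P.d_hom that] F0 by simp
  have \<epsilon>_d: "?\<epsilon> (P.d 0 p) = (\<zero>, \<zero>)" if "p \<in> carrier (P.F (Suc 0))" for p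
    using P.aug_d[OF that] by (simp add: T2_left_simps)
  define h where "h = (\<lambda>p\<in>carrier (P.F (Suc 0)). (f (\<sigma> (P.d 0 p)), \<zero>, \<zero>))"
  have "h \<in> lhom \<Lambda> (P.F (Suc 0)) (regular \<Lambda>)"
  proof (rule lhomI)
    show "h \<in> carrier (P.F (Suc 0)) \<rightarrow>\<^sub>E carrier (regular \<Lambda>)"
      by (simp add: h_def \<Lambda>_simps f_cl \<sigma>_J d_cl)
  next
    fix p p' assume p: "p \<in> carrier (P.F (Suc 0))" "p' \<in> carrier (P.F (Suc 0))"
    then have "P.d 0 (p \<oplus>\<^bsub>P.F (Suc 0)\<^esub> p') = P.d 0 p \<oplus>\<^bsub>?F\<^esub> P.d 0 p'"
      using lhom_add[OF P.d_hom[of 0]] F0 by simp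
    then show "h (p \<oplus>\<^bsub>P.F (Suc 0)\<^esub> p') = h p \<oplus>\<^bsub>regular \<Lambda>\<^esub> h p'"
      using p by (simp add: h_def \<sigma>_add d_cl f_add \<sigma>_J \<Lambda>_simps)
  next
    fix a p assume a: "a \<in> carrier \<Lambda>" and p: "p \<in> carrier (P.F (Suc 0))"
    obtain a1 a2 a3 where a': "a = (a1, a2, a3)" "a1 \<in> carrier R" "a2 \<in> carrier R" "a3 \<in> carrier R"
      using a by (cases a) (simp add: \<Lambda>_simps)
    have "P.d 0 (a \<odot>\<^bsub>P.F (Suc 0)\<^esub> p) = a \<odot>\<^bsub>?F\<^esub> P.d 0 p"
      using lhom_smult[OF P.d_hom[of 0] a p] F0 by simp
    then show "h (a \<odot>\<^bsub>P.F (Suc 0)\<^esub> p) = a \<odot>\<^bsub>regular \<Lambda>\<^esub> h p"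
      using p a a' F1.smult_closed[OF a p]
      by (simp add: h_def \<sigma>_smult d_cl \<epsilon>_d f_smult f_cl JR \<sigma>_J \<Lambda>_simps)
  qed
  moreover have "h (P.d (Suc 0) u) = \<zero>\<^bsub>regular \<Lambda>\<^esub>" if "u \<in> carrier (P.F (Suc (Suc 0)))" for u
  proof -
    have z: "\<sigma> \<zero>\<^bsub>?F\<^esub> = \<zero>"
      using \<sigma>_add[of "\<zero>\<^bsub>?F\<^esub>" "\<zero>\<^bsub>?F\<^esub>"] \<sigma>_J[of "\<zero>\<^bsub>?F\<^esub>"] JR by simp
    show ?thesis
      using that P.d_d[OF that] lhom_closed[OF P.d_hom that] F0
      by (simp add: h_def z f_zero \<Lambda>_simps)
  qed
  ultimately obtain H where H: "H \<in> lhom \<Lambda> ?F (regular \<Lambda>)"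
    and hH: "\<And>p. p \<in> carrier (P.F (Suc 0)) \<Longrightarrow> h p = H (P.d 0 p)"
    using van F0 unfolding ext_vanishes_def by auto
  have H_ker: "fst (H u) = f (\<sigma> u)" if u: "u \<in> carrier ?F" "?\<epsilon> u = (\<zero>, \<zero>)" for u
  proof -
    have "u \<in> syzygy \<Lambda> ?Y P 0" using u F0 by (simp add: syzygy_0 T2_left_simps)
    then obtain p where p: "p \<in> carrier (P.F (Suc 0))" "u = P.d 0 p"
      using P.d_image[of 0] by blast
    then have "H u = h p" using hH by simp
    then show ?thesis using p by (simp add: h_def)
  qed
  have H_smult: "fst (H ((a1, a2, a3) \<odot>\<^bsub>?F\<^esub> u)) = a1 \<otimes> fst (H u)"
    if "a1 \<in> carrier R" "a2 \<in> carrier R" "a3 \<in> carrier R" "u \<in> carrier ?F" for a1 a2 a3 u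
    using lhom_smult[OF H, of "(a1, a2, a3)" u] that by (cases "H u") (simp add: \<Lambda>_simps)
  have H_add: "fst (H (u \<oplus>\<^bsub>?F\<^esub> v)) = fst (H u) \<oplus> fst (H v)"
    if "u \<in> carrier ?F" "v \<in> carrier ?F" for u v
    using lhom_add[OF H that] by (cases "H u"; cases "H v") (simp add: \<Lambda>_simps)
  have H_cl: "fst (H u) \<in> carrier R" if "u \<in> carrier ?F" for u
    using lhom_closed[OF H that] by (cases "H u") (simp add: \<Lambda>_simps)
  have surj: "\<exists>u\<in>carrier ?F. ?\<epsilon> u = y" if "y \<in> carrier R \<times> J" for y
  proof -
    have "y \<in> ?\<epsilon> ` carrier ?F" using P.aug_surj F0 that by (simp add: T2_left_simps)
    then show ?thesis by blast
  qed
  obtain s0 where s0: "s0 \<in> carrier ?F" "?\<epsilon> s0 = (\<one>, \<zero>)"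
    using surj[of "(\<one>, \<zero>)"] J'(2) by auto
  have f_formula: "f w = w \<otimes> (f (\<sigma> s0) \<ominus> fst (H s0))" if w: "w \<in> J" for w
  proof -
    note wR = JR[OF w]
    obtain t where t: "t \<in> carrier ?F" "?\<epsilon> t = (\<zero>, w)"
      using surj[of "(\<zero>, w)"] w by auto
    \<comment> \<open>Two lifts of (w, 0) are compared: \<open>?t\<close> moves t from the bottom to
      the top, and the other is w times s0. Their difference lies in the kernel of the augmentation,
      where f after \<sigma> is the first entry of H. On \<open>?t\<close> that entry is zero
      because the matrix used has a1 = 0, whereas \<sigma> takes the value w there.\<close>
    let ?t = "(\<zero>, \<one>, \<zero>) \<odot>\<^bsub>?F\<^esub> t" and ?s = "(\<ominus> w, \<zero>, \<zero>) \<odot>\<^bsub>?F\<^esub> s0"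
    let ?u = "?t \<oplus>\<^bsub>?F\<^esub> ?s"
    have cl: "?t \<in> carrier ?F" "?s \<in> carrier ?F"
      using t s0 wR by (auto intro!: F.smult_closed simp: \<Lambda>_simps)
    have u: "?u \<in> carrier ?F" using cl by simp
    have "?\<epsilon> ?t = (w, \<zero>)"
      using lhom_smult[OF \<epsilon> _ t(1), of "(\<zero>, \<one>, \<zero>)"] wR t(2)
      by (simp add: \<Lambda>_simps T2_left_simps)
    moreover have "?\<epsilon> ?s = (\<ominus> w, \<zero>)"
      using lhom_smult[OF \<epsilon> _ s0(1), of "(\<ominus> w, \<zero>, \<zero>)"] wR s0(2)
      by (simp add: \<Lambda>_simps T2_left_simps)
    ultimately have "?\<epsilon> ?u = (\<zero>, \<zero>)"
      using lhom_add[OF \<epsilon> cl] wR by (simp add: T2_left_simps R.r_neg)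
    then have eq: "fst (H ?u) = f (\<sigma> ?u)" by (rule H_ker[OF u])
    have "\<sigma> ?u = w \<oplus> (\<ominus> w) \<otimes> \<sigma> s0"
      using wR s0 t JR[OF \<sigma>_J[OF s0(1)]] JR[OF \<sigma>_J[OF t(1)]]
      by (simp add: \<sigma>_add[OF cl] \<sigma>_smult)
    moreover have "(\<ominus> w) \<otimes> \<sigma> s0 \<in> J" using wR \<sigma>_J[OF s0(1)] J'(4) by simp
    ultimately have "f (\<sigma> ?u) = f w \<oplus> (\<ominus> w) \<otimes> f (\<sigma> s0)"
      using w wR \<sigma>_J[OF s0(1)] by (simp add: f_add f_smult)
    moreover have "fst (H ?u) = (\<ominus> w) \<otimes> fst (H s0)"
      using wR s0 t H_cl by (simp add: H_add[OF cl] H_smult)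
    ultimately have "f w \<oplus> (\<ominus> w) \<otimes> f (\<sigma> s0) = (\<ominus> w) \<otimes> fst (H s0)"
      using eq by simp
    then have eq': "f w \<oplus> \<ominus> (w \<otimes> f (\<sigma> s0)) = \<ominus> (w \<otimes> fst (H s0))"
      using wR f_cl[OF \<sigma>_J[OF s0(1)]] H_cl[OF s0(1)] by (simp add: R.l_minus)
    have "f w = (f w \<oplus> \<ominus> (w \<otimes> f (\<sigma> s0))) \<oplus> w \<otimes> f (\<sigma> s0)"
      using wR f_cl[OF w] f_cl[OF \<sigma>_J[OF s0(1)]] by (simp add: R.a_assoc R.l_neg)
    then show ?thesis
      unfolding eq' using wR f_cl[OF \<sigma>_J[OF s0(1)]] H_cl[OF s0(1)]
      by (simp add: a_minus_def R.r_distr R.r_minus R.a_comm)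
  qed
  have "f (\<sigma> s0) \<ominus> fst (H s0) \<in> carrier R"
    using f_cl[OF \<sigma>_J[OF s0(1)]] H_cl[OF s0(1)] by simp
  with f_formula not_mult show False by blast
qed

section \<open>The algebra in coordinates\<close>

text \<open>Coordinates with respect to the basis \<open>1, x, y, z, yx, zx\<close> of \<open>A\<close>.\<close>
type_synonym 'k coords = "'k \<times> 'k \<times> 'k \<times> 'k \<times> 'k \<times> 'k"

text \<open>The multiplication table forced by the relations: the nonzero products of two generators
  are \<open>yx\<close>, \<open>xy = - q yx\<close> and \<open>zx = xz = zy\<close>, and all
  products of three generators vanish.\<close>

fun cmult :: "'k::field \<Rightarrow> 'k coords \<Rightarrow> 'k coords \<Rightarrow> 'k coords" where
  "cmult q (a0, a1, a2, a3, a4, a5) (b0, b1, b2, b3, b4, b5) =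
    (a0 * b0, a0 * b1 + a1 * b0, a0 * b2 + a2 * b0, a0 * b3 + a3 * b0,
     a0 * b4 + a4 * b0 + a2 * b1 - q * a1 * b2,
     a0 * b5 + a5 * b0 + a1 * b3 + a3 * b1 + a3 * b2)"

fun cscale :: "'k::field \<Rightarrow> 'k coords \<Rightarrow> 'k coords" where
  "cscale c (a0, a1, a2, a3, a4, a5) = (c * a0, c * a1, c * a2, c * a3, c * a4, c * a5)"

fun gen_coords :: "gen \<Rightarrow> 'k::field coords" where
  "gen_coords GX = (0, 1, 0, 0, 0, 0)"
| "gen_coords GY = (0, 0, 1, 0, 0, 0)"
| "gen_coords GZ = (0, 0, 0, 1, 0, 0)"

fun word_coords :: "'k::field \<Rightarrow> gen list \<Rightarrow> 'k coords" where
  "word_coords q [] = (1, 0, 0, 0, 0, 0)"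
| "word_coords q (g # w) = cmult q (gen_coords g) (word_coords q w)"

definition coords :: "'k::field \<Rightarrow> 'k free_algebra \<Rightarrow> 'k coords" where
  "coords q p = (\<Sum>w\<in>Poly_Mapping.keys p. cscale (Poly_Mapping.lookup p w) (word_coords q (letters w)))"

fun of_coords :: "'k::field coords \<Rightarrow> 'k free_algebra" where
  "of_coords (a0, a1, a2, a3, a4, a5) =
    const a0 + const a1 * vx + const a2 * vy + const a3 * vz + const a4 * (vy * vx) + const a5 * (vz * vx)"

text \<open>This check takes the place of a confluence argument for the relations: it makes
  \<open>word_coords\<close> multiplicative, so that the six basis monomials stay independent in the
  quotient.\<close>

lemma cmult_assoc: "cmult q (cmult q a b) c = cmult q a (cmult q b c)"
  by (cases a; cases b; cases c) (simp add: algebra_simps)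

lemma cmult_one: "cmult q (1, 0, 0, 0, 0, 0) a = a" "cmult q a (1, 0, 0, 0, 0, 0) = a"
  by (cases a; simp)+

lemma cmult_add: "cmult q (a + b) c = cmult q a c + cmult q b c" "cmult q c (a + b) = cmult q c a + cmult q c b"
  by (cases a; cases b; cases c; simp add: algebra_simps)+

lemma cmult_zero [simp]: "cmult q 0 a = 0" "cmult q a 0 = 0"
  by (cases a; simp add: zero_prod_def)+

lemma cmult_scale: "cmult q (cscale c a) b = cscale c (cmult q a b)" "cmult q a (cscale c b) = cscale c (cmult q a b)"
  by (cases a; cases b; simp add: algebra_simps)+

lemma cscale_add: "cscale (c + d) a = cscale c a + cscale d a" "cscale c (a + b) = cscale c a + cscale c b"
  by (cases a; cases b; simp add: algebra_simps)+

lemma cscale_cscale: "cscale c (cscale d a) = cscale (c * d) a" and cscale_one: "cscale 1 a = a"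
  and cscale_zero: "cscale 0 a = 0"
  by (cases a; simp add: zero_prod_def)+

lemma word_coords_append: "word_coords q (v @ w) = cmult q (word_coords q v) (word_coords q w)"
  by (induction v) (simp_all add: cmult_one cmult_assoc)

lemma free_algebra_induct [case_names zero single add]:
  fixes p :: "'k::field free_algebra"
  assumes "P 0" "\<And>w c. P (Poly_Mapping.single w c)" "\<And>p r. P p \<Longrightarrow> P r \<Longrightarrow> P (p + r)"
  shows "P p"
proof (induction p rule: update_induct)
  case (update p w c)
  have "Poly_Mapping.update w c p = p + Poly_Mapping.single w c"
    using update.hyps by (intro poly_mapping_eqI)
      (auto simp: lookup_update lookup_add lookup_single in_keys_iff when_def)
  then show ?case using assms(2,3) update.IH by metis
qed (use assms in auto)

lemma coords_superset:
  assumes "finite S" "Poly_Mapping.keys p \<subseteq> S"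
  shows "coords q p = (\<Sum>w\<in>S. cscale (Poly_Mapping.lookup p w) (word_coords q (letters w)))"
  unfolding coords_def using assms
  by (intro sum.mono_neutral_left) (auto simp: in_keys_iff cscale_zero)

lemma coords_zero [simp]: "coords q 0 = 0"
  by (simp add: coords_def)

lemma coords_add: "coords q (p + r) = coords q p + coords q r"
proof -
  let ?S = "Poly_Mapping.keys p \<union> Poly_Mapping.keys r"
  have "coords q (p + r) =
      (\<Sum>w\<in>?S. cscale (Poly_Mapping.lookup (p + r) w) (word_coords q (letters w)))"
    by (rule coords_superset) (auto simp: Poly_Mapping.keys_add)
  also have "\<dots> = coords q p + coords q r"
    using coords_superset[of ?S p q] coords_superset[of ?S r q]
    by (simp add: lookup_add cscale_add sum.distrib)
  finally show ?thesis .
qed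

lemma coords_single: "coords q (Poly_Mapping.single w c) = cscale c (word_coords q (letters w))"
  by (cases "c = 0") (simp_all add: coords_def cscale_zero)

lemma coords_minus: "coords q (- p) = - coords q p"
  using coords_add[of q "- p" p] by (simp add: eq_neg_iff_add_eq_0)

lemma coords_diff: "coords q (p - r) = coords q p - coords q r"
  using coords_add[of q p "- r"] by (simp add: coords_minus)

lemma coords_mult: "coords q (p * r) = cmult q (coords q p) (coords q r)"
proof (induction p rule: free_algebra_induct)
  case (single w c)
  show ?case
  proof (induction r rule: free_algebra_induct)
    case (single w' c')
    then show ?case
      by (simp add: mult_single coords_single plus_word_def word_coords_append cmult_scale
          cscale_cscale mult.commute)
  qed (simp_all add: distrib_left coords_add cmult_add)
qed (simp_all add: distrib_right coords_add cmult_add)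

lemma coords_const [simp]: "coords q (const c) = (c, 0, 0, 0, 0, 0)"
  by (simp add: const_def coords_single zero_word_def)

lemma coords_var [simp]: "coords q (var g) = gen_coords g"
  by (simp add: var_def coords_single cscale_one cmult_one)

lemma coords_of_coords: "coords q (of_coords a) = a"
  by (cases a) (simp add: coords_add coords_mult)

lemma const_mult: "const c * const d = const (c * d)"
  and const_add: "const (c + d) = const c + const d"
  and const_0: "const 0 = 0" and const_1: "const 1 = 1" and const_minus: "const (- c) = - const c"
  by (simp_all add: const_def mult_single single_add single_uminus)

lemma const_commute: "p * const c = const c * p"
proof (induction p rule: free_algebra_induct)
  case (single w d)
  then show ?case by (simp add: const_def mult_single mult.commute)
qed (simp_all add: distrib_left distrib_right)

lemma var_const: "var g * (const c * r) = const c * (var g * r)" "var g * const c = const c * var g"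
  by (simp_all add: const_commute[of "var g"] flip: mult.assoc)

lemma const_const_mult: "const c * (const d * r) = const (c * d) * r"
  by (simp add: const_mult flip: mult.assoc)

lemma of_coords_add: "of_coords (a + b) = of_coords a + of_coords b"
  by (cases a; cases b) (simp add: const_add algebra_simps)

lemma of_coords_scale: "of_coords (cscale c a) = const c * of_coords a"
  by (cases a) (simp add: distrib_left flip: const_mult, simp add: mult.assoc)

lemma of_coords_zero: "of_coords 0 = 0"
  by (simp add: zero_prod_def const_0)

section \<open>The quotient of the free algebra by the relations\<close>

abbreviation free_ring :: "'k::field free_algebra ring" where
  "free_ring \<equiv> ring_of_type_algebra"

lemma free_ring_simps:
  "carrier free_ring = UNIV" "a \<otimes>\<^bsub>free_ring\<^esub> b = a * b" "a \<oplus>\<^bsub>free_ring\<^esub> b = a + b"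
  "\<zero>\<^bsub>free_ring\<^esub> = 0" "\<one>\<^bsub>free_ring\<^esub> = 1"
  by (simp_all add: ring_of_type_algebra_def)

interpretation free: ring "free_ring :: 'k::field free_algebra ring"
proof (rule ringI)
  show "abelian_group (free_ring :: 'k free_algebra ring)"
    by (rule abelian_groupI)
      (auto simp: free_ring_simps add.assoc add.commute intro: exI[of _ "- _"])
  show "Group.monoid (free_ring :: 'k free_algebra ring)"
    by (rule monoidI) (simp_all add: free_ring_simps mult.assoc)
qed (simp_all add: free_ring_simps distrib_left distrib_right)

lemma free_ring_minus: "\<ominus>\<^bsub>free_ring\<^esub> a = - (a :: 'k::field free_algebra)"
  by (rule free.minus_equality) (simp_all add: free_ring_simps)

lemma ideal_rel_ideal: "ideal (rel_ideal q) free_ring"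
  unfolding rel_ideal_def by (rule free.genideal_ideal) (simp add: free_ring_simps)

context
  fixes q :: "'k::field"
begin

interpretation I: ideal "rel_ideal q" free_ring by (rule ideal_rel_ideal)

lemma rel_ideal_closed:
  "p \<in> rel_ideal q \<Longrightarrow> r * p \<in> rel_ideal q" "p \<in> rel_ideal q \<Longrightarrow> p * r \<in> rel_ideal q"
  "p \<in> rel_ideal q \<Longrightarrow> r \<in> rel_ideal q \<Longrightarrow> p + r \<in> rel_ideal q"
  "p \<in> rel_ideal q \<Longrightarrow> - p \<in> rel_ideal q" "0 \<in> rel_ideal q"
  using I.I_l_closed[of p r] I.I_r_closed[of p r] I.a_closed[of p r] I.a_inv_closed[of p]
    I.zero_closed by (simp_all add: free_ring_simps free_ring_minus)

lemma rel_ideal_diff: "p \<in> rel_ideal q \<Longrightarrow> r \<in> rel_ideal q \<Longrightarrow> p - r \<in> rel_ideal q"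
  using rel_ideal_closed(3)[of p "- r"] rel_ideal_closed(4) by simp

lemma relators_in_rel_ideal: "relators q \<subseteq> rel_ideal q"
  unfolding rel_ideal_def by (rule free.genideal_self) (simp add: free_ring_simps)

text \<open>Words grow by letters on the left, so this reduction of one letter times a normal form
  carries the whole induction in \<open>of_coords_coords\<close>.\<close>

lemma var_mult_of_coords: "var g * of_coords a - of_coords (cmult q (gen_coords g) a) \<in> rel_ideal q"
proof -
  have "relators q \<subseteq> rel_ideal q" by (rule relators_in_rel_ideal)
  then have xx: "vx * vx \<in> rel_ideal q" and yy: "vy * vy \<in> rel_ideal q"
    and zz: "vz * vz \<in> rel_ideal q" and yz: "vy * vz \<in> rel_ideal q"
    and xy: "vx * vy + const q * (vy * vx) \<in> rel_ideal q" and xz: "vx * vz - vz * vx \<in> rel_ideal q"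
    and zy: "vz * vy - vz * vx \<in> rel_ideal q"
    by (auto simp: relators_def power2_eq_square mult.assoc)
  note cl = rel_ideal_closed rel_ideal_diff
  obtain a0 a1 a2 a3 a4 a5 where a: "a = (a0, a1, a2, a3, a4, a5)" by (cases a)
  show ?thesis
  proof (cases g)
    case GX
    \<comment> \<open>The cubic monomials that arise lie in the ideal: here and in the case of z,
      rewriting the first two letters exposes the square of x.\<close>
    have 1: "vx * (vy * vx) \<in> rel_ideal q"
    proof -
      have "vx * (vy * vx) = (vx * vy + const q * (vy * vx)) * vx - const q * (vy * (vx * vx))"
        by (simp add: algebra_simps)
      then show ?thesis using xy xx cl by metis
    qed
    have 2: "vx * (vz * vx) \<in> rel_ideal q"
    proof -
      have "vx * (vz * vx) = (vx * vz - vz * vx) * vx + vz * (vx * vx)"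
        by (simp add: algebra_simps)
      then show ?thesis using xz xx cl by metis
    qed
    have "vx * of_coords a - of_coords (cmult q (gen_coords GX) a) =
        const a1 * (vx * vx) + const a2 * (vx * vy + const q * (vy * vx)) + const a3 * (vx * vz - vz * vx)
        + const a4 * (vx * (vy * vx)) + const a5 * (vx * (vz * vx))"
      by (simp add: a var_const const_const_mult distrib_left right_diff_distrib const_0 const_minus
          mult.commute[of a2 q])
    then show ?thesis using GX xx xy xz 1 2 cl by simp
  next
    case GY
    have 1: "vy * (vy * vx) \<in> rel_ideal q" "vy * (vz * vx) \<in> rel_ideal q"
      using cl(2)[OF yy, of vx] cl(2)[OF yz, of vx] by (simp_all add: mult.assoc)
    have "vy * of_coords a - of_coords (cmult q (gen_coords GY) a) =
        const a2 * (vy * vy) + const a3 * (vy * vz)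
        + const a4 * (vy * (vy * vx)) + const a5 * (vy * (vz * vx))"
      by (simp add: a var_const distrib_left const_0)
    then show ?thesis using GY yy yz 1 cl by simp
  next
    case GZ
    have 1: "vz * (vz * vx) \<in> rel_ideal q" using cl(2)[OF zz, of vx] by (simp add: mult.assoc)
    have 2: "vz * (vy * vx) \<in> rel_ideal q"
    proof -
      have "vz * (vy * vx) = (vz * vy - vz * vx) * vx + vz * (vx * vx)"
        by (simp add: algebra_simps)
      then show ?thesis using zy xx cl by metis
    qed
    have "vz * of_coords a - of_coords (cmult q (gen_coords GZ) a) =
        const a2 * (vz * vy - vz * vx) + const a3 * (vz * vz)
        + const a4 * (vz * (vy * vx)) + const a5 * (vz * (vz * vx))"
      by (simp add: a var_const distrib_left right_diff_distrib const_0
          const_add distrib_right)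
    then show ?thesis using GZ zz zy 1 2 cl by simp
  qed
qed

lemma of_coords_coords: "p - of_coords (coords q p) \<in> rel_ideal q"
proof (induction p rule: free_algebra_induct)
  case zero
  then show ?case by (simp add: of_coords_zero rel_ideal_closed)
next
  case (single w c)
  have word: "Poly_Mapping.single (Word w) 1 - of_coords (word_coords q w) \<in> rel_ideal q" for w
  proof (induction w)
    case Nil
    have "Poly_Mapping.single (Word []) (1::'k) = 1"
      using single_one[where 'b = 'k and 'a = word] by (simp add: zero_word_def)
    then show ?case by (simp add: const_0 const_1 rel_ideal_closed)
  next
    case (Cons g w)
    let ?m = "Poly_Mapping.single (Word w) (1::'k)"
    have "Poly_Mapping.single (Word (g # w)) 1 = var g * ?m"
      by (simp add: var_def mult_single plus_word_def)
    then have "Poly_Mapping.single (Word (g # w)) 1 - of_coords (word_coords q (g # w)) =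
        var g * (?m - of_coords (word_coords q w)) +
        (var g * of_coords (word_coords q w) - of_coords (cmult q (gen_coords g) (word_coords q w)))"
      by (simp add: right_diff_distrib)
    then show ?case
      using rel_ideal_closed(1)[OF Cons.IH] var_mult_of_coords rel_ideal_closed(3) by metis
  qed
  have "Poly_Mapping.single w c = const c * Poly_Mapping.single (Word (letters w)) 1"
    by (simp add: const_def mult_single)
  moreover have "of_coords (coords q (Poly_Mapping.single w c)) = const c * of_coords (word_coords q (letters w))"
    by (simp add: coords_single of_coords_scale)
  ultimately have "Poly_Mapping.single w c - of_coords (coords q (Poly_Mapping.single w c)) =
      const c * (Poly_Mapping.single (Word (letters w)) 1 - of_coords (word_coords q (letters w)))"
    by (metis right_diff_distrib)
  then show ?case using rel_ideal_closed(1)[OF word] by metis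
next
  case (add p r)
  then show ?case
    using rel_ideal_closed(3)[OF add] by (simp add: coords_add of_coords_add algebra_simps)
qed

text \<open>The kernel of \<open>coords\<close> is an ideal containing the relators, hence it
  contains \<open>rel_ideal\<close>; conversely every p is congruent to
  \<open>of_coords (coords q p)\<close>. So A is the space of six coordinates with the product
  \<open>cmult\<close>.\<close>

lemma mem_rel_ideal_iff: "p \<in> rel_ideal q \<longleftrightarrow> coords q p = 0"
proof
  have "ideal {p. coords q p = 0} free_ring"
  proof (rule idealI[OF free.ring_axioms])
    show "subgroup {p. coords q p = 0} (add_monoid (free_ring :: 'k free_algebra ring))"
    proof (rule group.subgroupI[OF free.a_group])
      show "inv\<^bsub>add_monoid free_ring\<^esub> p \<in> {p. coords q p = 0}" if "p \<in> {p. coords q p = 0}" for p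
        unfolding free_ring_minus[unfolded a_inv_def] using that by (simp add: coords_minus)
      show "{p. coords q p = 0} \<noteq> {}" using coords_zero[of q] by blast
    qed (simp_all add: free_ring_simps coords_add)
  qed (auto simp: free_ring_simps coords_mult)
  moreover have "relators q \<subseteq> {p. coords q p = 0}"
    by (auto simp: relators_def power2_eq_square coords_mult coords_add coords_diff zero_prod_def)
  ultimately have "rel_ideal q \<subseteq> {p. coords q p = 0}"
    unfolding rel_ideal_def by (rule free.genideal_minimal)
  then show "p \<in> rel_ideal q \<Longrightarrow> coords q p = 0" by auto
next
  assume "coords q p = 0"
  then show "p \<in> rel_ideal q" using of_coords_coords[of p] by (simp add: of_coords_zero)
qed

lemma ring_alg: "ring (alg q)"
  unfolding alg_def by (rule I.quotient_is_ring)

lemma elt_eq_iff: "elt q p = elt q r \<longleftrightarrow> coords q p = coords q r"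
proof -
  have "elt q p = elt q r \<longleftrightarrow> p \<in> elt q r"
    using I.a_rcos_self[of p] I.a_repr_independence'[of p r]
    by (auto simp: elt_def free_ring_simps)
  also have "\<dots> \<longleftrightarrow> p - r \<in> rel_ideal q"
    using I.a_rcos_module[of r p] by (simp add: elt_def free_ring_simps free_ring_minus)
  finally show ?thesis by (simp add: mem_rel_ideal_iff coords_diff)
qed

lemma elt_hom:
  "elt q p \<otimes>\<^bsub>alg q\<^esub> elt q r = elt q (p * r)" "elt q p \<oplus>\<^bsub>alg q\<^esub> elt q r = elt q (p + r)"
  "\<one>\<^bsub>alg q\<^esub> = elt q 1" "\<zero>\<^bsub>alg q\<^esub> = elt q 0" "carrier (alg q) = range (elt q)"
proof -
  show "elt q p \<otimes>\<^bsub>alg q\<^esub> elt q r = elt q (p * r)"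
    using I.rcoset_mult_add[of p r] by (simp add: elt_def alg_def FactRing_def free_ring_simps)
  show "elt q p \<oplus>\<^bsub>alg q\<^esub> elt q r = elt q (p + r)"
    using I.a_rcos_sum[of p r] by (simp add: elt_def alg_def FactRing_def free_ring_simps)
  show "\<one>\<^bsub>alg q\<^esub> = elt q 1" by (simp add: elt_def alg_def FactRing_def free_ring_simps)
  show "\<zero>\<^bsub>alg q\<^esub> = elt q 0"
    using I.a_rcos_const[OF I.zero_closed] by (simp add: elt_def alg_def FactRing_def free_ring_simps)
  show "carrier (alg q) = range (elt q)"
    by (auto simp: elt_def alg_def FactRing_def A_RCOSETS_def' free_ring_simps)
qed

end

text \<open>The inverse of the coordinate isomorphism. It turns annihilator questions in A into
  equations between six scalars.\<close>

definition celt :: "'k::field \<Rightarrow> 'k coords \<Rightarrow> 'k free_algebra set" where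
  "celt q a = elt q (of_coords a)"

lemma elt_eq_celt: "elt q p = celt q (coords q p)"
  by (simp add: celt_def elt_eq_iff coords_of_coords)

lemma carrier_alg: "carrier (alg q) = range (celt q)"
proof -
  have "elt q p \<in> range (celt q)" for p by (simp add: elt_eq_celt)
  then show ?thesis by (auto simp: elt_hom(5) celt_def)
qed

lemma celt_closed [simp]: "celt q a \<in> carrier (alg q)"
  by (simp add: carrier_alg)

lemma celt_eq_iff [simp]: "celt q a = celt q b \<longleftrightarrow> a = b"
  by (simp add: celt_def elt_eq_iff coords_of_coords)

lemma celt_mult: "celt q a \<otimes>\<^bsub>alg q\<^esub> celt q b = celt q (cmult q a b)"
  and celt_add: "celt q a \<oplus>\<^bsub>alg q\<^esub> celt q b = celt q (a + b)"
  and celt_zero: "\<zero>\<^bsub>alg q\<^esub> = celt q 0"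
  by (simp_all add: celt_def elt_hom elt_eq_iff coords_of_coords coords_mult coords_add)

lemma celt_minus: "\<ominus>\<^bsub>alg q\<^esub> celt q a = celt q (- a)"
proof -
  interpret ring "alg q" by (rule ring_alg)
  show ?thesis by (rule minus_equality) (simp_all add: celt_add celt_zero)
qed

lemma celt_zero': "\<zero>\<^bsub>alg q\<^esub> = celt q (0, 0, 0, 0, 0, 0)"
  by (simp add: celt_zero zero_prod_def)

context cyclic_module
begin

lemma lspan_generator: "lspan R N {g} = carrier N"
proof -
  have "carrier N \<subseteq> H" if "submodule H R N" "g \<in> H" for H
    using gen submoduleD(4)[OF that(1) _ that(2)] by auto
  then show ?thesis
    using carrier_submodule g unfolding lspan_def by blast
qed

lemma fg: "fg_module R N"
  unfolding fg_module_def using left_module_axioms lspan_generator g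
  by (intro conjI exI[of _ "{g}"]) auto

lemma hom_eqI:
  assumes "f \<in> lhom R N M" "h \<in> lhom R N M" "f g = h g"
  shows "f = h"
proof (rule lhom_eqI[OF assms(1,2)])
  show "f v = h v" if "v \<in> carrier N" for v
    using gen[OF that] assms g by (auto simp: lhom_smult)
qed

end

section \<open>The matrices D over an arbitrary ring and their annihilators\<close>

definition diff_matrix :: "('a, 'e) ring_scheme \<Rightarrow> 'a \<Rightarrow> 'a \<Rightarrow> 'a \<times> 'a \<times> 'a" where
  "diff_matrix R a b = (\<ominus>\<^bsub>R\<^esub> a, \<one>\<^bsub>R\<^esub>, b)"

context ring
begin

lemma diff_matrix_closed: "a \<in> carrier R \<Longrightarrow> b \<in> carrier R \<Longrightarrow> diff_matrix R a b \<in> carrier (T2 R)"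
  by (simp add: diff_matrix_def T2_simps)

lemma mult_diff_matrix:
  assumes "p1 \<in> carrier R" "p2 \<in> carrier R" "p3 \<in> carrier R" "a \<in> carrier R" "b \<in> carrier R"
  shows "(p1, p2, p3) \<otimes>\<^bsub>T2 R\<^esub> diff_matrix R a b = (\<ominus> (p1 \<otimes> a), p1 \<oplus> p2 \<otimes> b, p3 \<otimes> b)"
  using assms by (simp add: diff_matrix_def T2_simps r_minus)

lemma diff_matrix_mult:
  assumes "p1 \<in> carrier R" "p2 \<in> carrier R" "p3 \<in> carrier R" "a \<in> carrier R" "b \<in> carrier R"
  shows "diff_matrix R a b \<otimes>\<^bsub>T2 R\<^esub> (p1, p2, p3) = (\<ominus> (a \<otimes> p1), p3 \<ominus> a \<otimes> p2, b \<otimes> p3)"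
  using assms by (simp add: diff_matrix_def T2_simps l_minus a_minus_def a_comm)

lemma minus_eq_zero_iff: "x \<in> carrier R \<Longrightarrow> y \<in> carrier R \<Longrightarrow> x \<ominus> y = \<zero> \<longleftrightarrow> x = y"
  by (metis a_minus_def add.inv_closed minus_equality minus_minus r_neg)

lemma neg_eq_zero_iff: "x \<in> carrier R \<Longrightarrow> \<ominus> x = \<zero> \<longleftrightarrow> x = \<zero>"
  by (metis minus_minus minus_zero)

lemma add_eq_zero_iff: "x \<in> carrier R \<Longrightarrow> y \<in> carrier R \<Longrightarrow> x \<oplus> y = \<zero> \<longleftrightarrow> x = \<ominus> y"
  by (metis l_neg minus_equality)

text \<open>The corner entry of the product forces \<open>p1 = - p2 b\<close>, and the first entry
  is then \<open>p2 b a\<close>, which vanishes by itself. Only p3 meets a genuine annihilator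
  condition, and it concerns b.\<close>

lemma diff_matrix_l_ann_pair:
  assumes ab: "a \<in> carrier R" "b \<in> carrier R" and ba: "b \<otimes> a = \<zero>"
    and p: "p1 \<in> carrier R" "p2 \<in> carrier R" "p3 \<in> carrier R"
  shows "(p1, p2, p3) \<otimes>\<^bsub>T2 R\<^esub> diff_matrix R a b = \<zero>\<^bsub>T2 R\<^esub> \<longleftrightarrow> p1 = \<ominus> (p2 \<otimes> b) \<and> p3 \<otimes> b = \<zero>"
  using assms by (auto simp: mult_diff_matrix T2_simps add_eq_zero_iff l_minus m_assoc)

text \<open>The corner entry gives \<open>p3 = a p2\<close>, which settles the last entry because
  \<open>b a = 0\<close>; what remains is the right annihilator of a. Thus for \<open>D_n\<close>
  left annihilators are governed by \<open>u_(n+1)\<close> and right ones by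
  \<open>u_n\<close>.\<close>

lemma diff_matrix_r_ann_pair:
  assumes ab: "a \<in> carrier R" "b \<in> carrier R" and ba: "b \<otimes> a = \<zero>"
    and p: "p1 \<in> carrier R" "p2 \<in> carrier R" "p3 \<in> carrier R"
  shows "diff_matrix R a b \<otimes>\<^bsub>T2 R\<^esub> (p1, p2, p3) = \<zero>\<^bsub>T2 R\<^esub> \<longleftrightarrow> a \<otimes> p1 = \<zero> \<and> p3 = a \<otimes> p2"
proof -
  have "b \<otimes> (a \<otimes> p2) = \<zero>" using assms by (simp flip: m_assoc)
  then show ?thesis
    using assms by (auto simp: diff_matrix_mult T2_simps minus_eq_zero_iff neg_eq_zero_iff)
qed

lemma diff_matrix_image:
  assumes a: "a \<in> carrier R" and b: "b \<in> carrier R" and ba: "b \<otimes> a = \<zero>"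
    and p: "p1 \<in> carrier R" "p2 \<in> carrier R" "p3 \<in> carrier R"
  shows "(\<exists>p'\<in>carrier (T2 R). (p1, p2, p3) = p' \<otimes>\<^bsub>T2 R\<^esub> diff_matrix R a b) \<longleftrightarrow>
    p1 = \<ominus> (p2 \<otimes> a) \<and> (\<exists>y\<in>carrier R. p3 = y \<otimes> b)" (is "?L \<longleftrightarrow> ?R")
proof
  assume ?L
  then obtain y1 y2 y3 where y: "y1 \<in> carrier R" "y2 \<in> carrier R" "y3 \<in> carrier R"
    "(p1, p2, p3) = (y1, y2, y3) \<otimes>\<^bsub>T2 R\<^esub> diff_matrix R a b" by (auto simp: T2_simps)
  then have "p1 = \<ominus> (y1 \<otimes> a)" "p2 = y1 \<oplus> y2 \<otimes> b" "p3 = y3 \<otimes> b" using a b by (simp_all add: mult_diff_matrix)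
  then show ?R using y a b ba by (auto simp: l_distr m_assoc)
next
  assume ?R
  then obtain y where y: "y \<in> carrier R" "p3 = y \<otimes> b" "p1 = \<ominus> (p2 \<otimes> a)" by blast
  \<comment> \<open>The corner 1 of the matrix lets p2 itself serve as first entry of the factor,
    with 0 in the middle.\<close>
  then have "(p1, p2, p3) = (p2, \<zero>, y) \<otimes>\<^bsub>T2 R\<^esub> diff_matrix R a b" using a b p by (simp add: mult_diff_matrix)
  then show ?L using y p by (intro bexI[of _ "(p2, \<zero>, y)"]) (simp_all add: T2_simps)
qed

lemma diff_matrix_l_ann:
  assumes a: "a \<in> carrier R" and b: "b \<in> carrier R" and c: "c \<in> carrier R"
    and ba: "b \<otimes> a = \<zero>" and cb: "c \<otimes> b = \<zero>"
    and ann: "\<And>x. x \<in> carrier R \<Longrightarrow> x \<otimes> b = \<zero> \<longleftrightarrow> (\<exists>y\<in>carrier R. x = y \<otimes> c)"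
    and p: "p \<in> carrier (T2 R)"
  shows "p \<otimes>\<^bsub>T2 R\<^esub> diff_matrix R a b = \<zero>\<^bsub>T2 R\<^esub> \<longleftrightarrow> (\<exists>p'\<in>carrier (T2 R). p = p' \<otimes>\<^bsub>T2 R\<^esub> diff_matrix R b c)"
proof -
  obtain p1 p2 p3 where p': "p = (p1, p2, p3)" "p1 \<in> carrier R" "p2 \<in> carrier R" "p3 \<in> carrier R"
    using p by (cases p) (simp add: T2_simps)
  show ?thesis
    unfolding p'(1) diff_matrix_l_ann_pair[OF a b ba p'(2-)] diff_matrix_image[OF b c cb p'(2-)] ann[OF p'(4)] ..
qed

lemma diff_matrix_r_ann:
  assumes z: "z \<in> carrier R" and a: "a \<in> carrier R" and b: "b \<in> carrier R"
    and ba: "b \<otimes> a = \<zero>"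
    and ann: "\<And>x. x \<in> carrier R \<Longrightarrow> a \<otimes> x = \<zero> \<longleftrightarrow> (\<exists>y\<in>carrier R. x = z \<otimes> y)"
    and p: "p \<in> carrier (T2 R)"
  shows "diff_matrix R a b \<otimes>\<^bsub>T2 R\<^esub> p = \<zero>\<^bsub>T2 R\<^esub> \<longleftrightarrow> (\<exists>p'\<in>carrier (T2 R). p = diff_matrix R z a \<otimes>\<^bsub>T2 R\<^esub> p')"
    (is "?L \<longleftrightarrow> ?R")
proof -
  have az: "a \<otimes> z = \<zero>" using ann[OF z] z by (metis one_closed r_one)
  obtain p1 p2 p3 where p': "p = (p1, p2, p3)" "p1 \<in> carrier R" "p2 \<in> carrier R" "p3 \<in> carrier R"
    using p by (cases p) (simp add: T2_simps)
  have L: "?L \<longleftrightarrow> a \<otimes> p1 = \<zero> \<and> p3 = a \<otimes> p2"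
    unfolding p'(1) by (rule diff_matrix_r_ann_pair[OF a b ba p'(2-)])
  show ?thesis
  proof
    assume ?L
    then obtain y where y: "y \<in> carrier R" "p1 = z \<otimes> y" "p3 = a \<otimes> p2" using L ann p' by blast
    then have "p = diff_matrix R z a \<otimes>\<^bsub>T2 R\<^esub> (\<ominus> y, \<zero>, p2)"
      using a z p' by (simp add: diff_matrix_mult r_minus a_minus_def)
    then show ?R using y p' by (intro bexI[of _ "(\<ominus> y, \<zero>, p2)"]) (simp_all add: T2_simps)
  next
    assume ?R
    then obtain y1 y2 y3 where y: "y1 \<in> carrier R" "y2 \<in> carrier R" "y3 \<in> carrier R"
      "p = diff_matrix R z a \<otimes>\<^bsub>T2 R\<^esub> (y1, y2, y3)" by (auto simp: T2_simps)
    then have eq: "p1 = \<ominus> (z \<otimes> y1)" "p2 = y3 \<ominus> z \<otimes> y2" "p3 = a \<otimes> y3"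
      using a z p'(1) by (simp_all add: diff_matrix_mult)
    have "a \<otimes> (z \<otimes> y1) = \<zero>" "a \<otimes> (z \<otimes> y2) = \<zero>" using a z y az by (simp_all flip: m_assoc)
    then show ?L unfolding L using eq y a z by (simp add: r_minus r_distr a_minus_def)
  qed
qed

end

section \<open>The elements \<open>u_seq n\<close> and their annihilators in A\<close>

locale skew_parameter =
  fixes q c :: "'k::field"
  assumes q: "q \<noteq> 0" "\<forall>n::nat. n \<ge> 1 \<longrightarrow> q ^ n \<noteq> 1"
begin

text \<open>The product is empty at n = 1, so that \<open>c_seq 1 = c\<close>; passing from j to j +
  1 multiplies by the factor that solves \<open>c_step\<close>.\<close>

definition c_seq :: "int \<Rightarrow> 'k" where
  "c_seq n = (if n \<le> 0 then 0 else c * (\<Prod>j\<in>{1..<n}. - 1 / (1 - q powi j)))"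

definition u_seq :: "int \<Rightarrow> 'k free_algebra set" where
  "u_seq n = celt q (0, 1, - (q powi n), c_seq n, 0, 0)"

abbreviation "A \<equiv> alg q"
interpretation A: ring A by (rule ring_alg)

lemma powi_neq_1: "n \<noteq> 0 \<Longrightarrow> q powi n \<noteq> 1"
  using q(2)[rule_format, of "nat \<bar>n\<bar>"]
  by (cases "n \<ge> 0") (auto simp: power_int_def power_inverse)

lemma q_neq_1: "q \<noteq> 1" using q(2)[rule_format, of 1] by simp

lemma powi_Suc: "q powi (n + 1) = q * q powi n" "q powi (1 + n) = q * q powi n"
  using q by (simp_all add: power_int_add)

text \<open>This expression is the coefficient of \<open>zx\<close> in \<open>u_(n+1) u_n\<close>.
  At n = 0 the factor is zero, which leaves c free; for n > 0 it is invertible because q has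
  infinite order.\<close>

lemma c_step: "c_seq n + c_seq (n + 1) * (1 - q powi n) = 0"
proof (cases "n \<le> 0")
  case True
  then show ?thesis by (cases "n = 0") (simp_all add: c_seq_def)
next
  case False
  then have "{1..<n + 1} = insert n {1..<n}" by auto
  then have "c_seq (n + 1) = c_seq n * (- 1 / (1 - q powi n))"
    using False by (simp add: c_seq_def)
  then show ?thesis using powi_neq_1[of n] False by simp
qed

lemma u_closed [simp]: "u_seq n \<in> carrier A"
  by (simp add: u_seq_def)

lemma elt_u: "elt q (vx - const q * vy + const c * vz) = u_seq 1" "elt q (vx - vy) = u_seq 0"
  "elt q (vx - const (inverse q) * vy) = u_seq (- 1)"
  by (simp_all add: u_seq_def c_seq_def elt_eq_celt coords_add coords_diff coords_mult
      power_int_minus) (simp_all add: zero_prod_def)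

lemma celt_cases: assumes "x \<in> carrier A"
  obtains a0 a1 a2 a3 a4 a5 where "x = celt q (a0, a1, a2, a3, a4, a5)"
  using assms by (auto simp: carrier_alg)

lemma u_mult_u: "u_seq (n + 1) \<otimes>\<^bsub>A\<^esub> u_seq n = \<zero>\<^bsub>A\<^esub>"
  using c_step[of n] by (simp add: u_seq_def celt_mult celt_zero' powi_Suc algebra_simps)

text \<open>Two divisions are made: by \<open>1 - q^n\<close> to determine the coordinate a3 of
  \<open>z\<close>, and by \<open>1 - q^(n+1)\<close> to reach the coordinate a5 of
  \<open>zx\<close>. The first fails at n = 0, the second at n = -1.\<close>

lemma l_ann_u:
  assumes n: "n \<noteq> 0" "n \<noteq> - 1" and x: "x \<in> carrier A"
  shows "x \<otimes>\<^bsub>A\<^esub> u_seq n = \<zero>\<^bsub>A\<^esub> \<longleftrightarrow> (\<exists>y\<in>carrier A. x = y \<otimes>\<^bsub>A\<^esub> u_seq (n + 1))"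
proof
  obtain a0 a1 a2 a3 a4 a5 where a: "x = celt q (a0, a1, a2, a3, a4, a5)" using x by (rule celt_cases)
  have n1: "1 - q powi n \<noteq> 0" "1 - q powi (n + 1) \<noteq> 0"
    using powi_neq_1[of n] powi_neq_1[of "n + 1"] n by auto
  assume "x \<otimes>\<^bsub>A\<^esub> u_seq n = \<zero>\<^bsub>A\<^esub>"
  then have *: "a0 = 0" "a2 + q * a1 * q powi n = 0" "a1 * c_seq n + a3 * (1 - q powi n) = 0"
    by (simp_all add: a u_seq_def celt_mult celt_zero' algebra_simps)
  have "a1 * c_seq n + (a1 * c_seq (n + 1)) * (1 - q powi n) = 0"
    using c_step[of n] by (simp add: algebra_simps flip: distrib_left)
  with *(3) have "(a1 * c_seq (n + 1)) * (1 - q powi n) = a3 * (1 - q powi n)"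
    by (metis add_left_cancel)
  then have a3: "a1 * c_seq (n + 1) = a3" using n1 by simp
  have a2: "a2 = - (a1 * (q * q powi n))" using *(2) by (simp add: algebra_simps eq_neg_iff_add_eq_0)
  define w where "w = a5 / (1 - q powi (n + 1))"
  have "w * (1 - q powi (n + 1)) = a5" using n1 by (simp add: w_def)
  then have w: "w - w * (q * q powi n) = a5" by (simp add: right_diff_distrib powi_Suc)
  have "x = celt q (a1, 0, a4, w, 0, 0) \<otimes>\<^bsub>A\<^esub> u_seq (n + 1)"
    by (simp add: a u_seq_def celt_mult *(1) a3 a2 w powi_Suc)
  then show "\<exists>y\<in>carrier A. x = y \<otimes>\<^bsub>A\<^esub> u_seq (n + 1)" using celt_closed by blast
next
  assume "\<exists>y\<in>carrier A. x = y \<otimes>\<^bsub>A\<^esub> u_seq (n + 1)"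
  then obtain y where "y \<in> carrier A" "x = y \<otimes>\<^bsub>A\<^esub> u_seq (n + 1)" by blast
  then show "x \<otimes>\<^bsub>A\<^esub> u_seq n = \<zero>\<^bsub>A\<^esub>" by (simp add: A.m_assoc u_mult_u)
qed

text \<open>Right factors reach \<open>yx\<close> through y with coefficient -q and
  \<open>zx\<close> through z with coefficient 1. Only q is ever inverted, so there are no
  exceptional n.\<close>

lemma r_ann_u:
  assumes x: "x \<in> carrier A"
  shows "u_seq (n + 1) \<otimes>\<^bsub>A\<^esub> x = \<zero>\<^bsub>A\<^esub> \<longleftrightarrow> (\<exists>y\<in>carrier A. x = u_seq n \<otimes>\<^bsub>A\<^esub> y)"
proof
  obtain a0 a1 a2 a3 a4 a5 where a: "x = celt q (a0, a1, a2, a3, a4, a5)" using x by (rule celt_cases)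
  assume "u_seq (n + 1) \<otimes>\<^bsub>A\<^esub> x = \<zero>\<^bsub>A\<^esub>"
  then have *: "a0 = 0" "- (a1 * (q * q powi n)) = a2 * q" "a3 + c_seq (n + 1) * (a1 + a2) = 0"
    by (simp_all add: a u_seq_def celt_mult celt_zero' powi_Suc algebra_simps)
  have "a2 * q = - (q powi n * a1) * q" using *(2) by (simp add: mult_ac)
  then have a2: "a2 = - (q powi n * a1)" using mult_right_cancel[OF q(1)] by blast
  have "c_seq n * a1 + c_seq (n + 1) * (a1 + a2) = (c_seq n + c_seq (n + 1) * (1 - q powi n)) * a1"
    by (simp add: a2 algebra_simps)
  also have "\<dots> = 0" by (simp only: c_step mult_zero_left)
  finally have a3: "a3 = c_seq n * a1" using *(3) by (metis add_right_cancel)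
  \<comment> \<open>The coefficient \<open>- a4 / q\<close> of y produces a4 times
    \<open>yx\<close>; the summand \<open>c_seq n * a4 / q\<close> at z cancels the multiple of
    \<open>zx\<close> that y brings along.\<close>
  have "x = u_seq n \<otimes>\<^bsub>A\<^esub> celt q (a1, 0, - a4 / q, a5 + c_seq n * a4 / q, 0, 0)"
    using q by (simp add: a u_seq_def celt_mult *(1) a3 a2)
  then show "\<exists>y\<in>carrier A. x = u_seq n \<otimes>\<^bsub>A\<^esub> y" using celt_closed by blast
next
  assume "\<exists>y\<in>carrier A. x = u_seq n \<otimes>\<^bsub>A\<^esub> y"
  then obtain y where "y \<in> carrier A" "x = u_seq n \<otimes>\<^bsub>A\<^esub> y" by blast
  then show "u_seq (n + 1) \<otimes>\<^bsub>A\<^esub> x = \<zero>\<^bsub>A\<^esub>" by (simp add: u_mult_u flip: A.m_assoc)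
qed

text \<open>The ideal generated by x - y in coordinates, by \<open>genideal_u0\<close>, and at the
  same time the left annihilator of \<open>u_seq (- 1)\<close>. It is strictly larger than A(x - y),
  whose elements have coordinate 0 at \<open>zx\<close>.\<close>

definition J where "J = {celt q (0, s, - s, 0, t, r) | s t r. True}"

lemma mem_J: "celt q (a0, a1, a2, a3, a4, a5) \<in> J \<longleftrightarrow> a0 = 0 \<and> a2 = - a1 \<and> a3 = 0"
  by (auto simp: J_def)

lemma l_ann_u_minus_1: assumes x: "x \<in> carrier A" shows "x \<otimes>\<^bsub>A\<^esub> u_seq (- 1) = \<zero>\<^bsub>A\<^esub> \<longleftrightarrow> x \<in> J"
proof -
  obtain a0 a1 a2 a3 a4 a5 where a: "x = celt q (a0, a1, a2, a3, a4, a5)" using x by (rule celt_cases)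
  have "1 - inverse q \<noteq> 0" using powi_neq_1[of "-1"] by (simp add: power_int_minus)
  moreover have "x \<otimes>\<^bsub>A\<^esub> u_seq (- 1) =
      celt q (0, a0, - (a0 * inverse q), 0, a2 + a1, a3 * (1 - inverse q))"
    using q(1) by (simp add: a u_seq_def c_seq_def celt_mult power_int_minus right_diff_distrib)
  ultimately show ?thesis
    by (auto simp: a mem_J celt_zero' eq_neg_iff_add_eq_0)
qed

lemma ideal_J: "ideal J A"
proof (rule idealI[OF ring_alg])
  show "subgroup J (add_monoid A)"
  proof (rule group.subgroupI[OF A.a_group])
    show "J \<subseteq> carrier (add_monoid A)" by (auto simp: J_def)
    show "J \<noteq> {}" by (auto simp: J_def)
    fix a b assume "a \<in> J" "b \<in> J"
    then show "a \<otimes>\<^bsub>add_monoid A\<^esub> b \<in> J" by (auto simp: J_def celt_add)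
  next
    fix a assume "a \<in> J"
    then obtain s t r where a: "a = celt q (0, s, - s, 0, t, r)" by (auto simp: J_def)
    show "inv\<^bsub>add_monoid A\<^esub> a \<in> J"
      unfolding a_inv_def[symmetric] a celt_minus by (simp add: mem_J)
  qed
  fix a x assume "a \<in> J" "x \<in> carrier A"
  then show "x \<otimes>\<^bsub>A\<^esub> a \<in> J" "a \<otimes>\<^bsub>A\<^esub> x \<in> J"
    by (auto simp: J_def carrier_alg celt_mult)
qed

lemma genideal_u0: "genideal A {u_seq 0} = J"
proof
  have "u_seq 0 \<in> J" by (simp add: u_seq_def c_seq_def mem_J)
  then show "genideal A {u_seq 0} \<subseteq> J" using ideal_J by (intro A.genideal_minimal) auto
  show "J \<subseteq> genideal A {u_seq 0}"
  proof
    fix x assume "x \<in> J"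
    then obtain s t r where x: "x = celt q (0, s, - s, 0, t, r)" by (auto simp: J_def)
    \<comment> \<open>Right multiples of x - y already exhaust J: the factor -x gives
      \<open>yx\<close> and the factor z gives \<open>zx\<close>.\<close>
    have "x = u_seq 0 \<otimes>\<^bsub>A\<^esub> celt q (s, - t, 0, r, 0, 0)"
      by (simp add: x u_seq_def c_seq_def celt_mult)
    moreover have "u_seq 0 \<in> genideal A {u_seq 0}" using A.genideal_self[of "{u_seq 0}"] by simp
    moreover have "ideal (genideal A {u_seq 0}) A" by (rule A.genideal_ideal) simp
    ultimately show "x \<in> genideal A {u_seq 0}" by (simp add: ideal.I_r_closed)
  qed
qed

section \<open>The submodule defining M(1,-q,c)\<close>

definition K where "K = {celt q (0, s, - (q * s), c * s, t, r) | s t r. True}"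

lemma mem_K: "celt q (a0, a1, a2, a3, a4, a5) \<in> K \<longleftrightarrow> a0 = 0 \<and> a2 = - (q * a1) \<and> a3 = c * a1"
  by (auto simp: K_def)

text \<open>Division by 1 - q makes the coordinate at \<open>zx\<close> reachable, so the left ideal
  generated by \<open>u_seq 1\<close> contains \<open>yx\<close> and \<open>zx\<close>, and with
  them the socle. This is why \<open>M_sub\<close> is a principal left ideal and M has a single
  relation.\<close>

lemma K_eq: "K = (\<lambda>a. a \<otimes>\<^bsub>A\<^esub> u_seq 1) ` carrier A"
proof
  show "(\<lambda>a. a \<otimes>\<^bsub>A\<^esub> u_seq 1) ` carrier A \<subseteq> K"
    by (auto simp: carrier_alg u_seq_def c_seq_def celt_mult mem_K)
  show "K \<subseteq> (\<lambda>a. a \<otimes>\<^bsub>A\<^esub> u_seq 1) ` carrier A"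
  proof
    fix x assume "x \<in> K"
    then obtain s t r where x: "x = celt q (0, s, - (q * s), c * s, t, r)" by (auto simp: K_def)
    define w where "w = r / (1 - q)"
    have "w * (1 - q) = r" using q_neq_1 by (simp add: w_def)
    then have "w - w * q = r" by (simp add: right_diff_distrib)
    then have "x = celt q (s, 0, t, w, 0, 0) \<otimes>\<^bsub>A\<^esub> u_seq 1"
      by (simp add: x u_seq_def c_seq_def celt_mult mult.commute)
    then show "x \<in> (\<lambda>a. a \<otimes>\<^bsub>A\<^esub> u_seq 1) ` carrier A" by (rule image_eqI) simp
  qed
qed

interpretation reg: left_module A "regular A" by (rule left_module_regular[OF ring_alg])

lemma submodule_K: "submodule K A (regular A)"
proof (rule reg.submoduleI)
  show "K \<subseteq> carrier (regular A)" by (auto simp: K_def)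
  show "K \<noteq> {}" by (auto simp: K_def)
  show "v \<oplus>\<^bsub>regular A\<^esub> w \<in> K" if "v \<in> K" "w \<in> K" for v w
    using that by (auto simp: K_def celt_add algebra_simps)
  show "a \<odot>\<^bsub>regular A\<^esub> v \<in> K" if "a \<in> carrier A" "v \<in> K" for a v
    using that by (auto simp: K_def carrier_alg celt_mult mem_K mult.left_commute)
qed

text \<open>
  Every nonzero submodule meets the span of \<open>yx\<close> and \<open>zx\<close> nontrivially, so that a simple one is
  contained in it.
\<close>
lemma simple_submodule_subset_K:
  assumes S: "simple_submodule S A (regular A)"
  shows "S \<subseteq> K"
proof -
  let ?B = "{celt q (0, 0, 0, 0, t, r) | t r. True}"
  have S': "submodule S A (regular A)" "S \<noteq> {\<zero>\<^bsub>A\<^esub>}"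
    "\<And>T. submodule T A (regular A) \<Longrightarrow> T \<subseteq> S \<Longrightarrow> T = {\<zero>\<^bsub>A\<^esub>} \<or> T = S"
    using S by (auto simp: simple_submodule_def)
  note Sd = reg.submoduleD[OF S'(1), simplified]
  have "submodule (S \<inter> ?B) A (regular A)"
  proof (rule reg.submoduleI)
    show "S \<inter> ?B \<noteq> {}" using Sd(2) by (auto simp: celt_zero')
    show "v \<oplus>\<^bsub>regular A\<^esub> w \<in> S \<inter> ?B" if "v \<in> S \<inter> ?B" "w \<in> S \<inter> ?B" for v w
      using that Sd(3)[of v w] by (auto simp: celt_add)
    show "a \<odot>\<^bsub>regular A\<^esub> v \<in> S \<inter> ?B" if "a \<in> carrier A" "v \<in> S \<inter> ?B" for a v
      using that Sd(4)[of a v] by (auto simp: celt_mult carrier_alg)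
  qed (use Sd(1) in auto)
  then consider "S \<inter> ?B = {\<zero>\<^bsub>A\<^esub>}" | "S \<inter> ?B = S" using S'(3) by blast
  then show ?thesis
  proof cases
    case 1
    have "S \<subseteq> {\<zero>\<^bsub>A\<^esub>}"
    proof
      fix x assume x: "x \<in> S"
      then have "x \<in> carrier A" using Sd(1) by blast
      then obtain a0 a1 a2 a3 a4 a5 where a: "x = celt q (a0, a1, a2, a3, a4, a5)" by (rule celt_cases)
      have *: "t = 0 \<and> r = 0" if "celt q b \<otimes>\<^bsub>A\<^esub> x = celt q (0, 0, 0, 0, t, r)" for b t r
      proof -
        have "celt q (0, 0, 0, 0, t, r) \<in> S" using Sd(4)[OF celt_closed x, of b] that by simp
        then have "celt q (0, 0, 0, 0, t, r) = \<zero>\<^bsub>A\<^esub>" using 1 by blast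
        then show ?thesis by (simp add: celt_zero')
      qed
      \<comment> \<open>Left multiplication by \<open>yx\<close>, y, z and x moves the coordinates
        at 1, x, y and z in turn into the span of \<open>yx\<close> and \<open>zx\<close>, once the
        earlier ones are known to vanish.\<close>
      have a0: "a0 = 0" using *[of "(0, 0, 0, 0, 1, 0)" a0 0] by (simp add: a celt_mult)
      have a1: "a1 = 0" using *[of "(0, 0, 1, 0, 0, 0)" a1 0] by (simp add: a a0 celt_mult)
      have a2: "a2 = 0" using *[of "(0, 0, 0, 1, 0, 0)" 0 a2] by (simp add: a a0 a1 celt_mult)
      have a3: "a3 = 0" using *[of "(0, 1, 0, 0, 0, 0)" 0 a3] by (simp add: a a0 a1 a2 celt_mult)
      have "x \<in> S \<inter> ?B" using x by (simp add: a a0 a1 a2 a3)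
      then show "x \<in> {\<zero>\<^bsub>A\<^esub>}" unfolding 1 .
    qed
    then show ?thesis using S'(2) Sd(2) by blast
  next
    case 2
    then have "S \<subseteq> ?B" by blast
    moreover have "?B \<subseteq> K" by (auto simp: mem_K)
    ultimately show ?thesis by (rule order_trans)
  qed
qed

lemma M_sub_eq: "M_sub q c = K"
proof -
  let ?S = "socle A (regular A)"
  note Kd = reg.submoduleD[OF submodule_K, simplified]
  have sub: "?S \<subseteq> K"
    unfolding socle_def lspan_def using submodule_K simple_submodule_subset_K by blast
  have zero: "\<zero>\<^bsub>A\<^esub> \<in> ?S"
    unfolding socle_def lspan_def using reg.submoduleD(2) by auto
  have "K <+>\<^bsub>A\<^esub> ?S = K"
    unfolding set_add_def'
  proof (intro equalityI subsetI)
    fix x assume "x \<in> (\<Union>h\<in>K. \<Union>k\<in>?S. {h \<oplus>\<^bsub>A\<^esub> k})"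
    then obtain h k where "h \<in> K" "k \<in> ?S" "x = h \<oplus>\<^bsub>A\<^esub> k" by blast
    then show "x \<in> K" using sub Kd(3)[of h k] by blast
  next
    fix x assume "x \<in> K"
    moreover have "x \<in> {x \<oplus>\<^bsub>A\<^esub> \<zero>\<^bsub>A\<^esub>}" using Kd(1) \<open>x \<in> K\<close> by auto
    ultimately show "x \<in> (\<Union>h\<in>K. \<Union>k\<in>?S. {h \<oplus>\<^bsub>A\<^esub> k})" using zero by blast
  qed
  then show ?thesis by (simp add: M_sub_def elt_u K_eq)
qed

end

section \<open>The module \<open>X(c)\<close>\<close>

lemma coset_regular: "S +>\<^bsub>regular R\<^esub> a = S +>\<^bsub>R\<^esub> a"
  by (simp add: a_r_coset_def r_coset_def)

context skew_parameter
begin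

interpretation A: ring A by (rule ring_alg)
interpretation reg: left_module A "regular A" by (rule left_module_regular[OF ring_alg])
interpretation Q: quotient_module A "regular A" K
  by (intro quotient_module.intro quotient_module_axioms.intro reg.left_module_axioms submodule_K)

abbreviation "\<Lambda> \<equiv> T2 A"
abbreviation "D n \<equiv> diff_matrix A (u_seq n) (u_seq (n + 1))"

interpretation \<Lambda>: ring \<Lambda> by (rule ring_T2[OF ring_alg])

abbreviation "M \<equiv> M_module q c"
abbreviation "gM \<equiv> M_res q c \<one>\<^bsub>A\<^esub>"
abbreviation "Xc \<equiv> X_module q c"
abbreviation "gX \<equiv> (one A, gM)"
abbreviation "X_dual \<equiv> T2_right (right_ideal_module q) (regular (opp A)) id"
abbreviation "X_bidual \<equiv> T2_left (regular A) (two_sided_ideal_module q) id"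

lemma M_eq: "M = quot_module (regular A) K"
  by (simp add: M_module_def M_sub_eq)

lemma M_res_eq: "M_res q c a = K +>\<^bsub>regular A\<^esub> a"
  by (simp add: M_res_def M_sub_eq coset_regular)

lemma left_module_M: "left_module A M"
  unfolding M_eq by (rule Q.left_module_quot)

lemma carrier_M: "carrier M = M_res q c ` carrier A"
  by (simp add: M_eq M_res_eq Q.carrier_quot image_def)

lemma M_res_smult: "a \<in> carrier A \<Longrightarrow> a \<odot>\<^bsub>M\<^esub> gM = M_res q c a"
  by (simp add: M_eq M_res_eq Q.smult_quot)

lemma M_res_zero_iff: "a \<in> carrier A \<Longrightarrow> M_res q c a = \<zero>\<^bsub>M\<^esub> \<longleftrightarrow> a \<in> K"
  by (simp add: M_eq M_res_eq Q.zero_quot Q.coset_eq_iff a_minus_def minus_regular ring_alg)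

lemma cyclic_M: "cyclic_module A M gM (u_seq 1)"
proof -
  interpret M: left_module A M by (rule left_module_M)
  show ?thesis
  proof unfold_locales
    show "gM \<in> carrier M" by (simp add: carrier_M)
    show "\<exists>a\<in>carrier A. v = a \<odot>\<^bsub>M\<^esub> gM" if "v \<in> carrier M" for v
      using that M_res_smult by (auto simp: carrier_M)
    show "a \<odot>\<^bsub>M\<^esub> gM = \<zero>\<^bsub>M\<^esub> \<longleftrightarrow> (\<exists>b\<in>carrier A. a = b \<otimes>\<^bsub>A\<^esub> u_seq 1)" if "a \<in> carrier A" for a
      using that by (auto simp: M_res_smult M_res_zero_iff K_eq)
  qed simp
qed

interpretation M: cyclic_module A M gM "u_seq 1" by (rule cyclic_M)

text \<open>The relation \<open>u_1 u_0 = 0\<close> makes the map well defined, and its value on the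
  generator determines it; together they discharge the definite description in
  \<open>f1\<close>.\<close>

lemma f1_hom: "f1 q c \<in> lhom A M (regular A)" and f1_gM: "f1 q c gM = u_seq 0"
proof -
  have "u_seq 1 \<odot>\<^bsub>regular A\<^esub> u_seq 0 = \<zero>\<^bsub>regular A\<^esub>" using u_mult_u[of 0] by simp
  then obtain f where f: "f \<in> lhom A M (regular A)" "f gM = u_seq 0"
    using M.hom_exists[OF reg.left_module_axioms, of "u_seq 0"] by auto
  have "\<exists>!f. f \<in> lhom A M (regular A) \<and> f gM = elt q (vx - vy)"
  proof (rule ex1I)
    show "f \<in> lhom A M (regular A) \<and> f gM = elt q (vx - vy)" using f by (simp add: elt_u)
    show "h = f" if "h \<in> lhom A M (regular A) \<and> h gM = elt q (vx - vy)" for h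
      using that f by (intro M.hom_eqI) (simp_all add: elt_u)
  qed
  from theI'[OF this] have "f1 q c \<in> lhom A M (regular A) \<and> f1 q c gM = elt q (vx - vy)"
    unfolding f1_def .
  then show "f1 q c \<in> lhom A M (regular A)" "f1 q c gM = u_seq 0" by (simp_all add: elt_u)
qed

lemma f1_M_res: "a \<in> carrier A \<Longrightarrow> f1 q c (M_res q c a) = a \<otimes>\<^bsub>A\<^esub> u_seq 0"
  using lhom_smult[OF f1_hom _ M.g, of a] by (simp add: M_res_smult f1_gM)

text \<open>The coset consists of a plus left multiples of \<open>u_seq 1\<close>, which right
  multiplication by \<open>u_seq 0\<close> kills; hence the image is a singleton and
  \<open>the_elem\<close> is meaningful.\<close>

lemma right_mult_M_res:
  assumes a: "a \<in> carrier A"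
  shows "right_mult A (u_seq 0) (M_res q c a) = a \<otimes>\<^bsub>A\<^esub> u_seq 0"
proof -
  have "x \<otimes>\<^bsub>A\<^esub> u_seq 0 = a \<otimes>\<^bsub>A\<^esub> u_seq 0" if "x \<in> M_res q c a" for x
  proof -
    obtain b where b: "b \<in> carrier A" "x = b \<otimes>\<^bsub>A\<^esub> u_seq 1 \<oplus>\<^bsub>A\<^esub> a"
      using \<open>x \<in> M_res q c a\<close> by (auto simp: M_res_def M_sub_eq K_eq a_r_coset_def')
    then show ?thesis
      using a u_mult_u[of 0] by (simp add: A.l_distr A.m_assoc)
  qed
  moreover have "a \<in> M_res q c a"
    unfolding M_res_eq by (rule Q.K.a_rcos_self) (simp add: a)
  ultimately have "(\<lambda>x. x \<otimes>\<^bsub>A\<^esub> u_seq 0) ` M_res q c a = {a \<otimes>\<^bsub>A\<^esub> u_seq 0}" by blast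
  then show ?thesis by (simp add: right_mult_def)
qed


lemma left_module_X: "left_module \<Lambda> Xc"
  unfolding X_module_def
proof (rule left_module_T2_left[OF reg.left_module_axioms left_module_M])
  show "f1 q c v \<in> carrier (regular A)" if "v \<in> carrier M" for v
    using lhom_closed[OF f1_hom that] .
qed (use lhom_add[OF f1_hom] lhom_smult[OF f1_hom] in auto)

lemma carrier_X: "carrier Xc = carrier A \<times> carrier M"
  by (simp add: X_module_def T2_left_simps)

lemma X_smult_gX:
  assumes "a1 \<in> carrier A" "a2 \<in> carrier A" "a3 \<in> carrier A"
  shows "(a1, a2, a3) \<odot>\<^bsub>Xc\<^esub> gX = (a1 \<oplus>\<^bsub>A\<^esub> a2 \<otimes>\<^bsub>A\<^esub> u_seq 0, M_res q c a3)"
  using assms by (simp add: X_module_def T2_left_simps f1_gM M_res_smult)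

lemma D_closed: "D n \<in> carrier \<Lambda>"
  by (rule A.diff_matrix_closed) simp_all

text \<open>A matrix p sends the generator to \<open>(p1 + p2 u_0, p3)\<close> with p3 read modulo
  K. It vanishes when \<open>p1 = - p2 u_0\<close> and p3 is a left multiple of \<open>u_1\<close>,
  and by \<open>diff_matrix_image\<close> these are the multiples of \<open>D 0\<close>.\<close>

lemma cyclic_X: "cyclic_module \<Lambda> Xc gX (D 0)"
proof -
  interpret X: left_module \<Lambda> Xc by (rule left_module_X)
  show ?thesis
  proof unfold_locales
    show "gX \<in> carrier Xc" using M.g by (simp add: carrier_X)
    show "\<exists>a\<in>carrier \<Lambda>. v = a \<odot>\<^bsub>Xc\<^esub> gX" if v: "v \<in> carrier Xc" for v
    proof -
      obtain a b where "a \<in> carrier A" "b \<in> carrier A" "v = (a, M_res q c b)"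
        using v by (auto simp: carrier_X carrier_M)
      then have "v = (a, \<zero>\<^bsub>A\<^esub>, b) \<odot>\<^bsub>Xc\<^esub> gX" "(a, \<zero>\<^bsub>A\<^esub>, b) \<in> carrier \<Lambda>"
        by (simp_all add: X_smult_gX T2_simps)
      then show ?thesis by blast
    qed
    fix p assume "p \<in> carrier \<Lambda>"
    then obtain p1 p2 p3 where p: "p = (p1, p2, p3)" "p1 \<in> carrier A" "p2 \<in> carrier A" "p3 \<in> carrier A"
      by (cases p) (simp add: T2_simps)
    have "p \<odot>\<^bsub>Xc\<^esub> gX = \<zero>\<^bsub>Xc\<^esub> \<longleftrightarrow> p1 = \<ominus>\<^bsub>A\<^esub> (p2 \<otimes>\<^bsub>A\<^esub> u_seq 0) \<and> p3 \<in> K"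
      unfolding p(1) X_smult_gX[OF p(2-)]
      using p by (simp add: X_module_def T2_left_simps A.add_eq_zero_iff M_res_zero_iff)
    also have "\<dots> \<longleftrightarrow> (\<exists>b\<in>carrier \<Lambda>. p = b \<otimes>\<^bsub>\<Lambda>\<^esub> D 0)"
      using A.diff_matrix_image[of "u_seq 0" "u_seq 1" p1 p2 p3] p u_mult_u[of 0]
      by (auto simp: K_eq)
    finally show "p \<odot>\<^bsub>Xc\<^esub> gX = \<zero>\<^bsub>Xc\<^esub> \<longleftrightarrow> (\<exists>b\<in>carrier \<Lambda>. p = b \<otimes>\<^bsub>\<Lambda>\<^esub> D 0)" .
  qed (rule D_closed)
qed

interpretation X: cyclic_module \<Lambda> Xc gX "D 0" by (rule cyclic_X)

text \<open>Only the left annihilator of \<open>u_seq (n + 1)\<close> enters, so the exceptions 0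
  and -1 for \<open>u_seq\<close> become -1 and -2 here.\<close>

lemma D_l_ann:
  assumes "n \<noteq> - 1" "n \<noteq> - 2" "p \<in> carrier \<Lambda>"
  shows "p \<otimes>\<^bsub>\<Lambda>\<^esub> D n = \<zero>\<^bsub>\<Lambda>\<^esub> \<longleftrightarrow> (\<exists>p'\<in>carrier \<Lambda>. p = p' \<otimes>\<^bsub>\<Lambda>\<^esub> D (n + 1))"
  using assms l_ann_u[of "n + 1"] u_mult_u[of n] u_mult_u[of "n + 1"]
  by (intro A.diff_matrix_l_ann) auto

lemma D_r_ann:
  assumes "p \<in> carrier \<Lambda>"
  shows "D (n + 1) \<otimes>\<^bsub>\<Lambda>\<^esub> p = \<zero>\<^bsub>\<Lambda>\<^esub> \<longleftrightarrow> (\<exists>p'\<in>carrier \<Lambda>. p = D n \<otimes>\<^bsub>\<Lambda>\<^esub> p')"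
  using assms r_ann_u[of _ n] u_mult_u[of "n + 1"]
  by (intro A.diff_matrix_r_ann) auto

text \<open>Left annihilators are called upon for n >= 0 only, clear of the exceptions.\<close>

lemma semi_Gorenstein_projective_X: "semi_Gorenstein_projective \<Lambda> Xc"
proof (rule cyclic_semi_Gorenstein_projective[where g = gX and d = "\<lambda>n. D (int n)"])
  fix n p assume p: "p \<in> carrier \<Lambda>"
  show "p \<otimes>\<^bsub>\<Lambda>\<^esub> D (int n) = \<zero>\<^bsub>\<Lambda>\<^esub> \<longleftrightarrow> (\<exists>b\<in>carrier \<Lambda>. p = b \<otimes>\<^bsub>\<Lambda>\<^esub> D (int (Suc n)))"
    using D_l_ann[of "int n" p] p by (simp add: add.commute)
  show "\<exists>b\<in>carrier \<Lambda>. p = D (int n) \<otimes>\<^bsub>\<Lambda>\<^esub> b" if "D (int (Suc n)) \<otimes>\<^bsub>\<Lambda>\<^esub> p = \<zero>\<^bsub>\<Lambda>\<^esub>"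
    using D_r_ann[of p "int n"] p that by (simp add: add.commute)
qed (use X.gen X.ann_g X.g D_closed left_module_X in auto)

text \<open>A generator of the dual: \<open>D (- 1)\<close> generates the right annihilator of
  \<open>D 0\<close>, the relation of X(c).\<close>

definition "xi = (SOME f. f \<in> carrier (dual \<Lambda> Xc) \<and> f gX = D (- 1))"

lemma xi: "xi \<in> carrier (dual \<Lambda> Xc)" "xi gX = D (- 1)"
proof -
  have "D 0 \<otimes>\<^bsub>\<Lambda>\<^esub> D (- 1) = \<zero>\<^bsub>\<Lambda>\<^esub>"
    using D_r_ann[of "D (- 1)" "- 1"] D_closed[of "- 1"] bexI[OF _ \<Lambda>.one_closed] by auto
  then have "\<exists>f. f \<in> carrier (dual \<Lambda> Xc) \<and> f gX = D (- 1)"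
    using X.dual_exists[OF D_closed[of "- 1"]] by auto
  from someI_ex[OF this] show "xi \<in> carrier (dual \<Lambda> Xc)" "xi gX = D (- 1)" by (simp_all add: xi_def)
qed

lemma cyclic_dual_X: "cyclic_module (opp \<Lambda>) (dual \<Lambda> Xc) xi (D (- 2))"
  using D_r_ann[of _ "- 1"] D_r_ann[of _ "- 2"]
  by (intro X.cyclic_dual xi(1) D_closed) (auto simp: xi(2))

interpretation X': cyclic_module "opp \<Lambda>" "dual \<Lambda> Xc" xi "D (- 2)" by (rule cyclic_dual_X)

text \<open>Over the opposite ring the two sides change places: the resolution through
  \<open>D (- 2), D (- 3), ...\<close> is exact by right annihilators, and its dual by left
  annihilators of \<open>D n\<close> with n <= -3, beyond the exceptions.\<close>

lemma semi_Gorenstein_projective_dual_X: "semi_Gorenstein_projective (opp \<Lambda>) (dual \<Lambda> Xc)"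
proof (rule cyclic_semi_Gorenstein_projective[where g = xi and d = "\<lambda>n. D (- 2 - int n)"])
  fix n p assume p: "p \<in> carrier (opp \<Lambda>)"
  have n: "- 2 - int n = - 3 - int n + 1" "- 2 - int (Suc n) = - 3 - int n" by simp_all
  show "p \<otimes>\<^bsub>opp \<Lambda>\<^esub> D (- 2 - int n) = \<zero>\<^bsub>opp \<Lambda>\<^esub> \<longleftrightarrow>
      (\<exists>b\<in>carrier (opp \<Lambda>). p = b \<otimes>\<^bsub>opp \<Lambda>\<^esub> D (- 2 - int (Suc n)))"
    using D_r_ann[of p "- 3 - int n"] p unfolding n by (simp only: mult_opp carrier_opp zero_opp)
  show "\<exists>b\<in>carrier (opp \<Lambda>). p = D (- 2 - int n) \<otimes>\<^bsub>opp \<Lambda>\<^esub> b"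
    if "D (- 2 - int (Suc n)) \<otimes>\<^bsub>opp \<Lambda>\<^esub> p = \<zero>\<^bsub>opp \<Lambda>\<^esub>"
    using D_l_ann[of "- 3 - int n" p] p that unfolding n by (simp only: mult_opp carrier_opp zero_opp)
next
  fix m
  show "D (- 2 - int m) \<in> carrier (opp \<Lambda>)"
    using D_closed[of "- 2 - int m"] by (simp only: carrier_opp)
qed (use X'.gen X'.ann_g X'.g X'.left_module_axioms in auto)


section \<open>The dual and the bidual of X(c)\<close>

lemma two_sided_eq: "two_sided_ideal_module q = (regular A)\<lparr>carrier := J\<rparr>"
  by (simp add: two_sided_ideal_module_def elt_u genideal_u0)

lemma carrier_X_bidual: "carrier X_bidual = carrier A \<times> J"
  by (simp add: T2_left_simps two_sided_eq)

lemma carrier_X_dual: "carrier X_dual = (\<lambda>a. u_seq (- 1) \<otimes>\<^bsub>A\<^esub> a) ` carrier A \<times> carrier A"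
  by (simp add: T2_right_simps right_ideal_module_def elt_u)

text \<open>The values at the generator form the right annihilator of \<open>D 0\<close>: the
  triples \<open>(b1, b2, u_0 b2)\<close> with \<open>u_0 b1 = 0\<close>, that is, with b1 in
  \<open>u_(-1) A\<close>. The last entry is determined by b2, so the first two can serve as
  coordinates.\<close>

lemma liso_dual_X: "liso (opp \<Lambda>) (dual \<Lambda> Xc) X_dual"
proof -
  let ?h = "\<lambda>f\<in>carrier (dual \<Lambda> Xc). (fst (f gX), fst (snd (f gX)))"
  have val: "\<exists>b1\<in>carrier A. \<exists>b2\<in>carrier A. f gX = (b1, b2, u_seq 0 \<otimes>\<^bsub>A\<^esub> b2) \<and>
      b1 \<in> (\<lambda>a. u_seq (- 1) \<otimes>\<^bsub>A\<^esub> a) ` carrier A"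
    if f: "f \<in> carrier (dual \<Lambda> Xc)" for f
  proof -
    obtain b1 b2 b3 where b: "f gX = (b1, b2, b3)" "b1 \<in> carrier A" "b2 \<in> carrier A" "b3 \<in> carrier A"
      using X.dual_closed[OF f X.g] by (cases "f gX") (simp add: T2_simps)
    have "u_seq 0 \<otimes>\<^bsub>A\<^esub> b1 = \<zero>\<^bsub>A\<^esub>" "b3 = u_seq 0 \<otimes>\<^bsub>A\<^esub> b2"
      using X.dual_ann[OF f] A.diff_matrix_r_ann_pair[of "u_seq 0" "u_seq 1" b1 b2 b3] b u_mult_u[of 0] by auto
    then show ?thesis using b r_ann_u[of b1 "- 1"] by (auto simp: image_iff)
  qed
  have hom: "?h \<in> lhom (opp \<Lambda>) (dual \<Lambda> Xc) X_dual"
  proof (rule lhomI)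
    show "?h \<in> carrier (dual \<Lambda> Xc) \<rightarrow>\<^sub>E carrier X_dual"
      using val by (fastforce simp: carrier_X_dual)
    fix f f' assume f: "f \<in> carrier (dual \<Lambda> Xc)" "f' \<in> carrier (dual \<Lambda> Xc)"
    have "(f \<oplus>\<^bsub>dual \<Lambda> Xc\<^esub> f') gX = f gX \<oplus>\<^bsub>\<Lambda>\<^esub> f' gX"
      using X.g by (simp add: dual_simps(3))
    then show "?h (f \<oplus>\<^bsub>dual \<Lambda> Xc\<^esub> f') = ?h f \<oplus>\<^bsub>X_dual\<^esub> ?h f'"
      using f val[OF f(1)] val[OF f(2)] X'.M.a_closed[OF f]
      by (auto simp: T2_simps T2_right_simps right_ideal_module_def)
  next
    fix p f assume p: "p \<in> carrier (opp \<Lambda>)" and f: "f \<in> carrier (dual \<Lambda> Xc)"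
    have "(p \<odot>\<^bsub>dual \<Lambda> Xc\<^esub> f) gX = f gX \<otimes>\<^bsub>\<Lambda>\<^esub> p"
      using X.g by (simp add: dual_simps(4))
    then show "?h (p \<odot>\<^bsub>dual \<Lambda> Xc\<^esub> f) = p \<odot>\<^bsub>X_dual\<^esub> ?h f"
      using f val[OF f] X'.smult_closed[OF p f] p
      by (cases p) (auto simp: T2_simps T2_right_simps right_ideal_module_def)
  qed
  have "bij_betw ?h (carrier (dual \<Lambda> Xc)) (carrier X_dual)"
  proof (rule bij_betwI')
    fix f f' assume f: "f \<in> carrier (dual \<Lambda> Xc)" "f' \<in> carrier (dual \<Lambda> Xc)"
    show "?h f = ?h f' \<longleftrightarrow> f = f'"
      using f val[OF f(1)] val[OF f(2)] X.dual_eqI[OF f] by auto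
  next
    show "?h f \<in> carrier X_dual" if "f \<in> carrier (dual \<Lambda> Xc)" for f
      using lhom_closed[OF hom that] .
  next
    fix y assume "y \<in> carrier X_dual"
    then obtain a b where y: "a \<in> carrier A" "b \<in> carrier A" "y = (u_seq (- 1) \<otimes>\<^bsub>A\<^esub> a, b)"
      by (auto simp: carrier_X_dual)
    have "u_seq 0 \<otimes>\<^bsub>A\<^esub> (u_seq (- 1) \<otimes>\<^bsub>A\<^esub> a) = \<zero>\<^bsub>A\<^esub>"
      using u_mult_u[of "- 1"] y by (simp flip: A.m_assoc)
    then have "D 0 \<otimes>\<^bsub>\<Lambda>\<^esub> (u_seq (- 1) \<otimes>\<^bsub>A\<^esub> a, b, u_seq 0 \<otimes>\<^bsub>A\<^esub> b) = \<zero>\<^bsub>\<Lambda>\<^esub>"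
      using A.diff_matrix_r_ann_pair[of "u_seq 0" "u_seq 1" "u_seq (- 1) \<otimes>\<^bsub>A\<^esub> a" b "u_seq 0 \<otimes>\<^bsub>A\<^esub> b"]
        y u_mult_u[of 0] by simp
    then obtain f where "f \<in> carrier (dual \<Lambda> Xc)" "f gX = (u_seq (- 1) \<otimes>\<^bsub>A\<^esub> a, b, u_seq 0 \<otimes>\<^bsub>A\<^esub> b)"
      using X.dual_exists[of "(u_seq (- 1) \<otimes>\<^bsub>A\<^esub> a, b, u_seq 0 \<otimes>\<^bsub>A\<^esub> b)"] y
      by (auto simp: T2_simps)
    then show "\<exists>f\<in>carrier (dual \<Lambda> Xc). y = ?h f" using y by (intro bexI[of _ f]) simp_all
  qed
  then show ?thesis using hom by (auto simp: liso_def lisos_def)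
qed

text \<open>By \<open>bidual_value\<close> the first entry of \<open>F xi\<close> is determined by
  the second, so the remaining two entries lose nothing.\<close>

definition "theta = (\<lambda>F\<in>carrier (bidual \<Lambda> Xc). snd (F xi))"

lemma bidual_eq: "bidual \<Lambda> Xc = dual (opp \<Lambda>) (dual \<Lambda> Xc)"
  by (simp add: bidual_def)

text \<open>\<open>F xi\<close> is killed by right multiplication with \<open>D (- 2)\<close>, and
  this is where the exceptional left annihilator of \<open>u_seq (- 1)\<close> enters: w ranges over
  J and not just over the left multiples of x - y.\<close>

lemma bidual_value:
  assumes F: "F \<in> carrier (bidual \<Lambda> Xc)"
  shows "\<exists>v\<in>carrier A. \<exists>w\<in>J. F xi = (\<ominus>\<^bsub>A\<^esub> (v \<otimes>\<^bsub>A\<^esub> u_seq (- 1)), v, w)"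
proof -
  have F': "F \<in> carrier (dual (opp \<Lambda>) (dual \<Lambda> Xc))" using F by (simp add: bidual_eq)
  obtain p1 p2 p3 where p: "F xi = (p1, p2, p3)" "p1 \<in> carrier A" "p2 \<in> carrier A" "p3 \<in> carrier A"
    using X'.dual_closed[OF F' X'.g] by (cases "F xi") (simp add: T2_simps)
  have "(p1, p2, p3) \<otimes>\<^bsub>\<Lambda>\<^esub> D (- 2) = \<zero>\<^bsub>\<Lambda>\<^esub>" using X'.dual_ann[OF F'] p(1) by simp
  then show ?thesis
    using A.diff_matrix_l_ann_pair[of "u_seq (- 2)" "u_seq (- 1)" p1 p2 p3] p u_mult_u[of "- 2"]
      l_ann_u_minus_1[of p3] by auto
qed

lemma theta: "theta \<in> lisos \<Lambda> (bidual \<Lambda> Xc) X_bidual"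
proof -
  interpret B: left_module \<Lambda> "bidual \<Lambda> Xc" using left_module_bidual[OF left_module_X] .
  have hom: "theta \<in> lhom \<Lambda> (bidual \<Lambda> Xc) X_bidual"
  proof (rule lhomI)
    show "theta \<in> carrier (bidual \<Lambda> Xc) \<rightarrow>\<^sub>E carrier X_bidual"
      using bidual_value by (fastforce simp: theta_def carrier_X_bidual)
    fix F F' assume F: "F \<in> carrier (bidual \<Lambda> Xc)" "F' \<in> carrier (bidual \<Lambda> Xc)"
    have "(F \<oplus>\<^bsub>bidual \<Lambda> Xc\<^esub> F') xi = F xi \<oplus>\<^bsub>\<Lambda>\<^esub> F' xi"
      using xi(1) by (simp add: bidual_eq dual_simps(3)[of "opp \<Lambda>"])
    then show "theta (F \<oplus>\<^bsub>bidual \<Lambda> Xc\<^esub> F') = theta F \<oplus>\<^bsub>X_bidual\<^esub> theta F'"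
      using F bidual_value[OF F(1)] bidual_value[OF F(2)] B.M.a_closed[OF F]
      by (auto simp: theta_def T2_simps T2_left_simps two_sided_eq)
  next
    fix p F assume p: "p \<in> carrier \<Lambda>" and F: "F \<in> carrier (bidual \<Lambda> Xc)"
    have "(p \<odot>\<^bsub>bidual \<Lambda> Xc\<^esub> F) xi = p \<otimes>\<^bsub>\<Lambda>\<^esub> F xi"
      using xi(1) by (simp add: bidual_eq dual_simps(4)[of "opp \<Lambda>"])
    then show "theta (p \<odot>\<^bsub>bidual \<Lambda> Xc\<^esub> F) = p \<odot>\<^bsub>X_bidual\<^esub> theta F"
      using F bidual_value[OF F] B.smult_closed[OF p F] p
      by (cases p) (auto simp: theta_def T2_simps T2_left_simps two_sided_eq)
  qed
  have "bij_betw theta (carrier (bidual \<Lambda> Xc)) (carrier X_bidual)"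
  proof (rule bij_betwI')
    fix F F' assume F: "F \<in> carrier (bidual \<Lambda> Xc)" "F' \<in> carrier (bidual \<Lambda> Xc)"
    show "theta F = theta F' \<longleftrightarrow> F = F'"
      using F bidual_value[OF F(1)] bidual_value[OF F(2)] X'.dual_eqI[of F F']
      by (auto simp: theta_def bidual_eq)
  next
    show "theta F \<in> carrier X_bidual" if "F \<in> carrier (bidual \<Lambda> Xc)" for F
      using lhom_closed[OF hom that] .
  next
    fix y assume "y \<in> carrier X_bidual"
    then obtain v w where y: "v \<in> carrier A" "w \<in> J" "y = (v, w)" by (auto simp: carrier_X_bidual)
    have wA: "w \<in> carrier A" using y(2) by (auto simp: J_def)
    let ?l = "(\<ominus>\<^bsub>A\<^esub> (v \<otimes>\<^bsub>A\<^esub> u_seq (- 1)), v, w)"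
    have "?l \<otimes>\<^bsub>\<Lambda>\<^esub> D (- 2) = \<zero>\<^bsub>\<Lambda>\<^esub>"
      using A.diff_matrix_l_ann_pair[of "u_seq (- 2)" "u_seq (- 1)" "\<ominus>\<^bsub>A\<^esub> (v \<otimes>\<^bsub>A\<^esub> u_seq (- 1))" v w]
        y wA u_mult_u[of "- 2"] l_ann_u_minus_1[OF wA] by simp
    then obtain F where "F \<in> carrier (dual (opp \<Lambda>) (dual \<Lambda> Xc))" "F xi = ?l"
      using X'.dual_exists[of ?l] y wA by (auto simp: T2_simps)
    then show "\<exists>F\<in>carrier (bidual \<Lambda> Xc). y = theta F"
      using y by (intro bexI[of _ F]) (simp_all add: theta_def bidual_eq)
  qed
  then show ?thesis using hom by (simp add: lisos_def)
qed

text \<open>Evaluation at \<open>xi\<close> multiplies the representative (a, 0, b) by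
  \<open>D (- 1)\<close>, giving \<open>(- a u_(-1), a, b u_0)\<close>, and \<open>theta\<close>
  removes the first entry.\<close>

lemma theta_canonical:
  assumes a: "a \<in> carrier A" and b: "b \<in> carrier A"
  shows "theta (canonical_map \<Lambda> Xc (a, M_res q c b)) = (a, b \<otimes>\<^bsub>A\<^esub> u_seq 0)"
proof -
  have mem: "(a, M_res q c b) \<in> carrier Xc" using a b by (auto simp: carrier_X carrier_M)
  have "canonical_map \<Lambda> Xc (a, M_res q c b) xi = xi (a, M_res q c b)"
    using mem xi(1) by (simp add: canonical_map_def)
  also have "\<dots> = (a, \<zero>\<^bsub>A\<^esub>, b) \<otimes>\<^bsub>\<Lambda>\<^esub> D (- 1)"
    using X.dual_apply[OF xi(1), of "(a, \<zero>\<^bsub>A\<^esub>, b)"] a b xi(2)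
    by (simp add: X_smult_gX T2_simps)
  finally show ?thesis
    using canonical_map_closed[OF left_module_X mem] a b by (simp add: theta_def A.mult_diff_matrix)
qed

text \<open>The element z satisfies z(x - y) = 0 because \<open>zy = zx\<close>, but it is not in K,
  where the coordinate at z is c times the one at x. Its class therefore refutes injectivity of both
  \<open>f1\<close> and the canonical map.\<close>

definition "z_elt = celt q (0, 0, 0, 1, 0, 0)"

lemma z_elt: "z_elt \<in> carrier A" "z_elt \<notin> K" "z_elt \<otimes>\<^bsub>A\<^esub> u_seq 0 = \<zero>\<^bsub>A\<^esub>"
  by (simp_all add: z_elt_def mem_K u_seq_def c_seq_def celt_mult celt_zero')

lemma M_res_z_elt: "M_res q c z_elt \<noteq> M_res q c \<zero>\<^bsub>A\<^esub>"
proof -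
  have "M_res q c \<zero>\<^bsub>A\<^esub> = \<zero>\<^bsub>M\<^esub>" using M_res_zero_iff[of "\<zero>\<^bsub>A\<^esub>"] by (simp add: celt_zero' mem_K)
  then show ?thesis using M_res_zero_iff[OF z_elt(1)] z_elt(2) by simp
qed

lemma not_monic: "\<not> monic (regular A) M (f1 q c)"
proof
  assume "monic (regular A) M (f1 q c)"
  then have "inj_on (f1 q c) (carrier M)" by (simp add: monic_def)
  moreover have "f1 q c (M_res q c z_elt) = f1 q c (M_res q c \<zero>\<^bsub>A\<^esub>)"
    using z_elt by (simp add: f1_M_res)
  ultimately show False
    using M_res_z_elt z_elt(1) by (auto simp: inj_on_def carrier_M)
qed

lemma canonical_map_not_inj: "\<not> inj_on (canonical_map \<Lambda> Xc) (carrier Xc)"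
proof
  let ?x = "(\<zero>\<^bsub>A\<^esub>, M_res q c z_elt)" and ?y = "(\<zero>\<^bsub>A\<^esub>, M_res q c \<zero>\<^bsub>A\<^esub>)"
  assume inj: "inj_on (canonical_map \<Lambda> Xc) (carrier Xc)"
  have xy: "?x \<in> carrier Xc" "?y \<in> carrier Xc" using z_elt(1) by (auto simp: carrier_X carrier_M)
  have "inj_on theta (carrier (bidual \<Lambda> Xc))" using theta by (simp add: lisos_def bij_betw_def)
  moreover have "theta (canonical_map \<Lambda> Xc ?x) = theta (canonical_map \<Lambda> Xc ?y)"
    using z_elt by (simp add: theta_canonical)
  ultimately have "canonical_map \<Lambda> Xc ?x = canonical_map \<Lambda> Xc ?y"
    using canonical_map_closed[OF left_module_X] xy by (auto dest: inj_onD)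
  then show False using inj xy M_res_z_elt by (auto dest: inj_onD)
qed

lemma canonical_map_not_surj: "canonical_map \<Lambda> Xc ` carrier Xc \<noteq> carrier (bidual \<Lambda> Xc)"
proof
  assume eq: "canonical_map \<Lambda> Xc ` carrier Xc = carrier (bidual \<Lambda> Xc)"
  \<comment> \<open>This is \<open>zx\<close>: it lies in J, but b(x - y) has coordinate b3 - b3 = 0
    at \<open>zx\<close> for every b.\<close>
  let ?w = "celt q (0, 0, 0, 0, 0, 1)"
  have "(\<zero>\<^bsub>A\<^esub>, ?w) \<in> carrier X_bidual" by (simp add: carrier_X_bidual mem_J)
  then have "(\<zero>\<^bsub>A\<^esub>, ?w) \<in> theta ` (canonical_map \<Lambda> Xc ` carrier Xc)"
    using theta unfolding eq by (simp add: lisos_def bij_betw_def)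
  then obtain a m where am: "(a, m) \<in> carrier Xc" "(\<zero>\<^bsub>A\<^esub>, ?w) = theta (canonical_map \<Lambda> Xc (a, m))"
    by auto
  then obtain b where b: "a \<in> carrier A" "b \<in> carrier A" "m = M_res q c b"
    by (auto simp: carrier_X carrier_M)
  then have w: "?w = b \<otimes>\<^bsub>A\<^esub> u_seq 0" using am(2) by (simp add: theta_canonical)
  obtain b0 b1 b2 b3 b4 b5 where "b = celt q (b0, b1, b2, b3, b4, b5)" using b(2) by (rule celt_cases)
  with w show False by (simp add: u_seq_def c_seq_def celt_mult)
qed

section \<open>Ext of the bidual\<close>

lemma J_cases: assumes "x \<in> J" obtains s t r where "x = celt q (0, s, - s, 0, t, r)"
  using assms by (auto simp: J_def)

lemma submodule_J: "submodule J A (regular A)"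
proof -
  interpret J: ideal J A by (rule ideal_J)
  show ?thesis
    using J.a_subset J.zero_closed J.a_closed J.I_l_closed
    by (intro reg.submoduleI) (simp, blast, simp_all)
qed

lemma left_module_X_bidual: "left_module \<Lambda> X_bidual"
  unfolding two_sided_eq using reg.submoduleD(1)[OF submodule_J]
  by (intro left_module_T2_left left_module_submodule reg.left_module_axioms submodule_J) auto

definition coordinate :: "nat \<Rightarrow> 'k free_algebra set \<Rightarrow> 'k" where
  "coordinate i x = (case inv_into UNIV (celt q) x of (a0, a1, a2, a3, a4, a5) \<Rightarrow> [a0, a1, a2, a3, a4, a5] ! i)"

lemma coordinate_celt: "coordinate i (celt q (a0, a1, a2, a3, a4, a5)) = [a0, a1, a2, a3, a4, a5] ! i"
proof -
  have "inj (celt q)" by (rule injI) simp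
  then show ?thesis by (simp add: coordinate_def)
qed

lemma less_6_cases: "i < 6 \<Longrightarrow> i = 0 \<or> i = 1 \<or> i = 2 \<or> i = 3 \<or> i = 4 \<or> i = (5::nat)"
  by auto

lemma coordinate_add:
  assumes "i < 6" "x \<in> carrier A" "y \<in> carrier A"
  shows "coordinate i (x \<oplus>\<^bsub>A\<^esub> y) = coordinate i x + coordinate i y"
  using less_6_cases[OF assms(1)] assms(2,3)
  by (elim celt_cases) (auto simp: celt_add coordinate_celt)

lemma coordinate_scale:
  assumes "i < 6" "x \<in> carrier A"
  shows "coordinate i (celt q (a, 0, 0, 0, 0, 0) \<otimes>\<^bsub>A\<^esub> x) = a * coordinate i x"
  using less_6_cases[OF assms(1)] assms(2)
  by (elim celt_cases) (auto simp: celt_mult coordinate_celt)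

lemma coordinate_eq_0:
  assumes x: "x \<in> carrier A" and 0: "\<And>i. i < 6 \<Longrightarrow> coordinate i x = 0"
  shows "x = \<zero>\<^bsub>A\<^esub>"
proof -
  obtain a0 a1 a2 a3 a4 a5 where a: "x = celt q (a0, a1, a2, a3, a4, a5)" using x by (rule celt_cases)
  show ?thesis
    using 0[of 0] 0[of 1] 0[of 2] 0[of 3] 0[of 4] 0[of 5]
    by (simp add: a coordinate_celt celt_zero')
qed

text \<open>The scalar matrices: through them k acts on \<Lambda>-modules, which makes the
  coordinate functionals linear.\<close>

definition scalar :: "'k \<Rightarrow> _" where
  "scalar a = (celt q (a, 0, 0, 0, 0, 0), celt q (0, 0, 0, 0, 0, 0), celt q (a, 0, 0, 0, 0, 0))"

lemma scalar_closed: "scalar a \<in> carrier \<Lambda>"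
  by (simp add: scalar_def T2_simps)

lemma noetherian_free_T2: "noetherian_free \<Lambda>"
proof (rule noetherian_free_of_coordinates[where \<kappa> = scalar
      and \<Psi> = "(\<lambda>(i, pr) p. coordinate i (pr p)) ` ({..<6} \<times> {fst, fst \<circ> snd, snd \<circ> snd})"])
  fix \<psi> p p' assume \<psi>: "\<psi> \<in> (\<lambda>(i, pr) p. coordinate i (pr p)) ` ({..<6} \<times> {fst, fst \<circ> snd, snd \<circ> snd})"
    and p: "p \<in> carrier \<Lambda>"
  show "\<psi> (p \<oplus>\<^bsub>\<Lambda>\<^esub> p') = \<psi> p + \<psi> p'" if "p' \<in> carrier \<Lambda>"
    using \<psi> p that by (auto simp: T2_simps coordinate_add)
  show "\<psi> (scalar a \<otimes>\<^bsub>\<Lambda>\<^esub> p) = a * \<psi> p" for a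
    using \<psi> p by (auto simp: T2_simps scalar_def coordinate_scale simp flip: celt_zero')
next
  fix p assume p: "p \<in> carrier \<Lambda>"
    and 0: "\<And>\<psi>. \<psi> \<in> (\<lambda>(i, pr) p. coordinate i (pr p)) ` ({..<6} \<times> {fst, fst \<circ> snd, snd \<circ> snd}) \<Longrightarrow> \<psi> p = 0"
  have *: "coordinate i (pr p) = 0" if "i < 6" "pr \<in> {fst, fst \<circ> snd, snd \<circ> snd}" for i pr
    using that by (intro 0[of "\<lambda>p. coordinate i (pr p)"]) auto
  obtain p1 p2 p3 where p': "p = (p1, p2, p3)" "p1 \<in> carrier A" "p2 \<in> carrier A" "p3 \<in> carrier A"
    using p by (cases p) (simp add: T2_simps)
  have "p1 = \<zero>\<^bsub>A\<^esub>" "p2 = \<zero>\<^bsub>A\<^esub>" "p3 = \<zero>\<^bsub>A\<^esub>"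
    using *[of _ fst] *[of _ "fst \<circ> snd"] *[of _ "snd \<circ> snd"] p' by (auto intro!: coordinate_eq_0)
  then show "p = \<zero>\<^bsub>\<Lambda>\<^esub>" by (simp add: p'(1) T2_simps)
qed (simp_all add: \<Lambda>.ring_axioms scalar_closed)

text \<open>Unlike for X(c) and its dual, no explicit resolution is written down: finite dimension
  over k supplies one. Some resolution must exist for the \<open>SOME\<close> in \<open>Ext\<close>
  to be meaningful.\<close>

lemma free_resolution_X_bidual: "\<exists>P. free_resolution \<Lambda> X_bidual P"
proof -
  interpret Y: left_module \<Lambda> X_bidual by (rule left_module_X_bidual)
  have JA: "w \<in> carrier A" if "w \<in> J" for w
    using reg.submoduleD(1)[OF submodule_J] that by auto
  have "\<exists>n. \<exists>h\<in>lhom \<Lambda> (free_module \<Lambda> n) X_bidual.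
      h ` carrier (free_module \<Lambda> n) = carrier X_bidual"
  proof (rule submodule_image_of_free[OF left_module_X_bidual scalar_closed,
        where \<Phi> = "(\<lambda>(i, pr) p. coordinate i (pr p)) ` ({..<6} \<times> {fst, snd})"])
    fix \<phi> p p' assume \<phi>: "\<phi> \<in> (\<lambda>(i, pr) p. coordinate i (pr p)) ` ({..<6} \<times> {fst, snd})"
      and p: "p \<in> carrier X_bidual"
    show "\<phi> (p \<oplus>\<^bsub>X_bidual\<^esub> p') = \<phi> p + \<phi> p'" if "p' \<in> carrier X_bidual"
      using \<phi> p that JA by (auto simp: T2_left_simps two_sided_eq coordinate_add)
    show "\<phi> (scalar a \<odot>\<^bsub>X_bidual\<^esub> p) = a * \<phi> p" for a
      using \<phi> p JA
      by (auto simp: T2_left_simps two_sided_eq scalar_def coordinate_scale simp flip: celt_zero')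
  next
    fix p assume p: "p \<in> carrier X_bidual"
      and 0: "\<And>\<phi>. \<phi> \<in> (\<lambda>(i, pr) p. coordinate i (pr p)) ` ({..<6} \<times> {fst, snd}) \<Longrightarrow> \<phi> p = 0"
    have *: "coordinate i (pr p) = 0" if "i < 6" "pr \<in> {fst, snd}" for i pr
      using that by (intro 0[of "\<lambda>p. coordinate i (pr p)"]) auto
    obtain v w where p': "p = (v, w)" "v \<in> carrier A" "w \<in> carrier A"
      using p JA by (auto simp: carrier_X_bidual)
    have "v = \<zero>\<^bsub>A\<^esub>" "w = \<zero>\<^bsub>A\<^esub>"
      using *[of _ fst] *[of _ snd] p' by (auto intro!: coordinate_eq_0)
    then show "p = \<zero>\<^bsub>X_bidual\<^esub>" by (simp add: p'(1) T2_left_simps two_sided_eq)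
  qed (simp_all add: Y.carrier_submodule)
  then show ?thesis
    using free_resolution_exists[OF \<Lambda>.ring_axioms noetherian_free_T2 left_module_X_bidual] by blast
qed

text \<open>
  \<open>J\<close> is the direct sum of \<open>A (x - y)\<close> and \<open>k zx\<close>; the projection to the second summand is not
  a right multiplication, since a right multiplication annihilating \<open>x - y\<close> is by an element of
  the radical and so annihilates \<open>zx\<close>.
\<close>
lemma not_semi_Gorenstein_projective_bidual: "\<not> semi_Gorenstein_projective \<Lambda> (bidual \<Lambda> Xc)"
proof -
  obtain P where P: "free_resolution \<Lambda> X_bidual P" using free_resolution_X_bidual ..
  have bid: "left_module \<Lambda> (bidual \<Lambda> Xc)" using left_module_bidual[OF left_module_X] .
  define P' where "P' = \<lparr>res_rank = res_rank P, res_diff = res_diff P,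
    res_aug = \<lambda>u\<in>carrier (res_module \<Lambda> P 0).
    (\<lambda>v\<in>carrier X_bidual. inv_into (carrier (bidual \<Lambda> Xc)) theta v) (res_aug P u)\<rparr>"
  have "free_resolution \<Lambda> (bidual \<Lambda> Xc) P'"
    unfolding P'_def
    by (rule free_resolution_transfer[OF \<Lambda>.ring_axioms left_module_X_bidual bid P lisos_inv[OF bid theta]])
  then have P': "resolved_module \<Lambda> (bidual \<Lambda> Xc) P'" using resolved_moduleI[OF bid] by blast
  \<comment> \<open>The transport along \<open>theta\<close> alters only the augmentation, which
    \<open>ext_vanishes\<close> does not mention.\<close>
  have same: "ext_vanishes \<Lambda> P' L i = ext_vanishes \<Lambda> P L i" for L :: "('k free_algebra set \<times> 'k free_algebra set \<times> 'k free_algebra set, 'k free_algebra set \<times> 'k free_algebra set \<times> 'k free_algebra set) module" and i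
    by (simp add: ext_vanishes_def P'_def res_module_def)
  let ?f = "\<lambda>w\<in>J. celt q (0, 0, 0, 0, 0, coordinate 5 w)"
  have f_hom: "?f \<in> lhom A ((regular A)\<lparr>carrier := J\<rparr>) (regular A)"
    by (rule lhomI)
      (auto elim!: J_cases simp: mem_J celt_add celt_mult coordinate_celt carrier_alg)
  have f_not: "\<not> (\<exists>b\<in>carrier A. \<forall>w\<in>J. ?f w = w \<otimes>\<^bsub>A\<^esub> b)"
  proof
    assume "\<exists>b\<in>carrier A. \<forall>w\<in>J. ?f w = w \<otimes>\<^bsub>A\<^esub> b"
    then obtain b where b: "b \<in> carrier A" "\<And>w. w \<in> J \<Longrightarrow> ?f w = w \<otimes>\<^bsub>A\<^esub> b" by blast
    obtain b0 b1 b2 b3 b4 b5 where b': "b = celt q (b0, b1, b2, b3, b4, b5)" using b(1) by (rule celt_cases)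
    have "b0 = 0"
      using b(2)[of "celt q (0, 1, - 1, 0, 0, 0)"] by (simp add: mem_J b' celt_mult coordinate_celt)
    then show False
      using b(2)[of "celt q (0, 0, 0, 0, 0, 1)"] by (simp add: mem_J b' celt_mult coordinate_celt)
  qed
  have "\<not> ext_vanishes \<Lambda> P (regular \<Lambda>) 0"
    by (rule ext_T2_left_ideal_nonzero[OF ring_alg submodule_J f_hom f_not
          resolved_moduleI[OF left_module_X_bidual P, unfolded two_sided_eq]])
  then show ?thesis
    using semi_Gorenstein_projective_iff[OF P'] same by blast
qed

lemma properties_of_X_module:
  "f1 q c \<in> lhom A (M_module q c) (regular A) \<and> f1 q c (M_res q c \<one>\<^bsub>A\<^esub>) = elt q (vx - vy)
    \<and> fg_module \<Lambda> Xc
    \<and> double_semi_Gorenstein_projective \<Lambda> Xc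
    \<and> \<not> monic (regular A) (M_module q c) (f1 q c)
    \<and> \<not> torsionless \<Lambda> Xc
    \<and> (liso (opp \<Lambda>) (dual \<Lambda> Xc) X_dual
      \<and> liso \<Lambda> (bidual \<Lambda> Xc) X_bidual
      \<and> \<not> semi_Gorenstein_projective \<Lambda> (bidual \<Lambda> Xc)
      \<and> \<not> Gorenstein_projective (opp \<Lambda>) (dual \<Lambda> Xc))
    \<and> (\<exists>\<theta> \<in> lisos \<Lambda> (bidual \<Lambda> Xc) X_bidual.
        \<forall>(a, m) \<in> carrier Xc.
          \<theta> (canonical_map \<Lambda> Xc (a, m)) = (a, right_mult A (elt q (vx - vy)) m))
    \<and> \<not> inj_on (canonical_map \<Lambda> Xc) (carrier Xc)
    \<and> canonical_map \<Lambda> Xc ` carrier Xc \<noteq> carrier (bidual \<Lambda> Xc)"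
proof (intro conjI)
  \<comment> \<open>Were the dual Gorenstein-projective, its own dual, which is the bidual of X(c),
    would be semi-Gorenstein-projective.\<close>
  show "\<not> Gorenstein_projective (opp \<Lambda>) (dual \<Lambda> Xc)"
    using not_semi_Gorenstein_projective_bidual
    by (simp add: Gorenstein_projective_def double_semi_Gorenstein_projective_def bidual_eq)
  show "liso \<Lambda> (bidual \<Lambda> Xc) X_bidual" using theta by (auto simp: liso_def)
  have "\<forall>(a, m)\<in>carrier Xc. theta (canonical_map \<Lambda> Xc (a, m)) = (a, right_mult A (elt q (vx - vy)) m)"
    by (auto simp: carrier_X carrier_M elt_u theta_canonical right_mult_M_res)
  with theta show "\<exists>\<theta> \<in> lisos \<Lambda> (bidual \<Lambda> Xc) X_bidual. \<forall>(a, m) \<in> carrier Xc.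
      \<theta> (canonical_map \<Lambda> Xc (a, m)) = (a, right_mult A (elt q (vx - vy)) m)" by blast
qed (use f1_hom f1_gM X.fg semi_Gorenstein_projective_X semi_Gorenstein_projective_dual_X not_monic
    canonical_map_not_inj canonical_map_not_surj liso_dual_X not_semi_Gorenstein_projective_bidual
    in \<open>simp_all add: elt_u double_semi_Gorenstein_projective_def torsionless_def\<close>)

end

theorem proposition6p2:
  fixes q c :: "'k::field"
  assumes "q \<noteq> 0" and "\<forall>n::nat. n \<ge> 1 \<longrightarrow> q ^ n \<noteq> 1"
  defines "A \<equiv> alg q"
    and "\<Lambda> \<equiv> T2 (alg q)"
    and "Xc \<equiv> X_module q c"
    and "X_dual \<equiv> T2_right (right_ideal_module q) (regular (opp (alg q))) id"
    and "X_bidual \<equiv> T2_left (regular (alg q)) (two_sided_ideal_module q) id"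
  shows
    "f1 q c \<in> lhom A (M_module q c) (regular A) \<and> f1 q c (M_res q c \<one>\<^bsub>A\<^esub>) = elt q (vx - vy)
    \<and> fg_module \<Lambda> Xc
    \<and> double_semi_Gorenstein_projective \<Lambda> Xc
    \<and> \<not> monic (regular A) (M_module q c) (f1 q c)
    \<and> \<not> torsionless \<Lambda> Xc
    \<and> (liso (opp \<Lambda>) (dual \<Lambda> Xc) X_dual
      \<and> liso \<Lambda> (bidual \<Lambda> Xc) X_bidual
      \<and> \<not> semi_Gorenstein_projective \<Lambda> (bidual \<Lambda> Xc)
      \<and> \<not> Gorenstein_projective (opp \<Lambda>) (dual \<Lambda> Xc))
    \<and> (\<exists>\<theta> \<in> lisos \<Lambda> (bidual \<Lambda> Xc) X_bidual.
        \<forall>(a, m) \<in> carrier Xc.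
          \<theta> (canonical_map \<Lambda> Xc (a, m)) = (a, right_mult A (elt q (vx - vy)) m))
    \<and> \<not> inj_on (canonical_map \<Lambda> Xc) (carrier Xc)
    \<and> canonical_map \<Lambda> Xc ` carrier Xc \<noteq> carrier (bidual \<Lambda> Xc)"
  unfolding A_def \<Lambda>_def Xc_def X_dual_def X_bidual_def
  by (rule skew_parameter.properties_of_X_module[OF skew_parameter.intro[OF assms(1,2)]])

end
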